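(* Consider the stationary $BMAP/G_n^{(a,b)}/1$ queue described in the context, with $\rho<1$. Then, for $a\le r\le b-1$ and $|z|\le 1$, $$\sum_{n=0}^{\infty}\boldsymbol{\pi}^+(n,r)z^n=\Big(\sum_{i=0}^{a-1}\boldsymbol{\psi}^+(i)\mathbf{C}_{r,i}+\boldsymbol{\psi}^+(r)\Big)\mathbf{A}^{(r)}(z),$$ so that $$\boldsymbol{\pi}^+(n,r)=\Big(\sum_{i=0}^{a-1}\boldsymbol{\psi}^+(i)\mathbf{C}_{r,i}+\boldsymbol{\psi}^+(r)\Big)\mathbf{A}^{(r)}_n,\qquad a\le r\le b-1,\ n\ge 0,$$ and, for $|z|\le1$, wherever $z^b\mathbf{I}-\mathbf{A}^{(b)}(z)$ is invertible, $$ \begin{aligned} \sum_{n=0}^{\infty}\boldsymbol{\pi}^+(n,b)z^n=\Bigg[&\sum_{j=0}^{a-1}\boldsymbol{\psi}^+(j)\Bigg\{\sum_{\ell=a}^{b}\mathbf{C}_{\ell,j}\mathbf{A}^{(\ell)}(z)-\mathbf{C}_{b,j}\mathbf{A}^{(b)}(z)\\ &\qquad+\Big(\mathbf{C}_{b,j}z^b+\sum_{i=b-a+2}^{b+1-j}\tau_i(z)\,\mathbf{Q}_{b+1-j-i}\,z^{b+1-i}-z^j\mathbf{I}\Big)\Bigg\}\\ &+\sum_{j=a}^{b-1}\boldsymbol{\psi}^+(j)\big\{\mathbf{A}^{(j)}(z)-z^j\mathbf{I}\big\}\Bigg]\mathbf{A}^{(b)}(z)\big[z^b\mathbf{I}-\mathbf{A}^{(b)}(z)\big]^{-1}.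 \end{aligned} $$
   Context: **Model.** Customers arrive to a single-server, infinite-buffer queue according to an $m$-state batch Markovian arrival process (BMAP) given by $m\times m$ matrices $\mathbf{D}_k$, $k\ge 0$. The off-diagonal entries of $\mathbf{D}_0$ are the rates of phase transitions without arrival, and $\mathbf{D}_0$ has negative diagonal and nonnegative off-diagonal entries. For $k\ge1$ the entries of $\mathbf{D}_k\ge 0$ are the rates of phase transitions accompanied by the arrival of a batch of $k$ customers. $\mathbf{D}=\sum_{k\ge0}\mathbf{D}_k$ is the generator of the phase process $J(t)$, with stationary probability vector $\overline{\boldsymbol{\pi}}$; $\mathbf{D}_0$ is invertible. The arrival rate is $\lambda^*=\overline{\boldsymbol\pi}\sum_{k\ge1}k\mathbf{D}_k\mathbf{e}$, where $\mathbf{e}$ is the column vector of ones. $\mathbf{I}$ is the identity matrix. Customers are served in batches under the general bulk service $(a,b)$ rule, $1\le a\le b$. When the server is free and the queue contains fewer than $a$ customers, the server stays idle. If it contains $r$ customers with $a\le r\le b$, all are taken into service together. If it contains more than $b$, exactly $b$ are taken and the others wait. Customers arriving during a service do not join that service. Service times are independent of each other and of the arrivals. The service time of a batch of size $r$ has distribution function $S_r$, density $s_r(\cdot)$ and mean $s_r=1/\mu_r$. The traffic intensity is $\rho=\lambda^*/(b\mu_b)<1$ and the system is in steady state. **Departure-epoch vectors.** All vectors are $1\times m$ row vectors indexed by the phase. The $i$-th component $\pi_i^+(n,r)$ of $\boldsymbol\pi^+(n,r)$ ($n\ge0$, $a\le r\le b$) is the steady-state joint probability that, immediately after a departure of a batch,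 there are $n$ customers in the queue, the arrival phase is $i$, and the departing batch has size $r$. $\boldsymbol\psi^+(n)=\sum_{r=a}^b\boldsymbol\pi^+(n,r)$. **Matrices.** $\mathbf{D}(z)=\sum_{k\ge0}\mathbf{D}_kz^k$; for $a\le r\le b$, $\mathbf{A}^{(r)}(z)=\int_0^\infty e^{\mathbf{D}(z)t}\,dS_r(t)=\sum_{k\ge0}\mathbf{A}^{(r)}_kz^k$, so that $\mathbf{A}^{(r)}_k$ is the coefficient of $z^k$ (its $(i,j)$ entry is the probability that, starting from phase $i$, exactly $k$ customers arrive during the service of a batch of size $r$ and the phase at the end of the service is $j$); $\overline{\mathbf{D}}_i=(-\mathbf{D}_0)^{-1}\mathbf{D}_i$ for $i\ge1$; $\tau_j(z)=\sum_{k=j}^\infty\overline{\mathbf{D}}_kz^k$. For $a\le\ell\le b$: $\mathbf{C}_{\ell,a-1}=\overline{\mathbf{D}}_{\ell-a+1}$ and $\mathbf{C}_{\ell,n}=\sum_{j=n+1}^{a-1}\overline{\mathbf{D}}_{j-n}\mathbf{C}_{\ell,j}+\overline{\mathbf{D}}_{\ell-n}$ for $0\le n\le a-2$. $\mathbf{Q}_0=\mathbf{I}$, $\mathbf{Q}_1=\overline{\mathbf{D}}_1$, and $\mathbf{Q}_n=\sum_{j=1}^{n-1}\mathbf{Q}_j\overline{\mathbf{D}}_{n-j}+\overline{\mathbf{D}}_n$ for $2\le n\le a-1$.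
   Formalization: The product τ_i(z) Q_{b+1-j-i} in the last formula is replaced by Q_{b+1-j-i} τ_i(z): the matrices need not commute, and the printed order fails e.g. for m=2, a=b=2, D_0=-2I, D_1=[[0,1],[1,0]], D_2=[[1,0],[1,0]] with fast exponential service. *)

theory Defs
  imports "HOL-Probability.Probability" "HOL-Complex_Analysis.Complex_Analysis"
begin

section \<open>Matrices\<close>

text \<open>
  The phase set is a finite type \<open>'m\<close>. On \<open>real^'m^'m\<close> the library operation \<open>*\<close>, and hence
  also \<open>^\<close> and \<open>exp\<close>, is componentwise, so the matrix exponential is defined here via \<open>**\<close>.
  A scalar factor \<open>z\<close> of a matrix is written as the scalar matrix \<open>mat z\<close>.
\<close>

primrec mat_pow :: "'a::semiring_1^'m^'m \<Rightarrow> nat \<Rightarrow> 'a^'m^'m" where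
  "mat_pow A 0 = mat 1"
| "mat_pow A (Suc k) = A ** mat_pow A k"

definition mat_exp :: "complex^'m^'m \<Rightarrow> complex^'m^'m" where
  "mat_exp A = (\<Sum>k. (1 / fact k) *\<^sub>R mat_pow A k)"

abbreviation cmat :: "real^'n^'m \<Rightarrow> complex^'n^'m" where
  "cmat \<equiv> map_matrix complex_of_real"

definition cvec :: "real^'m \<Rightarrow> complex^'m" where
  "cvec v = (\<chi> i. complex_of_real (v $ i))"

section \<open>The batch Markovian arrival process\<close>

locale bmap =
  fixes D :: "nat \<Rightarrow> real^'m::finite^'m"
  assumes D0_diag: "D 0 $ i $ i < 0"
    and D0_offdiag: "i \<noteq> j \<Longrightarrow> 0 \<le> D 0 $ i $ j"
    and Dk_nonneg: "1 \<le> k \<Longrightarrow> 0 \<le> D k $ i $ j"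
    and D_summable: "summable (\<lambda>k. D k $ i $ j)"
    and D_generator: "(\<Sum>j\<in>UNIV. \<Sum>k. D k $ i $ j) = 0"
    and D0_invertible: "invertible (D 0)"

definition phase_generator :: "(nat \<Rightarrow> real^'m^'m) \<Rightarrow> real^'m^'m" where
  "phase_generator D = (\<chi> i j. \<Sum>k. D k $ i $ j)"

definition stationary_phase :: "(nat \<Rightarrow> real^'m^'m) \<Rightarrow> real^'m \<Rightarrow> bool" where
  "stationary_phase D \<pi> \<longleftrightarrow>
     (\<forall>i. 0 \<le> \<pi> $ i) \<and> (\<Sum>i\<in>UNIV. \<pi> $ i) = 1 \<and> \<pi> v* phase_generator D = 0"

text \<open>Here \<open>1 :: real^'m\<close> is the vector of ones.\<close>

definition arrival_rate :: "(nat \<Rightarrow> real^'m^'m) \<Rightarrow> real^'m \<Rightarrow> real" where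
  "arrival_rate D \<pi> = (\<Sum>k. real k * ((\<pi> v* D k) \<bullet> 1))"

text \<open>
  When the phase is \<open>i\<close>, the time to the next transition is exponential with rate
  \<open>- D 0 $ i $ i\<close>, and \<open>jump_prob D i c j\<close> is the probability that this transition brings a
  batch of \<open>c\<close> customers (none if \<open>c = 0\<close>) and leads to phase \<open>j\<close>.
\<close>

definition jump_prob :: "(nat \<Rightarrow> real^'m^'m) \<Rightarrow> 'm \<Rightarrow> nat \<Rightarrow> 'm \<Rightarrow> real" where
  "jump_prob D i c j = (if c = 0 \<and> j = i then 0 else D c $ i $ j / (- D 0 $ i $ i))"

text \<open>
  Sample paths: \<open>h k\<close> is the time between the \<open>k\<close>-th and the \<open>(k+1)\<close>-st transition (the 0th
  being time 0), \<open>c k\<close> the batch size brought by the \<open>(k+1)\<close>-st transition, and \<open>y k\<close> the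
  phase after the \<open>k\<close>-th transition.
\<close>

definition jump_epoch :: "(nat \<Rightarrow> real) \<Rightarrow> nat \<Rightarrow> real" where
  "jump_epoch h k = (\<Sum>l<k. h l)"

definition arrivals :: "(nat \<Rightarrow> real) \<Rightarrow> (nat \<Rightarrow> nat) \<Rightarrow> real \<Rightarrow> nat" where
  "arrivals h c t = (\<Sum>k | jump_epoch h (Suc k) \<le> t. c k)"

definition phase_at :: "(nat \<Rightarrow> real) \<Rightarrow> (nat \<Rightarrow> 'm) \<Rightarrow> real \<Rightarrow> 'm" where
  "phase_at h y t = y (card {k. jump_epoch h (Suc k) \<le> t})"

section \<open>The queue under the general bulk service rule\<close>

text \<open>
  \<open>N\<close> is the arrival counting function, \<open>x\<close> the queue length immediately after a departure at
  time \<open>t\<close>. If \<open>a \<le> x\<close> the next service starts at \<open>t\<close> itself.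
\<close>

definition service_start :: "nat \<Rightarrow> (real \<Rightarrow> nat) \<Rightarrow> real \<Rightarrow> nat \<Rightarrow> real" where
  "service_start a N t x = Inf {u. t \<le> u \<and> a \<le> x + (N u - N t)}"

text \<open>
  \<open>departure a b N v x0 r0 k\<close> is the epoch of the \<open>k\<close>-th departure, the queue length immediately
  after it and the size of the departing batch. The 0th departure takes place at time 0 and
  leaves \<open>x0\<close> customers; \<open>v k r\<close> is the time it takes to serve the \<open>(k+1)\<close>-st batch if it
  has size \<open>r\<close>.
\<close>

primrec departure :: "nat \<Rightarrow> nat \<Rightarrow> (real \<Rightarrow> nat) \<Rightarrow> (nat \<Rightarrow> nat \<Rightarrow> real) \<Rightarrow> nat \<Rightarrow> nat \<Rightarrow> nat \<Rightarrow>
    real \<times> nat \<times> nat" where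
  "departure a b N v x0 r0 0 = (0, x0, r0)"
| "departure a b N v x0 r0 (Suc k) =
     (let (t, x, _) = departure a b N v x0 r0 k;
          u = service_start a N t x;
          l = x + (N u - N t);
          r = min l b;
          t' = u + v k r
      in (t', (l - r) + (N t' - N u), r))"

definition service_mean :: "(nat \<Rightarrow> real \<Rightarrow> real) \<Rightarrow> nat \<Rightarrow> real" where
  "service_mean s r = (LINT t|lborel. t * s r t)"

definition service_rate :: "(nat \<Rightarrow> real \<Rightarrow> real) \<Rightarrow> nat \<Rightarrow> real" where
  "service_rate s r = 1 / service_mean s r"

definition traffic_intensity ::
    "(nat \<Rightarrow> real^'m^'m) \<Rightarrow> nat \<Rightarrow> (nat \<Rightarrow> real \<Rightarrow> real) \<Rightarrow> real^'m \<Rightarrow> real" where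
  "traffic_intensity D b s \<pi> = arrival_rate D \<pi> / (real b * service_rate s b)"

text \<open>
  The queue is observed from a departure epoch on, at which it is in steady state: the joint law
  \<open>piplus\<close> of the queue length, the size of the departing batch and the arrival phase immediately
  after a departure is the same for all departures. The rates of the arrival process enter through
  the joint law of initial state, transition times, batch sizes and phases (\<open>arrival_law\<close>).
  The pathwise conditions \<open>H_pos\<close> and \<open>no_explosion\<close> follow almost surely from that law and
  only exclude a null set.
\<close>

locale stationary_bulk_queue = prob_space M + bmap D
  for M :: "'w measure" and D :: "nat \<Rightarrow> real^'m::finite^'m" +
  fixes \<pi> :: "real^'m"                  \<comment> \<open>stationary phase distribution\<close>
    and a b :: nat
    and s :: "nat \<Rightarrow> real \<Rightarrow> real"      \<comment> \<open>service time densities\<close>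
    and X0 R0 :: "'w \<Rightarrow> nat"           \<comment> \<open>queue length and batch size at the 0th departure\<close>
    and H :: "nat \<Rightarrow> 'w \<Rightarrow> real"
    and B :: "nat \<Rightarrow> 'w \<Rightarrow> nat"
    and Y :: "nat \<Rightarrow> 'w \<Rightarrow> 'm"
    and V :: "nat \<Rightarrow> nat \<Rightarrow> 'w \<Rightarrow> real"
    and piplus :: "nat \<Rightarrow> nat \<Rightarrow> real^'m"
  assumes a_pos: "1 \<le> a" and a_le_b: "a \<le> b"
    and stationary: "stationary_phase D \<pi>"
    and arrival_rate_finite: "summable (\<lambda>k. real k * ((\<pi> v* D k) \<bullet> 1))"
    and s_nonneg: "\<lbrakk>a \<le> r; r \<le> b\<rbrakk> \<Longrightarrow> 0 \<le> s r t"
    and s_neg_arg: "\<lbrakk>a \<le> r; r \<le> b; t < 0\<rbrakk> \<Longrightarrow> s r t = 0"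
    and service_mean_finite: "\<lbrakk>a \<le> r; r \<le> b\<rbrakk> \<Longrightarrow> integrable lborel (\<lambda>t. t * s r t)"
    and X0_measurable: "X0 \<in> measurable M (count_space UNIV)"
    and R0_measurable: "R0 \<in> measurable M (count_space UNIV)"
    and H_measurable: "H k \<in> borel_measurable M"
    and B_measurable: "B k \<in> measurable M (count_space UNIV)"
    and Y_measurable: "Y k \<in> measurable M (count_space UNIV)"
    and H_pos: "\<omega> \<in> space M \<Longrightarrow> 0 < H k \<omega>"
    and no_explosion:
      "\<omega> \<in> space M \<Longrightarrow> filterlim (jump_epoch (\<lambda>k. H k \<omega>)) at_top sequentially"
    and arrival_law: "(\<And>k. 0 \<le> w k) \<Longrightarrow>
      prob {\<omega> \<in> space M. X0 \<omega> = x \<and> R0 \<omega> = r \<and> Y 0 \<omega> = y 0 \<and>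
              (\<forall>k<n. w k < H k \<omega> \<and> B k \<omega> = c k \<and> Y (Suc k) \<omega> = y (Suc k))}
      = prob {\<omega> \<in> space M. X0 \<omega> = x \<and> R0 \<omega> = r \<and> Y 0 \<omega> = y 0} *
        (\<Prod>k<n. exp (D 0 $ y k $ y k * w k) * jump_prob D (y k) (c k) (y (Suc k)))"
    and service_law: "\<lbrakk>a \<le> r; r \<le> b\<rbrakk> \<Longrightarrow> distributed M lborel (V k r) (\<lambda>t. ennreal (s r t))"
    and service_indep: "indep_vars (\<lambda>_. borel) (\<lambda>(k, r). V k r) (UNIV \<times> {a..b})"
    and arrivals_indep_service:
      "indep_set
         (sets (vimage_algebra (space M) (\<lambda>\<omega>. (X0 \<omega>, R0 \<omega>, \<lambda>k. (H k \<omega>, B k \<omega>, Y k \<omega>)))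
            (count_space UNIV \<Otimes>\<^sub>M count_space UNIV \<Otimes>\<^sub>M
               (\<Pi>\<^sub>M k\<in>UNIV. borel \<Otimes>\<^sub>M count_space UNIV \<Otimes>\<^sub>M count_space UNIV))))
         (sets (vimage_algebra (space M) (\<lambda>\<omega>. \<lambda>(k, r)\<in>UNIV \<times> {a..b}. V k r \<omega>)
            (\<Pi>\<^sub>M p\<in>UNIV \<times> {a..b}. borel)))"
    and steady_state:
      "piplus n r $ i = prob {\<omega> \<in> space M.
         case departure a b (arrivals (\<lambda>l. H l \<omega>) (\<lambda>l. B l \<omega>)) (\<lambda>l q. V l q \<omega>)
                (X0 \<omega>) (R0 \<omega>) k
         of (t, x, q) \<Rightarrow> x = n \<and> q = r \<and> phase_at (\<lambda>l. H l \<omega>) (\<lambda>l. Y l \<omega>) t = i}"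

definition psiplus :: "nat \<Rightarrow> nat \<Rightarrow> (nat \<Rightarrow> nat \<Rightarrow> real^'m) \<Rightarrow> nat \<Rightarrow> real^'m" where
  "psiplus a b piplus n = (\<Sum>r = a..b. piplus n r)"

section \<open>The matrices of the solution\<close>

definition D_gf :: "(nat \<Rightarrow> real^'m^'m) \<Rightarrow> complex \<Rightarrow> complex^'m^'m" where
  "D_gf D z = (\<chi> i j. \<Sum>k. complex_of_real (D k $ i $ j) * z ^ k)"

definition A_gf ::
    "(nat \<Rightarrow> real^'m::finite^'m) \<Rightarrow> (nat \<Rightarrow> real \<Rightarrow> real) \<Rightarrow> nat \<Rightarrow> complex \<Rightarrow> complex^'m^'m" where
  "A_gf D s r z =
     (LINT t|density lborel (\<lambda>t. ennreal (s r t)). mat_exp (t *\<^sub>R D_gf D z))"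

definition A_coeff ::
    "(nat \<Rightarrow> real^'m::finite^'m) \<Rightarrow> (nat \<Rightarrow> real \<Rightarrow> real) \<Rightarrow> nat \<Rightarrow> nat \<Rightarrow> complex^'m^'m" where
  "A_coeff D s r k = (\<chi> i j. fps_nth (fps_expansion (\<lambda>z. A_gf D s r z $ i $ j) 0) k)"

definition Dbar :: "(nat \<Rightarrow> real^'m^'m) \<Rightarrow> nat \<Rightarrow> real^'m^'m" where
  "Dbar D k = matrix_inv (- D 0) ** D k"

definition tau :: "(nat \<Rightarrow> real^'m^'m) \<Rightarrow> nat \<Rightarrow> complex \<Rightarrow> complex^'m^'m" where
  "tau D j z =
     (\<chi> i i'. \<Sum>k. complex_of_real (Dbar D (j + k) $ i $ i') * z ^ (j + k))"

function C_mat :: "(nat \<Rightarrow> real^'m::finite^'m) \<Rightarrow> nat \<Rightarrow> nat \<Rightarrow> nat \<Rightarrow> real^'m^'m" where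
  "C_mat D a l n =
     (if n = a - 1 then Dbar D (l - a + 1)
      else (\<Sum>j = n + 1..a - 1. Dbar D (j - n) ** C_mat D a l j) + Dbar D (l - n))"
  by pat_completeness auto
termination
  by (relation "Wellfounded.measure (\<lambda>(D, a, l, n). a - n)") auto

declare C_mat.simps [simp del]

fun Q_mat :: "(nat \<Rightarrow> real^'m::finite^'m) \<Rightarrow> nat \<Rightarrow> real^'m^'m" where
  "Q_mat D n =
     (if n = 0 then mat 1
      else (\<Sum>j = 1..n - 1. Q_mat D j ** Dbar D (n - j)) + Dbar D n)"

declare Q_mat.simps [simp del]

text \<open>
  \<open>Q_mat D n\<close> gives the phase change on visiting the level \<open>n\<close> above the current one during
  an idle period, and \<open>tau D i z\<close> the one of a batch of size at least \<open>i\<close> arriving at that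
  level. Phase vectors are row vectors multiplied from the left, so in a product of the two
  \<open>Q_mat\<close> has to come first; the matrices do not commute in general.
\<close>

end

theory Submission
  imports Defs
begin

text \<open>
  By stationarity it suffices to follow one service cycle. If \<open>\<alpha>(l)\<close> is the row vector of
  probabilities that the first service starts with \<open>l\<close> customers present, then the queue left
  behind by a batch of size \<open>r < b\<close> consists of the arrivals during its service alone, so
  \<open>\<pi>\<^sup>+(n, r) = \<alpha>(r) A\<^sup>(\<^sup>r\<^sup>)\<^sub>n\<close>, whereas \<open>\<pi>\<^sup>+(n, b)\<close> is the convolution of \<open>\<alpha>(b + c)\<close> and
  \<open>A\<^sup>(\<^sup>b\<^sup>)\<^sub>d\<close>. The vectors \<open>\<alpha>(l)\<close> are determined by \<open>\<psi>\<^sup>+\<close> through the levels visited during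
  the idle period, and since \<open>\<psi>\<^sup>+\<close> contains \<open>\<pi>\<^sup>+(\<cdot>, b)\<close> again, the generating function of the
  latter satisfies a linear equation with matrix \<open>z\<^sup>b I - A\<^sup>(\<^sup>b\<^sup>)(z)\<close>.

  For the arrivals in a time interval, the probabilities computed from the jump chain satisfy the
  forward equation \<open>F' = F D\<close> of the counting process. It is solved by the coefficients of
  \<open>e\<^sup>D\<^sup>(\<^sup>z\<^sup>)\<^sup>t\<close>, which are nonnegative and summable by uniformisation:
  \<open>D(z) + \<theta> I\<close> has nonnegative coefficients with row sums at most \<open>\<theta>\<close>.
\<close>

text \<open>Stationarity enters by reading \<open>steady_state\<close> at departures 0 and 1:
  departure 0 ties \<open>\<psi>\<close> to the law of the initial state, departure 1 ties
  \<open>piplus\<close> to the outcome of the cycle. The epoch at which the first service starts is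
  random, so the cycle is cut at the index \<open>k\<close> of the transition at which this happens,
  and everything is summed over \<open>k\<close>. This raises two obstacles. The arrivals after that
  transition need a Markov property, which has to be extracted from the cylinder probabilities in
  \<open>arrival_law\<close>. And below level \<open>a\<close> the sums over \<open>k\<close> count
  repeated visits caused by silent phase changes; their convergence rests on the invertibility of
  \<open>D 0\<close>.

  The recursions run in opposite directions: \<open>C_mat\<close> splits off the first batch of the
  idle period, the law of the visited levels splits off the last one. \<open>Q_mat\<close> sums over
  all ways of dividing a climb into batches, can be read from either end, and so mediates between
  the two.\<close>

no_notation fps_nth (infixl "$" 75)

section \<open>The counting process by uniformisation\<close>

lemma sums_vecI: "(\<And>i. (\<lambda>k. f k $ i) sums (s $ i)) \<Longrightarrow> f sums (s :: ('a::real_normed_vector)^'n)"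
  unfolding sums_def by (rule vec_tendstoI) simp

context bmap
begin

text \<open>The rate \<theta> of the uniformisation. Any common bound of the exit rates would do;
  the sum over the phases spares a maximum.\<close>

definition unif_rate :: real where "unif_rate = (\<Sum>i\<in>UNIV. - D 0 $ i $ i)"

lemma unif_rate_ge: "- D 0 $ i $ i \<le> unif_rate"
  unfolding unif_rate_def
  by (rule member_le_sum) (auto intro: less_imp_le[OF D0_diag] simp: D0_diag less_imp_le)

definition shifted_D :: "nat \<Rightarrow> real^'m^'m" where
  "shifted_D d = D d + (if d = 0 then mat unif_rate else 0)"

lemma shifted_D_entry: "shifted_D d $ i $ j = D d $ i $ j + (if d = 0 \<and> i = j then unif_rate else 0)"
  by (simp add: shifted_D_def mat_def)

lemma shifted_D_nonneg: "0 \<le> shifted_D d $ i $ j"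
  using Dk_nonneg[of d i j] D0_offdiag[of i j] unif_rate_ge[of i]
  by (cases "d = 0"; cases "i = j") (auto simp: shifted_D_entry)

lemma shifted_D_summable: "summable (\<lambda>d. shifted_D d $ i $ j)"
  unfolding shifted_D_entry
  by (intro summable_add D_summable summable_finite[of "{0}"]) auto

lemma shifted_D_row_sum: "(\<Sum>j\<in>UNIV. \<Sum>d. shifted_D d $ i $ j) = unif_rate"
proof -
  have "(\<Sum>d. shifted_D d $ i $ j) = (\<Sum>d. D d $ i $ j) + (if i = j then unif_rate else 0)" for j
  proof -
    have "(\<Sum>d. shifted_D d $ i $ j) = (\<Sum>d. D d $ i $ j) + (\<Sum>d. if d = 0 \<and> i = j then unif_rate else 0)"
      unfolding shifted_D_entry by (intro suminf_add[symmetric] D_summable summable_finite[of "{0}"]) auto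
    also have "(\<Sum>d. if d = 0 \<and> i = j then unif_rate else 0) = (if i = j then unif_rate else 0)"
      by (subst suminf_finite[of "{0}"]) auto
    finally show ?thesis .
  qed
  thus ?thesis by (simp add: sum.distrib D_generator)
qed

text \<open>The coefficient of \<open>z ^ d\<close> in the \<open>k\<close>-th power of D(z) +
  \<theta> I. Divided by \<theta>^k it gives the probabilities of \<open>d\<close> arrivals within
  \<open>k\<close> steps of the uniformised chain.\<close>

primrec unif_coeff :: "nat \<Rightarrow> nat \<Rightarrow> real^'m^'m" where
  "unif_coeff 0 d = (if d = 0 then mat 1 else 0)"
| "unif_coeff (Suc k) d = (\<Sum>c\<le>d. shifted_D c ** unif_coeff k (d - c))"

lemma unif_coeff_Suc_entry: "unif_coeff (Suc k) d $ i $ j = (\<Sum>h\<in>UNIV. \<Sum>c\<le>d. shifted_D c $ i $ h * unif_coeff k (d - c) $ h $ j)"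
  by (simp add: sum_component matrix_matrix_mult_def) (rule sum.swap)

lemma unif_coeff_nonneg: "0 \<le> unif_coeff k d $ i $ j"
proof (induction k arbitrary: d i j)
  case 0 thus ?case by (simp add: mat_def)
next
  case (Suc k) thus ?case unfolding unif_coeff_Suc_entry by (intro sum_nonneg mult_nonneg_nonneg shifted_D_nonneg)
qed

lemma unif_coeff_summable: "summable (\<lambda>d. unif_coeff k d $ i $ j)"
  and unif_coeff_suminf: "(\<Sum>d. unif_coeff (Suc k) d $ i $ j) = (\<Sum>h\<in>UNIV. (\<Sum>d. shifted_D d $ i $ h) * (\<Sum>d. unif_coeff k d $ h $ j))"
proof -
  \<comment> \<open>Stated under a summability assumption on \<open>k\<close> so that it serves
    twice: as the induction step for summability and for the value of the sum.\<close>
  have conv: "(\<lambda>d. unif_coeff (Suc k) d $ i $ j) sums (\<Sum>h\<in>UNIV. (\<Sum>d. shifted_D d $ i $ h) * (\<Sum>d. unif_coeff k d $ h $ j))"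
    if "\<And>h. summable (\<lambda>d. unif_coeff k d $ h $ j)" for k i
    unfolding unif_coeff_Suc_entry using that
    by (intro sums_sum Cauchy_product_sums) (auto simp: shifted_D_nonneg unif_coeff_nonneg shifted_D_summable)
  have *: "summable (\<lambda>d. unif_coeff k d $ i $ j)" for k i
  proof (induction k arbitrary: i)
    case 0 show ?case by (rule summable_finite[of "{0}"]) auto
  next
    case (Suc k) thus ?case using conv sums_summable by blast
  qed
  show "summable (\<lambda>d. unif_coeff k d $ i $ j)" by (rule *)
  show "(\<Sum>d. unif_coeff (Suc k) d $ i $ j) = (\<Sum>h\<in>UNIV. (\<Sum>d. shifted_D d $ i $ h) * (\<Sum>d. unif_coeff k d $ h $ j))"
    using conv[OF *] by (rule sums_unique[symmetric])
qed

lemma unif_coeff_row_sum: "(\<Sum>j\<in>UNIV. \<Sum>d. unif_coeff k d $ i $ j) = unif_rate ^ k"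
proof (induction k arbitrary: i)
  case 0
  have "(\<Sum>d. unif_coeff 0 d $ i $ j) = (if i = j then 1 else 0)" for j
    by (subst suminf_finite[of "{0}"]) (auto simp: mat_def)
  thus ?case by simp
next
  case (Suc k)
  have "(\<Sum>j\<in>UNIV. \<Sum>d. unif_coeff (Suc k) d $ i $ j)
    = (\<Sum>h\<in>UNIV. (\<Sum>d. shifted_D d $ i $ h) * (\<Sum>j\<in>UNIV. \<Sum>d. unif_coeff k d $ h $ j))"
    unfolding unif_coeff_suminf by (subst sum.swap) (simp add: sum_distrib_left)
  thus ?case by (simp add: Suc shifted_D_row_sum flip: sum_distrib_right)
qed

lemma unif_coeff_total_le: "(\<Sum>d. unif_coeff k d $ i $ j) \<le> unif_rate ^ k"
  unfolding unif_coeff_row_sum[of k i, symmetric]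
  by (rule member_le_sum) (auto intro: suminf_nonneg unif_coeff_summable unif_coeff_nonneg)

lemma unif_coeff_le: "unif_coeff k d $ i $ j \<le> unif_rate ^ k"
  using sum_le_suminf[OF unif_coeff_summable, of "{d}" k i j] unif_coeff_total_le[of k i j] unif_coeff_nonneg by force

text \<open>A Poisson mixture: the uniformised chain makes \<open>k\<close> steps up to time
  \<open>t\<close> with probability e^(-\<theta>t) (\<theta>t)^k / k!, and the \<theta>^k cancels
  against the normalisation of \<open>unif_coeff k d\<close>.\<close>

definition count_prob :: "nat \<Rightarrow> real \<Rightarrow> real^'m^'m" where
  "count_prob d t = (\<chi> i j. exp (- unif_rate * t) * (\<Sum>k. unif_coeff k d $ i $ j / fact k * t ^ k))"

lemma count_prob_series_summable: "summable (\<lambda>k. unif_coeff k d $ i $ j / fact k * t ^ k)"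
proof (rule summable_comparison_test')
  show "summable (\<lambda>k. (unif_rate * \<bar>t\<bar>) ^ k / fact k)"
    using summable_exp[of "unif_rate * \<bar>t\<bar>"] by (simp add: divide_inverse mult.commute)
  show "norm (unif_coeff k d $ i $ j / fact k * t ^ k) \<le> (unif_rate * \<bar>t\<bar>) ^ k / fact k" for k
    using unif_coeff_le[of k d i j] unif_coeff_nonneg[of k d i j]
    by (auto simp: abs_mult power_abs power_mult_distrib intro!: divide_right_mono mult_right_mono)
qed

lemma count_prob_nonneg: "0 \<le> t \<Longrightarrow> 0 \<le> count_prob d t $ i $ j"
  unfolding count_prob_def
  by (auto intro!: mult_nonneg_nonneg suminf_nonneg count_prob_series_summable divide_nonneg_nonneg unif_coeff_nonneg simp del: times_divide_eq_left)

lemma count_prob_0: "count_prob d 0 = (if d = 0 then mat 1 else 0)"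
proof -
  have "(\<Sum>k. unif_coeff k d $ i $ j / fact k * 0 ^ k) = unif_coeff 0 d $ i $ j" for i j
    using powser_zero[of "\<lambda>k. unif_coeff k d $ i $ j / fact k"] by simp
  thus ?thesis by (simp add: count_prob_def vec_eq_iff del: times_divide_eq_left)
qed

text \<open>Differentiating the power series replaces \<open>unif_coeff k\<close> by
  \<open>unif_coeff (Suc k)\<close>, whose recursion puts \<open>shifted_D\<close> on the left; the
  extra \<theta> is cancelled by the derivative of the exponential factor. With \<open>D\<close> to
  the left of the probabilities this is the backward equation, which \<open>after_start_eq\<close>
  pairs with a forward one.\<close>

lemma count_prob_has_derivative:
  "((\<lambda>t. count_prob d t $ i $ j) has_real_derivative (\<Sum>c\<le>d. (D c ** count_prob (d - c) t) $ i $ j)) (at t)"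
proof -
  let ?w = "\<lambda>d h k. unif_coeff k d $ h $ j / fact k"
  let ?f = "\<lambda>d h t. \<Sum>k. ?w d h k * t ^ k"
  have "(?f d i has_real_derivative (\<Sum>k. diffs (?w d i) k * t ^ k)) (at t)"
    by (rule termdiffs_strong_converges_everywhere) (rule count_prob_series_summable)
  moreover have "diffs (?w d i) = (\<lambda>k. unif_coeff (Suc k) d $ i $ j / fact k)"
    by (rule ext, unfold diffs_def fact_Suc, simp add: field_simps del: unif_coeff.simps of_nat_Suc)
  moreover have "(\<lambda>k. unif_coeff (Suc k) d $ i $ j / fact k * t ^ k) sums (\<Sum>h\<in>UNIV. \<Sum>c\<le>d. shifted_D c $ i $ h * ?f (d - c) h t)"
  proof -
    have "(\<lambda>k. \<Sum>h\<in>UNIV. \<Sum>c\<le>d. shifted_D c $ i $ h * (?w (d - c) h k * t ^ k)) sums (\<Sum>h\<in>UNIV. \<Sum>c\<le>d. shifted_D c $ i $ h * ?f (d - c) h t)"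
      by (intro sums_sum sums_mult summable_sums count_prob_series_summable)
    thus ?thesis unfolding unif_coeff_Suc_entry by (simp add: sum_divide_distrib sum_distrib_right mult.assoc)
  qed
  ultimately have 1: "(?f d i has_real_derivative (\<Sum>h\<in>UNIV. \<Sum>c\<le>d. shifted_D c $ i $ h * ?f (d - c) h t)) (at t)"
    by (simp add: sums_iff)
  have 2: "(\<Sum>h\<in>UNIV. \<Sum>c\<le>d. shifted_D c $ i $ h * ?f (d - c) h t) = unif_rate * ?f d i t + (\<Sum>h\<in>UNIV. \<Sum>c\<le>d. D c $ i $ h * ?f (d - c) h t)"
  proof -
    have "(\<Sum>h\<in>UNIV. \<Sum>c\<le>d. (if c = 0 \<and> i = h then unif_rate else 0) * ?f (d - c) h t)
        = (\<Sum>h\<in>UNIV. if i = h then unif_rate * ?f d h t else 0)"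
    proof (rule sum.cong[OF refl])
      fix h
      have "(\<Sum>c\<le>d. (if c = 0 \<and> i = h then unif_rate else 0) * ?f (d - c) h t)
         = (\<Sum>c\<le>d. if c = 0 then (if i = h then unif_rate * ?f d h t else 0) else 0)"
        by (rule sum.cong) auto
      thus "(\<Sum>c\<le>d. (if c = 0 \<and> i = h then unif_rate else 0) * ?f (d - c) h t) = (if i = h then unif_rate * ?f d h t else 0)"
        by simp
    qed
    thus ?thesis
      by (simp add: shifted_D_entry distrib_right sum.distrib)
  qed
  have 3: "(\<Sum>c\<le>d. (D c ** count_prob (d - c) t) $ i $ j) = exp (- unif_rate * t) * (\<Sum>h\<in>UNIV. \<Sum>c\<le>d. D c $ i $ h * ?f (d - c) h t)"
    by (simp add: matrix_matrix_mult_def count_prob_def sum_distrib_left mult_ac) (rule sum.swap)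
  show ?thesis
    unfolding 3 unfolding count_prob_def vec_lambda_beta
    by (rule DERIV_cong, rule DERIV_mult[OF _ 1], (rule derivative_eq_intros refl)+)
       (simp only: 2, simp add: algebra_simps)
qed

lemma count_prob_continuous: "continuous_on A (\<lambda>t. count_prob d t $ i $ j)"
  by (rule DERIV_continuous_on[OF has_field_derivative_at_within[OF count_prob_has_derivative]])

lemma count_prob_measurable [measurable]: "(\<lambda>t. count_prob d t $ i $ j) \<in> borel_measurable borel"
  by (rule borel_measurable_continuous_onI) (rule count_prob_continuous)

lemma count_prob_summable_total:
  assumes "0 \<le> t"
  shows "summable (\<lambda>d. count_prob d t $ i $ j)" and "(\<Sum>d. count_prob d t $ i $ j) \<le> 1"
proof -
  \<comment> \<open>Only finitely many \<open>d\<close> are summed, so the exchange with the series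
    over \<open>k\<close> is free and the row bound \<theta>^k applies term by term.\<close>
  have *: "(\<Sum>d<n. count_prob d t $ i $ j) \<le> 1" for n
  proof -
    have "(\<lambda>k. \<Sum>d<n. unif_coeff k d $ i $ j / fact k * t ^ k) sums (\<Sum>d<n. \<Sum>k. unif_coeff k d $ i $ j / fact k * t ^ k)"
      by (intro sums_sum summable_sums count_prob_series_summable)
    moreover have "(\<lambda>k. (unif_rate * t) ^ k /\<^sub>R fact k) sums exp (unif_rate * t)"
      by (rule exp_converges)
    moreover have "(\<Sum>d<n. unif_coeff k d $ i $ j / fact k * t ^ k) \<le> (unif_rate * t) ^ k /\<^sub>R fact k" for k
    proof -
      have "(\<Sum>d<n. unif_coeff k d $ i $ j) \<le> unif_rate ^ k"
        using sum_le_suminf[OF unif_coeff_summable, of "{..<n}" k i j] unif_coeff_total_le[of k i j] unif_coeff_nonneg by force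
      hence "(\<Sum>d<n. unif_coeff k d $ i $ j) * (t ^ k / fact k) \<le> unif_rate ^ k * (t ^ k / fact k)"
        using assms by (intro mult_right_mono) auto
      thus ?thesis by (simp add: sum_distrib_right power_mult_distrib divide_inverse mult_ac flip: sum_distrib_left)
    qed
    ultimately have "(\<Sum>d<n. \<Sum>k. unif_coeff k d $ i $ j / fact k * t ^ k) \<le> exp (unif_rate * t)"
      by (rule sums_le[rotated])
    hence "exp (- unif_rate * t) * (\<Sum>d<n. \<Sum>k. unif_coeff k d $ i $ j / fact k * t ^ k) \<le> exp (- unif_rate * t) * exp (unif_rate * t)"
      by (intro mult_left_mono) auto
    thus ?thesis by (simp add: count_prob_def sum_distrib_left flip: exp_add)
  qed
  show 1: "summable (\<lambda>d. count_prob d t $ i $ j)"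
    by (rule summableI_nonneg_bounded[OF count_prob_nonneg[OF assms] *])
  show "(\<Sum>d. count_prob d t $ i $ j) \<le> 1"
    by (rule suminf_le_const[OF 1 *])
qed

lemma count_prob_le_1: "0 \<le> t \<Longrightarrow> count_prob d t $ i $ j \<le> 1"
  using sum_le_suminf[OF count_prob_summable_total(1), of t "{d}" i j] count_prob_summable_total(2)[of t i j] count_prob_nonneg[of t]
  by force

text \<open>Each induction step is a Cauchy product; |z| at most 1 preserves the absolute
  summability known at z = 1.\<close>

lemma mat_pow_shifted_D_sums:
  assumes "norm z \<le> 1"
  shows "(\<lambda>d. complex_of_real (unif_coeff k d $ i $ j) * z ^ d) sums (mat_pow (D_gf D z + mat (complex_of_real unif_rate)) k $ i $ j)"
proof (induction k arbitrary: i)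
  case 0
  have "(\<lambda>d. complex_of_real (unif_coeff 0 d $ i $ j) * z ^ d) = (\<lambda>d. if d = 0 then mat 1 $ i $ j else 0)"
    by (auto simp: mat_def)
  thus ?case using sums_single[of 0 "\<lambda>_. mat 1 $ i $ j :: complex"] by simp
next
  case (Suc k)
  have sm: "summable (\<lambda>d. norm (complex_of_real (X d) * z ^ d))" if "summable X" "\<And>d. 0 \<le> X d" for X :: "nat \<Rightarrow> real"
    by (rule summable_comparison_test'[OF that(1), of 0])
       (use that assms in \<open>auto simp: norm_mult norm_power intro!: mult_left_le power_le_one\<close>)
  have E: "(D_gf D z + mat (complex_of_real unif_rate)) $ i $ h = (\<Sum>c. complex_of_real (shifted_D c $ i $ h) * z ^ c)" for h
  proof -
    \<comment> \<open>\<open>D_gf\<close> is a bare \<open>suminf\<close>, so the series with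
      \<open>D\<close> itself must be known to converge before the sum is split; it is the shifted
      series minus a single term.\<close>
    have "summable (\<lambda>c. complex_of_real (D c $ i $ h) * z ^ c)"
    proof -
      have "summable (\<lambda>c. complex_of_real (shifted_D c $ i $ h) * z ^ c - complex_of_real (if c = 0 \<and> i = h then unif_rate else 0) * z ^ c)"
        by (intro summable_diff summable_norm_cancel[OF sm] shifted_D_summable shifted_D_nonneg summable_finite[of "{0}"]) auto
      thus ?thesis by (simp add: shifted_D_entry algebra_simps)
    qed
    moreover have "summable (\<lambda>c. complex_of_real (if c = 0 \<and> i = h then unif_rate else 0) * z ^ c)"
      by (intro summable_finite[of "{0}"]) auto
    ultimately have "(\<Sum>c. complex_of_real (shifted_D c $ i $ h) * z ^ c) = (\<Sum>c. complex_of_real (D c $ i $ h) * z ^ c)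
        + (\<Sum>c. complex_of_real (if c = 0 \<and> i = h then unif_rate else 0) * z ^ c)"
      by (simp add: shifted_D_entry suminf_add distrib_right del: of_real_eq_0_iff)
    also have "(\<Sum>c. complex_of_real (if c = 0 \<and> i = h then unif_rate else 0) * z ^ c) = mat (complex_of_real unif_rate) $ i $ h"
      by (subst suminf_finite[of "{0}"]) (auto simp: mat_def)
    finally show ?thesis by (simp add: D_gf_def)
  qed
  have "(\<lambda>d. \<Sum>h\<in>UNIV. \<Sum>c\<le>d. (complex_of_real (shifted_D c $ i $ h) * z ^ c) * (complex_of_real (unif_coeff k (d - c) $ h $ j) * z ^ (d - c)))
     sums (\<Sum>h\<in>UNIV. (\<Sum>c. complex_of_real (shifted_D c $ i $ h) * z ^ c) * (\<Sum>d. complex_of_real (unif_coeff k d $ h $ j) * z ^ d))"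
    by (intro sums_sum Cauchy_product_sums sm shifted_D_summable shifted_D_nonneg unif_coeff_summable unif_coeff_nonneg)
  also have "(\<Sum>h\<in>UNIV. (\<Sum>c. complex_of_real (shifted_D c $ i $ h) * z ^ c) * (\<Sum>d. complex_of_real (unif_coeff k d $ h $ j) * z ^ d))
     = mat_pow (D_gf D z + mat (complex_of_real unif_rate)) (Suc k) $ i $ j"
    by (simp add: matrix_matrix_mult_def E[symmetric] sums_unique[OF Suc, symmetric])
  also have "(\<lambda>d. \<Sum>h\<in>UNIV. \<Sum>c\<le>d. (complex_of_real (shifted_D c $ i $ h) * z ^ c) * (complex_of_real (unif_coeff k (d - c) $ h $ j) * z ^ (d - c)))
     = (\<lambda>d. complex_of_real (unif_coeff (Suc k) d $ i $ j) * z ^ d)"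
    unfolding unif_coeff_Suc_entry of_real_sum sum_distrib_right of_real_mult
    by (intro ext sum.cong refl) (simp add: power_add[symmetric] mult_ac)
  finally show ?case .
qed

end

section \<open>The matrix exponential as a generating function of the counting probabilities\<close>

lemma mat_mult_entry: "(mat c ** (A :: 'a::comm_semiring_1^'n^'n)) $ i $ j = c * A $ i $ j"
  by (simp add: matrix_matrix_mult_def mat_def if_distrib[of "\<lambda>x. x * _"] cong: if_cong)

lemma mat_pow_scaleR_entry: "mat_pow (t *\<^sub>R (A :: complex^'m::finite^'m)) k $ i $ j = complex_of_real t ^ k * mat_pow A k $ i $ j"
proof (induction k arbitrary: i)
  case 0 show ?case by simp
next
  case (Suc k)
  have "mat_pow (t *\<^sub>R A) (Suc k) $ i $ j = (\<Sum>h\<in>UNIV. (t *\<^sub>R A $ i $ h) * (complex_of_real t ^ k * mat_pow A k $ h $ j))"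
    by (simp add: matrix_matrix_mult_def Suc del: scaleR_left_distrib)
  thus ?case by (simp add: matrix_matrix_mult_def sum_distrib_left scaleR_conv_of_real mult_ac)
qed

text \<open>The binomial theorem, available because a scalar matrix commutes with every matrix. With
  the factorials divided out it has the shape of a Cauchy product, which will split off the scalar
  factor e^c.\<close>

lemma mat_pow_add_scalar_entry:
  fixes A :: "complex^'m::finite^'m"
  shows "mat_pow (A + mat c) k $ i $ j / fact k = (\<Sum>m\<le>k. (mat_pow A m $ i $ j / fact m) * (c ^ (k - m) / fact (k - m)))"
proof -
  have "mat_pow (A + mat c) k $ i $ j = (\<Sum>m\<le>k. of_nat (k choose m) * mat_pow A m $ i $ j * c ^ (k - m))"
  proof (induction k arbitrary: i)
    case 0 show ?case by simp
  next
    case (Suc k)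
    have "mat_pow (A + mat c) (Suc k) $ i $ j = (A ** mat_pow (A + mat c) k) $ i $ j + c * mat_pow (A + mat c) k $ i $ j"
      by (simp add: matrix_matrix_mult_def distrib_right sum.distrib mat_mult_entry[unfolded matrix_matrix_mult_def, simplified])
    also have "(A ** mat_pow (A + mat c) k) $ i $ j
        = (\<Sum>m\<le>k. \<Sum>h\<in>UNIV. A $ i $ h * (of_nat (k choose m) * mat_pow A m $ h $ j * c ^ (k - m)))"
      by (subst sum.swap) (simp add: matrix_matrix_mult_def Suc sum_distrib_left)
    also have "\<dots> = (\<Sum>m\<le>k. of_nat (k choose m) * mat_pow A (Suc m) $ i $ j * c ^ (k - m))"
      by (simp add: matrix_matrix_mult_def sum_distrib_left sum_distrib_right mult_ac)
    also have "c * mat_pow (A + mat c) k $ i $ j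
        = (\<Sum>m\<le>k. of_nat (k choose m) * mat_pow A m $ i $ j * c ^ (Suc k - m))"
      unfolding Suc sum_distrib_left by (intro sum.cong refl) (simp add: Suc_diff_le mult_ac)
    also have "(\<Sum>m\<le>k. of_nat (k choose m) * mat_pow A (Suc m) $ i $ j * c ^ (k - m))
        + (\<Sum>m\<le>k. of_nat (k choose m) * mat_pow A m $ i $ j * c ^ (Suc k - m))
       = (\<Sum>m\<le>Suc k. of_nat (Suc k choose m) * mat_pow A m $ i $ j * c ^ (Suc k - m))"
      unfolding sum.atMost_Suc_shift[of "\<lambda>m. of_nat (Suc k choose m) * mat_pow A m $ i $ j * c ^ (Suc k - m)"]
      using sum.atMost_Suc_shift[of "\<lambda>m. of_nat (k choose m) * mat_pow A m $ i $ j * c ^ (Suc k - m)" k]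
      by (simp add: sum.distrib distrib_right binomial_eq_0 del: mat_pow.simps)
    finally show ?case .
  qed
  thus ?thesis
    by (simp add: sum_divide_distrib binomial_fact field_simps)
qed

text \<open>Entries at z are dominated by those at z = 1, whose totals are at most \<theta>^m; an
  exponential series remains as a bound.\<close>

lemma (in bmap) summable_mat_pow_shifted_D:
  assumes z: "norm z \<le> 1" and t: "0 \<le> t"
  shows "summable (\<lambda>m. norm (mat_pow (t *\<^sub>R (D_gf D z + mat (complex_of_real unif_rate))) m $ i $ j / fact m))"
proof (rule summable_comparison_test')
  show "summable (\<lambda>k. (unif_rate * t) ^ k / fact k)"
    using summable_exp[of "unif_rate * t"] by (simp add: divide_inverse mult.commute)
  fix m
  have W: "summable (\<lambda>d. norm (complex_of_real (unif_coeff m d $ i $ j) * z ^ d))"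
    "norm (complex_of_real (unif_coeff m d $ i $ j) * z ^ d) \<le> unif_coeff m d $ i $ j" for d
    using unif_coeff_nonneg z by (auto intro!: summable_comparison_test'[OF unif_coeff_summable[of m i j], of 0]
      simp: norm_mult norm_power mult_left_le power_le_one)
  have "norm (mat_pow (D_gf D z + mat (complex_of_real unif_rate)) m $ i $ j) \<le> (\<Sum>d. norm (complex_of_real (unif_coeff m d $ i $ j) * z ^ d))"
    unfolding sums_unique[OF mat_pow_shifted_D_sums[OF z]] by (rule summable_norm[OF W(1)])
  also have "\<dots> \<le> (\<Sum>d. unif_coeff m d $ i $ j)"
    by (rule suminf_le[OF W(2) W(1) unif_coeff_summable])
  also have "\<dots> \<le> unif_rate ^ m" by (rule unif_coeff_total_le)
  finally have "norm (mat_pow (D_gf D z + mat (complex_of_real unif_rate)) m $ i $ j) \<le> unif_rate ^ m" .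
  from mult_left_mono[OF this, of "t ^ m / fact m"]
  show "norm (norm (mat_pow (t *\<^sub>R (D_gf D z + mat (complex_of_real unif_rate))) m $ i $ j / fact m)) \<le> (unif_rate * t) ^ m / fact m"
    using t by (simp add: mat_pow_scaleR_entry norm_mult norm_power norm_divide power_mult_distrib mult_ac)
qed

text \<open>Write t D(z) as t (D(z) + \<theta> I) minus \<theta>t I. The exponential of the first
  part is a double series over powers \<open>m\<close> and arrival numbers \<open>d\<close> with
  nonnegative coefficients; summed over \<open>m\<close> first it gives \<open>count_prob\<close>,
  up to a factor e^(\<theta>t) that the second part removes.\<close>

lemma (in bmap) mat_exp_D_gf_sums:
  assumes z: "norm z \<le> 1" and t: "0 \<le> t"
  shows "(\<lambda>d. complex_of_real (count_prob d t $ i $ j) * z ^ d) sums (mat_exp (t *\<^sub>R D_gf D z) $ i $ j)"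
proof -
  let ?A = "D_gf D z + mat (complex_of_real unif_rate)"
  let ?B = "t *\<^sub>R ?A"
  have B: "t *\<^sub>R D_gf D z = ?B + mat (- complex_of_real (unif_rate * t))"
    by (auto simp: vec_eq_iff mat_def scaleR_conv_of_real[where 'a=complex] algebra_simps)
  define f where "f m d = complex_of_real (unif_coeff m d $ i $ j / fact m * t ^ m) * z ^ d" for m d
  define R where "R m = mat_pow ?B m $ i $ j / fact m" for m
  have norm_f: "norm (f m d) = unif_coeff m d $ i $ j / fact m * t ^ m * norm z ^ d" for m d
    using unif_coeff_nonneg t by (simp add: f_def norm_mult norm_power norm_divide)
  have R: "(\<lambda>d. f m d) sums R m" for m
    using sums_mult[OF mat_pow_shifted_D_sums[OF z, of m i j], of "complex_of_real t ^ m / fact m"]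
    by (simp add: f_def R_def mat_pow_scaleR_entry mult_ac)
  have P: "exp (- unif_rate * t) * (\<Sum>m. unif_coeff m d $ i $ j / fact m * t ^ m) = count_prob d t $ i $ j" for d
    by (simp add: count_prob_def)
  \<comment> \<open>The two series are exchanged as a series and an integral over the counting
    measure in \<open>m\<close>. The norms integrate to e^(\<theta>t) times
    \<open>count_prob d t $ i $ j * norm z ^ d\<close>, which is summable over
    \<open>d\<close>.\<close>
  have "(\<lambda>d. \<integral>m. f m d \<partial>count_space UNIV) sums (\<integral>m. (\<Sum>d. f m d) \<partial>count_space UNIV)"
  proof -
    have 1: "summable (\<lambda>m. norm (f m d))" for d
      unfolding norm_f using count_prob_series_summable[of d i j t] by (rule summable_mult2)
    hence 1: "integrable (count_space UNIV) (\<lambda>m. f m d)" for d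
      by (simp add: integrable_count_space_nat_iff)
    have "summable (\<lambda>d. norm (complex_of_real (unif_coeff m d $ i $ j) * z ^ d))" for m
      by (rule summable_comparison_test'[OF unif_coeff_summable[of m i j], of 0])
         (use unif_coeff_nonneg z in \<open>auto simp: norm_mult norm_power intro!: mult_left_le power_le_one\<close>)
    from summable_mult[OF this, of "t ^ _ / fact _"] have 2: "summable (\<lambda>d. norm (f m d))" for m
      using unif_coeff_nonneg t by (simp add: f_def norm_mult norm_power norm_divide mult_ac)
    have "(\<integral>m. norm (f m d) \<partial>count_space UNIV) = exp (unif_rate * t) * (count_prob d t $ i $ j * norm z ^ d)" for d
    proof -
      have "(\<integral>m. norm (f m d) \<partial>count_space UNIV) = (\<Sum>m. norm (f m d))"
        using 1 by (intro integral_count_space_nat integrable_norm)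
      also have "\<dots> = (\<Sum>m. unif_coeff m d $ i $ j / fact m * t ^ m) * norm z ^ d"
        unfolding norm_f by (rule suminf_mult2[OF count_prob_series_summable, symmetric])
      finally show ?thesis by (simp add: P[symmetric] flip: exp_add mult.assoc)
    qed
    moreover have "summable (\<lambda>d. count_prob d t $ i $ j * norm z ^ d)"
      by (rule summable_comparison_test'[OF count_prob_summable_total(1)[OF t, of i j], of 0])
         (use count_prob_nonneg[OF t] z in \<open>auto simp: abs_mult intro!: mult_left_le power_le_one\<close>)
    ultimately have 3: "summable (\<lambda>d. \<integral>m. norm (f m d) \<partial>count_space UNIV)"
      by (simp add: summable_mult)
    show "(\<lambda>d. \<integral>m. f m d \<partial>count_space UNIV) sums (\<integral>m. (\<Sum>d. f m d) \<partial>count_space UNIV)"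
      by (rule sums_integral[OF 1 AE_I2 3]) (rule 2)
  qed
  moreover have "(\<integral>m. f m d \<partial>count_space UNIV) = complex_of_real (exp (unif_rate * t)) * (complex_of_real (count_prob d t $ i $ j) * z ^ d)" for d
  proof -
    have "summable (\<lambda>m. norm (f m d))"
      unfolding norm_f using count_prob_series_summable[of d i j t] by (rule summable_mult2)
    hence "(\<integral>m. f m d \<partial>count_space UNIV) = (\<Sum>m. f m d)"
      by (intro integral_count_space_nat) (simp add: integrable_count_space_nat_iff)
    also have "\<dots> = (\<Sum>m. complex_of_real (unif_coeff m d $ i $ j / fact m * t ^ m)) * z ^ d"
      unfolding f_def by (rule suminf_mult2[symmetric]) (use count_prob_series_summable in \<open>simp only: summable_of_real_iff\<close>)
    also have "(\<Sum>m. complex_of_real (unif_coeff m d $ i $ j / fact m * t ^ m)) = complex_of_real (\<Sum>m. unif_coeff m d $ i $ j / fact m * t ^ m)"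
      by (rule suminf_of_real[symmetric]) (rule count_prob_series_summable)
    finally show ?thesis
      by (simp add: P[symmetric] exp_minus field_simps)
  qed
  moreover have sum_f: "(\<Sum>d. f m d) = R m" for m
    using R by (simp add: sums_iff)
  moreover have norm_R: "summable (\<lambda>m. norm (mat_pow ?B m $ i $ j / fact m))" for i j
    by (rule summable_mat_pow_shifted_D[OF z t])
  have "(\<integral>m. R m \<partial>count_space UNIV) = (\<Sum>m. R m)"
    using norm_R[of i j]
    by (intro integral_count_space_nat) (simp add: integrable_count_space_nat_iff R_def)
  ultimately have 1: "(\<lambda>d. complex_of_real (exp (unif_rate * t)) * (complex_of_real (count_prob d t $ i $ j) * z ^ d)) sums (\<Sum>m. R m)"
    by simp
  let ?x = "- complex_of_real (unif_rate * t)"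
  \<comment> \<open>Cauchy product of the exponential series of \<open>?B\<close> with the scalar
    one, entry by entry.\<close>
  have "(\<lambda>k. (1 / fact k) *\<^sub>R mat_pow (t *\<^sub>R D_gf D z) k) sums
     (\<chi> i j. (\<Sum>m. mat_pow ?B m $ i $ j / fact m) * (\<Sum>k. ?x ^ k / fact k))"
  proof (intro sums_vecI)
    fix i j
    have "summable (\<lambda>k. norm (?x ^ k / fact k))"
      using summable_norm_exp[of ?x] by (simp add: scaleR_conv_of_real divide_inverse mult.commute norm_mult norm_power)
    from Cauchy_product_sums[OF norm_R[of i j] this]
    show "(\<lambda>k. ((1 / fact k) *\<^sub>R mat_pow (t *\<^sub>R D_gf D z) k) $ i $ j) sums
      ((\<chi> i j. (\<Sum>m. mat_pow ?B m $ i $ j / fact m) * (\<Sum>k. ?x ^ k / fact k)) $ i $ j)"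
      unfolding mat_pow_add_scalar_entry[symmetric] B by (simp add: scaleR_conv_of_real[where 'a=complex])
  qed
  hence "mat_exp (t *\<^sub>R D_gf D z) $ i $ j = (\<Sum>m. R m) * (\<Sum>k. ?x ^ k / fact k)"
    unfolding mat_exp_def by (simp add: sums_iff R_def)
  also have "(\<Sum>k. ?x ^ k / fact k) = exp ?x"
    unfolding exp_def by (simp add: scaleR_conv_of_real divide_inverse mult.commute)
  finally have 2: "exp ?x * (\<Sum>m. R m) = mat_exp (t *\<^sub>R D_gf D z) $ i $ j" by simp
  have "(\<lambda>d. exp ?x * (complex_of_real (exp (unif_rate * t)) * (complex_of_real (count_prob d t $ i $ j) * z ^ d))) sums (exp ?x * (\<Sum>m. R m))"
    using 1 by (rule sums_mult)
  moreover have "exp ?x * (complex_of_real (exp (unif_rate * t)) * y) = y" for y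
    by (simp add: exp_of_real[symmetric] flip: mult.assoc exp_add)
  ultimately show ?thesis unfolding 2 by (simp only:)
qed

section \<open>Entries of Bochner integrals, and arrivals in a random time\<close>

lemma bounded_linear_axis: "bounded_linear (axis i :: 'a::real_normed_vector \<Rightarrow> 'a^'n::finite)"
proof (rule bounded_linear_intro)
  show "axis i (x + y) = axis i x + axis i (y :: 'a)" for x y by (simp add: vec_eq_iff axis_def)
  show "axis i (r *\<^sub>R x) = r *\<^sub>R axis i (x :: 'a)" for r x by (simp add: vec_eq_iff axis_def)
  show "norm (axis i x) \<le> norm (x :: 'a) * 1" for x
    by (simp add: norm_vec_def L2_set_def axis_def if_distrib[of norm] if_distrib[of "\<lambda>x. x ^ 2"] cong: if_cong)
qed

text \<open>\<open>A_gf\<close> is a Bochner integral of matrices but is studied entry by entry, so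
  integrability of the whole has to come from that of the entries.\<close>

lemma integrable_vecI:
  fixes f :: "'x \<Rightarrow> ('a::euclidean_space)^'n::finite"
  assumes "\<And>i. integrable M (\<lambda>t. f t $ i)"
  shows "integrable M f"
proof -
  have "integrable M (\<lambda>t. \<Sum>i\<in>UNIV. axis i (f t $ i))"
    by (intro Bochner_Integration.integrable_sum integrable_bounded_linear[OF bounded_linear_axis] assms)
  also have "(\<lambda>t. \<Sum>i\<in>UNIV. axis i (f t $ i)) = f"
    by (auto simp: fun_eq_iff vec_eq_iff axis_def sum_component)
  finally show ?thesis .
qed

lemma integral_vec_nth:
  fixes f :: "'x \<Rightarrow> ('a::euclidean_space)^'n::finite"
  assumes "integrable M f"
  shows "(LINT t|M. f t) $ i = (LINT t|M. f t $ i)"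
  using integral_bounded_linear[OF bounded_linear_vec_nth assms] by (rule sym)

context bmap
begin

text \<open>Arrivals during an independent random time with law \<open>N\<close>. For the service
  time law of a batch of size \<open>r\<close> these are the matrices
  \<open>A_coeff D s r d\<close>, see \<open>A_coeff_eq\<close>.\<close>

definition count_mix :: "real measure \<Rightarrow> nat \<Rightarrow> real^'m^'m" where
  "count_mix N d = (\<chi> i j. LINT t|N. count_prob d t $ i $ j)"

context
  fixes N :: "real measure"
  assumes N: "prob_space N" and sets_N: "sets N = sets borel" and N_nonneg: "AE t in N. 0 \<le> t"
begin

interpretation N: prob_space N by (rule N)

lemma count_prob_integrable: "integrable N (\<lambda>t. count_prob d t $ i $ j)"
  by (rule N.integrable_const_bound[where B=1])
     (use N_nonneg count_prob_nonneg count_prob_le_1 sets_N in \<open>auto simp: measurable_cong_sets[OF sets_N refl]\<close>)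

lemma count_mix_nonneg: "0 \<le> count_mix N d $ i $ j"
  unfolding count_mix_def using N_nonneg count_prob_nonneg by (auto intro!: integral_nonneg_AE)

lemma count_mix_summable: "summable (\<lambda>d. count_mix N d $ i $ j)"
proof (rule summableI_nonneg_bounded[OF count_mix_nonneg])
  fix n
  have "(\<Sum>d<n. count_mix N d $ i $ j) = (LINT t|N. (\<Sum>d<n. count_prob d t $ i $ j))"
    by (simp add: count_mix_def count_prob_integrable)
  also have "\<dots> \<le> (LINT t|N. 1)"
  proof (rule integral_mono_AE)
    show "AE t in N. (\<Sum>d<n. count_prob d t $ i $ j) \<le> 1"
      using N_nonneg
    proof eventually_elim
      case (elim t)
      show ?case
        using sum_le_suminf[OF count_prob_summable_total(1)[OF elim], of "{..<n}" i j] count_prob_summable_total(2)[OF elim, of i j] count_prob_nonneg[OF elim]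
        by force
    qed
  qed (auto simp: count_prob_integrable)
  also have "\<dots> = 1" by (simp add: N.prob_space)
  finally show "(\<Sum>d<n. count_mix N d $ i $ j) \<le> 1" .
qed

lemma mat_exp_mix_sums:
  assumes z: "norm z \<le> 1"
  shows "(\<lambda>d. complex_of_real (count_mix N d $ i $ j) * z ^ d) sums ((LINT t|N. mat_exp (t *\<^sub>R D_gf D z)) $ i $ j)"
proof -
  have int: "integrable N (\<lambda>t. complex_of_real (count_prob d t $ i $ j) * z ^ d)" for d i j
    by (intro integrable_mult_left integrable_of_real count_prob_integrable)
  have norm_le: "norm (complex_of_real x * z ^ d) \<le> x" if "0 \<le> x" for x d
    using that z by (auto simp: norm_mult norm_power intro!: mult_left_le power_le_one)
  have sm: "AE t in N. summable (\<lambda>d. norm (complex_of_real (count_prob d t $ i $ j) * z ^ d))" for i j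
    using N_nonneg
  proof eventually_elim
    case (elim t)
    show ?case
      by (rule summable_comparison_test'[OF count_prob_summable_total(1)[OF elim, of i j], of 0])
         (use norm_le[OF count_prob_nonneg[OF elim]] in simp)
  qed
  \<comment> \<open>Norms are bounded by the values at z = 1, so their integrals are bounded by the
    summable \<open>count_mix\<close>.\<close>
  have sm2: "summable (\<lambda>d. LINT t|N. norm (complex_of_real (count_prob d t $ i $ j) * z ^ d))" for i j
  proof (rule summable_comparison_test'[OF count_mix_summable[of i j], of 0])
    fix d
    have "(LINT t|N. norm (complex_of_real (count_prob d t $ i $ j) * z ^ d)) \<le> (LINT t|N. count_prob d t $ i $ j)"
    proof (intro integral_mono_AE integrable_norm int count_prob_integrable)
      show "AE t in N. norm (complex_of_real (count_prob d t $ i $ j) * z ^ d) \<le> count_prob d t $ i $ j"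
        using N_nonneg by eventually_elim (rule norm_le[OF count_prob_nonneg])
    qed
    thus "norm (LINT t|N. norm (complex_of_real (count_prob d t $ i $ j) * z ^ d)) \<le> count_mix N d $ i $ j"
      by (simp add: count_mix_def)
  qed
  have eq: "AE t in N. (\<Sum>d. complex_of_real (count_prob d t $ i $ j) * z ^ d) = mat_exp (t *\<^sub>R D_gf D z) $ i $ j" for i j
    using N_nonneg by eventually_elim (rule sums_unique[OF mat_exp_D_gf_sums[OF z], symmetric])
  \<comment> \<open>The series and the matrix exponential are known to agree only at nonnegative
    times, hence almost everywhere. Integrability transfers once the exponential is measurable,
    which holds as it is a series of continuous functions of \<open>t\<close>.\<close>
  have int2: "integrable N (\<lambda>t. mat_exp (t *\<^sub>R D_gf D z) $ i $ j)" for i j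
  proof -
    have pow: "mat_pow (t *\<^sub>R D_gf D z) k = t ^ k *\<^sub>R mat_pow (D_gf D z) k" for t k
      by (simp add: vec_eq_iff mat_pow_scaleR_entry scaleR_conv_of_real[where 'a=complex])
    have "(\<lambda>t. mat_exp (t *\<^sub>R D_gf D z)) \<in> borel_measurable borel"
      unfolding mat_exp_def pow by (intro borel_measurable_suminf borel_measurable_continuous_onI continuous_intros)
    hence "(\<lambda>t. mat_exp (t *\<^sub>R D_gf D z) $ i $ j) \<in> borel_measurable borel"
      by (rule measurable_compose) (intro borel_measurable_continuous_onI continuous_intros)
    hence m: "(\<lambda>t. mat_exp (t *\<^sub>R D_gf D z) $ i $ j) \<in> borel_measurable N"
      unfolding measurable_cong_sets[OF sets_N refl] .
    note sum_int = integrable_suminf[OF int sm sm2, of i j]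
    show ?thesis
      by (rule integrable_cong_AE_imp[OF sum_int m]) (use eq[of i j] in \<open>simp add: eq_commute\<close>)
  qed
  have "(LINT t|N. (\<Sum>d. complex_of_real (count_prob d t $ i $ j) * z ^ d)) = (LINT t|N. mat_exp (t *\<^sub>R D_gf D z) $ i $ j)"
    using int2[of i j]
    by (intro integral_cong_AE eq integrable_suminf[OF int sm sm2, THEN borel_measurable_integrable] borel_measurable_integrable[OF int2])
  also have "\<dots> = (LINT t|N. mat_exp (t *\<^sub>R D_gf D z)) $ i $ j"
    by (simp add: integral_vec_nth integrable_vecI int2)
  finally show ?thesis
    using sums_integral[OF int sm sm2, of i j] by (simp add: count_mix_def)
qed

end

text \<open>The power series with coefficients \<open>count_mix\<close> converges at z = 1, so its
  radius is at least 1 and it represents \<open>A_gf\<close> near 0; Taylor coefficients are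
  unique.\<close>

lemma A_coeff_eq:
  assumes N: "prob_space (density lborel (\<lambda>t. ennreal (s r t)))"
    and N0: "AE t in density lborel (\<lambda>t. ennreal (s r t)). 0 \<le> t"
  shows "A_coeff D s r d = cmat (count_mix (density lborel (\<lambda>t. ennreal (s r t))) d)"
proof -
  let ?N = "density lborel (\<lambda>t. ennreal (s r t))"
  have sets: "sets ?N = sets borel" by simp
  have "(\<lambda>z. A_gf D s r z $ i $ j) has_fps_expansion Abs_fps (\<lambda>d. complex_of_real (count_mix ?N d $ i $ j))" for i j
    unfolding has_fps_expansion_def
  proof
    let ?F = "Abs_fps (\<lambda>d. complex_of_real (count_mix ?N d $ i $ j))"
    have sums: "(\<lambda>d. complex_of_real (count_mix ?N d $ i $ j) * z ^ d) sums (A_gf D s r z $ i $ j)" if "norm z \<le> 1" for z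
      unfolding A_gf_def by (rule mat_exp_mix_sums[OF N sets N0 that])
    have "fps_conv_radius ?F \<ge> norm (1 :: complex)"
      unfolding fps_conv_radius_def by (rule conv_radius_geI) (use sums[of 1] in \<open>simp add: sums_iff\<close>)
    thus "0 < fps_conv_radius ?F" by (rule less_le_trans[rotated]) simp
    have "eventually (\<lambda>z::complex. z \<in> ball 0 1) (nhds 0)"
      by (rule eventually_nhds_in_open) auto
    thus "eventually (\<lambda>z. eval_fps ?F z = A_gf D s r z $ i $ j) (nhds 0)"
      by eventually_elim (use sums in \<open>auto simp: eval_fps_def sums_iff\<close>)
  qed
  hence "fps_expansion (\<lambda>z. A_gf D s r z $ i $ j) 0 = Abs_fps (\<lambda>d. complex_of_real (count_mix ?N d $ i $ j))" for i j
    by (rule fps_expansion_eqI)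
  thus ?thesis by (simp add: A_coeff_def vec_eq_iff map_matrix_def)
qed

end

section \<open>The Markov property at transition epochs\<close>

lemma emeasure_exponential_greaterThan:
  assumes "0 < l"
  shows "emeasure (density lborel (exponential_density l)) {x<..} = ennreal (exp (- l * max 0 x))"
proof -
  interpret E: prob_space "density lborel (exponential_density l)"
    using assms by (rule prob_space_exponential_density)
  have gt: "{x<..} = space (density lborel (exponential_density l)) - {..x}" by auto
  have "emeasure (density lborel (exponential_density l)) {..x} = ennreal (1 - exp (- l * max 0 x))"
    using emeasure_erlang_density[OF assms, of 0 x] by (simp add: erlang_CDF_0 max_def mult_ac)
  thus ?thesis
    unfolding gt using assms
    by (subst emeasure_Diff) (auto simp: E.emeasure_space_1[simplified] ennreal_minus simp flip: ennreal_1)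
qed

context stationary_bulk_queue
begin

lemmas [measurable] = X0_measurable R0_measurable H_measurable B_measurable Y_measurable

definition cyl :: "nat \<Rightarrow> nat \<Rightarrow> nat \<Rightarrow> (nat \<Rightarrow> 'm) \<Rightarrow> (nat \<Rightarrow> nat) \<Rightarrow> (nat \<Rightarrow> real) \<Rightarrow> 'w set" where
  "cyl n x r y c w = {\<omega> \<in> space M. X0 \<omega> = x \<and> R0 \<omega> = r \<and> Y 0 \<omega> = y 0 \<and>
     (\<forall>k<n. w k < H k \<omega> \<and> B k \<omega> = c k \<and> Y (Suc k) \<omega> = y (Suc k))}"

text \<open>The empty set is added because incompatible cylinders are disjoint and the family has to
  be intersection stable. Thresholds are nonnegative because \<open>arrival_law\<close> speaks only
  of those.\<close>

definition cyls :: "nat \<Rightarrow> 'w set set" where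
  "cyls n = insert {} {cyl n x r y c w | x r y c w. \<forall>k. 0 \<le> w k}"

lemma cyl_sets [measurable]: "cyl n x r y c w \<in> sets M"
  unfolding cyl_def by measurable

lemma cyls_Int_stable: "Int_stable (cyls n)"
proof (rule Int_stableI)
  fix A A' assume "A \<in> cyls n" "A' \<in> cyls n"
  show "A \<inter> A' \<in> cyls n"
  proof (cases "A \<inter> A' = {}")
    case True thus ?thesis by (simp add: cyls_def)
  next
    case False
    then obtain x r y c w x' r' y' c' w' where
      A: "A = cyl n x r y c w" "\<forall>k. 0 \<le> w k" "A' = cyl n x' r' y' c' w'" "\<forall>k. 0 \<le> w' k"
      using \<open>A \<in> cyls n\<close> \<open>A' \<in> cyls n\<close> unfolding cyls_def by blast
    have "A \<inter> A' = cyl n x r y c (\<lambda>k. max (w k) (w' k))"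
      using False unfolding A cyl_def by auto
    thus ?thesis using A(2) unfolding cyls_def by (fastforce simp: le_max_iff_disj)
  qed
qed

text \<open>What is known at the \<open>n\<close>-th transition: the initial state, the first
  \<open>n\<close> holding times and batches, the phases up to index \<open>n\<close>. With
  cylinders as generators, identities of measures can be checked directly on
  \<open>arrival_law\<close>.\<close>

definition past :: "nat \<Rightarrow> 'w measure" where "past n = sigma (space M) (cyls n)"

lemma cyls_subset: "cyls n \<subseteq> sets M"
  by (auto simp: cyls_def)

lemma sets_F: "sets (past n) = sigma_sets (space M) (cyls n)"
  unfolding past_def using cyls_subset sets.space_closed by (intro sets_measure_of) blast

lemma space_F [simp]: "space (past n) = space M"
  unfolding past_def using cyls_subset sets.space_closed by (intro space_measure_of) blast

lemma sets_F_subset: "sets (past n) \<subseteq> sets M"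
  unfolding sets_F using cyls_subset by (rule sets.sigma_sets_subset)

lemma measurable_FD: "f \<in> measurable (past n) N \<Longrightarrow> f \<in> measurable M N"
  using sets_F_subset by (auto simp: measurable_def)

text \<open>The discrete part of the past. It has countably many values, so its level sets form a
  countable cover by cylinders, which both the measurability proofs and the uniqueness theorem for
  measures need.\<close>

definition data :: "nat \<Rightarrow> 'w \<Rightarrow> nat \<times> nat \<times> 'm list \<times> nat list" where
  "data n \<omega> = (X0 \<omega>, R0 \<omega>, map (\<lambda>k. Y k \<omega>) [0..<Suc n], map (\<lambda>k. B k \<omega>) [0..<n])"

lemma data_cyl:
  assumes "length ys = Suc n" "length cs = n"
  shows "{\<omega> \<in> space M. data n \<omega> = (x, r, ys, cs) \<and> (\<forall>k<n. w k < H k \<omega>)} = cyl n x r (\<lambda>k. ys ! k) (\<lambda>k. cs ! k) w"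
proof -
  have "(\<forall>k<Suc n. Y k \<omega> = ys ! k) \<longleftrightarrow> Y 0 \<omega> = ys ! 0 \<and> (\<forall>k<n. Y (Suc k) \<omega> = ys ! Suc k)" for \<omega>
    by (simp add: All_less_Suc2)
  thus ?thesis
    using assms by (auto simp: data_def cyl_def list_eq_iff_nth_eq simp del: upt_Suc)
qed

text \<open>\<open>max 0 (w k)\<close> admits arbitrary real thresholds; by \<open>H_pos\<close>, a
  negative threshold and the threshold 0 give the same event.\<close>

lemma data_event: "{\<omega> \<in> space M. data n \<omega> = v \<and> (\<forall>k<n. max 0 (w k) < H k \<omega>)} \<in> cyls n"
proof -
  obtain x r ys cs where v: "v = (x, r, ys, cs)" by (cases v)
  show ?thesis
  proof (cases "length ys = Suc n \<and> length cs = n")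
    case True
    have "\<forall>k. 0 \<le> max 0 (w k)" by simp
    thus ?thesis using data_cyl[of ys n cs x r "\<lambda>k. max 0 (w k)"] True unfolding cyls_def v by blast
  next
    case False
    hence "{\<omega> \<in> space M. data n \<omega> = v \<and> (\<forall>k<n. max 0 (w k) < H k \<omega>)} = {}"
      by (auto simp: v data_def simp del: upt_Suc)
    thus ?thesis by (simp only: cyls_def insertI1)
  qed
qed

lemma data_event': "{\<omega> \<in> space M. data n \<omega> = v} \<in> cyls n"
proof -
  have "{\<omega> \<in> space M. data n \<omega> = v} = {\<omega> \<in> space M. data n \<omega> = v \<and> (\<forall>k<n. max 0 0 < H k \<omega>)}"
    using H_pos by auto
  thus ?thesis using data_event[of n v "\<lambda>_. 0"] by simp
qed

lemma data_measurable: "data n \<in> measurable (past n) (count_space UNIV)"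
  unfolding measurable_count_space_eq2_countable
proof (intro conjI ballI)
  fix v show "data n -` {v} \<inter> space (past n) \<in> sets (past n)"
    using data_event'[of n v] by (auto simp: sets_F vimage_def Int_def conj_commute intro: sigma_sets.Basic)
qed auto

lemma X0_F [measurable]: "X0 \<in> measurable (past n) (count_space UNIV)"
  using measurable_compose[OF data_measurable, of fst "count_space UNIV" n] by (simp add: data_def)

lemma Y_F: "k \<le> n \<Longrightarrow> Y k \<in> measurable (past n) (count_space UNIV)"
  using measurable_compose[OF data_measurable, of "\<lambda>v. fst (snd (snd v)) ! k" "count_space UNIV" n]
  by (simp add: data_def less_Suc_eq_le del: upt_Suc)

lemma B_F: "k < n \<Longrightarrow> B k \<in> measurable (past n) (count_space UNIV)"
  using measurable_compose[OF data_measurable, of "\<lambda>v. snd (snd (snd v)) ! k" "count_space UNIV" n]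
  by (simp add: data_def del: upt_Suc)

lemma H_F: assumes "k < n" shows "H k \<in> borel_measurable (past n)"
proof (subst borel_measurable_iff_greater, rule allI)
  fix x
  \<comment> \<open>Threshold 0 at the other indices imposes nothing, by \<open>H_pos\<close>; the
    union over the values of \<open>data\<close> is countable.\<close>
  have "{\<omega> \<in> space (past n). x < H k \<omega>}
     = (\<Union>v. {\<omega> \<in> space M. data n \<omega> = v \<and> (\<forall>l<n. max 0 (if l = k then x else 0) < H l \<omega>)})"
    using H_pos assms by (auto split: if_splits)
  also have "\<dots> \<in> sets (past n)"
    by (intro sets.countable_UN image_subsetI) (simp only: sets_F, intro sigma_sets.Basic data_event)
  finally show "{\<omega> \<in> space (past n). x < H k \<omega>} \<in> sets (past n)" .
qed

text \<open>Lengthening a cylinder by one transition multiplies the product in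
  \<open>arrival_law\<close> by one factor, which depends on the past only through the phase at
  transition \<open>n\<close>: the Markov property on generators.\<close>

lemma cyl_next:
  assumes "0 \<le> v" "\<And>k. 0 \<le> w k"
  shows "prob (cyl n x r y c w \<inter> {\<omega> \<in> space M. Y n \<omega> = i \<and> v < H n \<omega> \<and> B n \<omega> = c' \<and> Y (Suc n) \<omega> = j})
    = prob (cyl n x r y c w \<inter> {\<omega> \<in> space M. Y n \<omega> = i}) * (exp (D 0 $ i $ i * v) * jump_prob D i c' j)"
proof (cases "y n = i")
  case False
  have "Y n \<omega> = y n" if "\<omega> \<in> cyl n x r y c w" for \<omega>
    using that by (cases n) (auto simp: cyl_def)
  hence "cyl n x r y c w \<inter> {\<omega> \<in> space M. Y n \<omega> = i \<and> Q \<omega>} = {}" for Q using False by auto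
  from this[of "\<lambda>_. True"] this show ?thesis by simp
next
  case True
  have Yn: "Y n \<omega> = y n" if "\<omega> \<in> cyl n x r y c w" for \<omega>
    using that by (cases n) (auto simp: cyl_def)
  define y' c'' w' where "y' = y(Suc n := j)" and "c'' = c(n := c')" and "w' = w(n := v)"
  have 1: "cyl n x r y c w \<inter> {\<omega> \<in> space M. Y n \<omega> = i} = cyl n x r y c w"
    using Yn True by (auto simp: cyl_def)
  have 2: "cyl n x r y c w \<inter> {\<omega> \<in> space M. Y n \<omega> = i \<and> v < H n \<omega> \<and> B n \<omega> = c' \<and> Y (Suc n) \<omega> = j} = cyl (Suc n) x r y' c'' w'"
    using Yn True by (auto simp: cyl_def y'_def c''_def w'_def less_Suc_eq)
  have 3: "prob (cyl (Suc n) x r y' c'' w') = prob {\<omega> \<in> space M. X0 \<omega> = x \<and> R0 \<omega> = r \<and> Y 0 \<omega> = y' 0} *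
        (\<Prod>k<Suc n. exp (D 0 $ y' k $ y' k * w' k) * jump_prob D (y' k) (c'' k) (y' (Suc k)))"
    unfolding cyl_def by (rule arrival_law) (use assms in \<open>auto simp: w'_def\<close>)
  have 4: "prob (cyl n x r y c w) = prob {\<omega> \<in> space M. X0 \<omega> = x \<and> R0 \<omega> = r \<and> Y 0 \<omega> = y 0} *
        (\<Prod>k<n. exp (D 0 $ y k $ y k * w k) * jump_prob D (y k) (c k) (y (Suc k)))"
    unfolding cyl_def by (rule arrival_law) (use assms in auto)
  have 5: "(\<Prod>k<n. exp (D 0 $ y' k $ y' k * w' k) * jump_prob D (y' k) (c'' k) (y' (Suc k)))
     = (\<Prod>k<n. exp (D 0 $ y k $ y k * w k) * jump_prob D (y k) (c k) (y (Suc k)))"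
    by (intro prod.cong refl) (auto simp: y'_def c''_def w'_def)
  show ?thesis
    unfolding 1 2 3 4 using 5 True by (simp add: y'_def c''_def w'_def)
qed

lemma jump_prob_nonneg: "0 \<le> jump_prob D i c j"
  using Dk_nonneg[of c i j] D0_offdiag[of i j] D0_diag[of i]
  by (cases "c = 0") (auto simp: jump_prob_def intro!: divide_nonneg_neg divide_nonpos_nonpos)

text \<open>For fixed \<open>v\<close> both sides are measures in \<open>A\<close> on
  \<open>past n\<close>. They agree on the cylinders, which are intersection stable and contain a
  countable cover by sets of finite measure, hence everywhere.\<close>

lemma next_jump_ray:
  assumes A: "A \<in> sets (past n)" and v: "0 \<le> v"
  shows "emeasure M (A \<inter> {\<omega> \<in> space M. Y n \<omega> = i \<and> v < H n \<omega> \<and> B n \<omega> = c \<and> Y (Suc n) \<omega> = j})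
    = emeasure M (A \<inter> {\<omega> \<in> space M. Y n \<omega> = i}) * ennreal (exp (D 0 $ i $ i * v) * jump_prob D i c j)"
proof -
  define C1 where "C1 = {\<omega> \<in> space M. Y n \<omega> = i \<and> v < H n \<omega> \<and> B n \<omega> = c \<and> Y (Suc n) \<omega> = j}"
  define C2 where "C2 = {\<omega> \<in> space M. Y n \<omega> = i}"
  define \<kappa> where "\<kappa> = ennreal (exp (D 0 $ i $ i * v) * jump_prob D i c j)"
  have [measurable]: "C1 \<in> sets M" "C2 \<in> sets M" unfolding C1_def C2_def by measurable
  define N1 where "N1 = distr (density M (indicator C1)) (past n) (\<lambda>\<omega>. \<omega>)"
  define N2 where "N2 = distr (density M (\<lambda>\<omega>. \<kappa> * indicator C2 \<omega>)) (past n) (\<lambda>\<omega>. \<omega>)"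
  have id: "(\<lambda>\<omega>. \<omega>) \<in> measurable (density M f) (past n)" for f
    using sets_F_subset[of n] sets.sets_into_space[of _ M] by (auto simp: measurable_def Int_absorb2 subset_iff)
  have N1: "emeasure N1 X = emeasure M (X \<inter> C1)" if "X \<in> sets (past n)" for X
  proof -
    have "X \<in> sets M" using that sets_F_subset by blast
    thus ?thesis unfolding N1_def using that sets.sets_into_space[OF \<open>X \<in> sets M\<close>]
      by (subst emeasure_distr[OF id]) (auto simp: emeasure_density Int_absorb2 Int_commute simp flip: indicator_inter_arith)
  qed
  have N2: "emeasure N2 X = emeasure M (X \<inter> C2) * \<kappa>" if "X \<in> sets (past n)" for X
  proof -
    have X: "X \<in> sets M" using that sets_F_subset by blast
    have "emeasure N2 X = (\<integral>\<^sup>+\<omega>. \<kappa> * indicator C2 \<omega> * indicator X \<omega> \<partial>M)"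
      unfolding N2_def using that sets.sets_into_space[OF X] X
      by (subst emeasure_distr[OF id]) (auto simp: emeasure_density Int_absorb2)
    also have "\<dots> = \<kappa> * emeasure M (X \<inter> C2)"
      using X by (simp add: mult.assoc nn_integral_cmult Int_commute flip: indicator_inter_arith)
    finally show ?thesis by (simp add: mult.commute)
  qed
  have "N1 = N2"
  proof (rule measure_eqI_generator_eq_countable[OF cyls_Int_stable[of n], of "space M"])
    show "cyls n \<subseteq> Pow (space M)" using cyls_subset sets.space_closed by blast
    show "sets N1 = sigma_sets (space M) (cyls n)" "sets N2 = sigma_sets (space M) (cyls n)"
      by (simp_all add: N1_def N2_def sets_F)
    show "range (\<lambda>v. {\<omega> \<in> space M. data n \<omega> = v}) \<subseteq> cyls n" using data_event' by blast
    show "countable (range (\<lambda>v. {\<omega> \<in> space M. data n \<omega> = v}))" by simp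
    show "\<Union> (range (\<lambda>v. {\<omega> \<in> space M. data n \<omega> = v})) = space M" by auto
    show "emeasure N1 X \<noteq> \<infinity>" if "X \<in> range (\<lambda>v. {\<omega> \<in> space M. data n \<omega> = v})" for X
      using that data_event' by (subst N1) (auto simp: sets_F intro: sigma_sets.Basic)
  next
    fix X assume X: "X \<in> cyls n"
    hence "X \<in> sets (past n)" by (auto simp: sets_F intro: sigma_sets.Basic)
    moreover have "emeasure M (X \<inter> C1) = emeasure M (X \<inter> C2) * \<kappa>"
    proof (cases "X = {}")
      case False
      then obtain x r y c w where "X = cyl n x r y c w" "\<And>k. 0 \<le> w k"
        using X unfolding cyls_def by blast
      thus ?thesis
        using cyl_next[OF v, of w n x r y c i] jump_prob_nonneg[of i]
        by (simp add: C1_def C2_def \<kappa>_def emeasure_eq_measure ennreal_mult)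
    qed auto
    ultimately show "emeasure N1 X = emeasure N2 X" by (simp add: N1 N2)
  qed
  thus ?thesis using N1[OF A] N2[OF A] by (simp add: C1_def C2_def \<kappa>_def)
qed

definition exit_rate :: "'m \<Rightarrow> real" where "exit_rate i = - D 0 $ i $ i"

lemma exit_rate_pos: "0 < exit_rate i" using D0_diag[of i] by (simp add: exit_rate_def)

text \<open>The extension argument in the second variable: for fixed \<open>A\<close> both sides are
  measures in \<open>C\<close> that agree on rays, where negative end points reduce to 0 by
  \<open>H_pos\<close>.\<close>

lemma next_jump:
  assumes A: "A \<in> sets (past n)" and C: "C \<in> sets borel"
  shows "emeasure M (A \<inter> {\<omega> \<in> space M. Y n \<omega> = i \<and> H n \<omega> \<in> C \<and> B n \<omega> = c \<and> Y (Suc n) \<omega> = j})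
    = emeasure M (A \<inter> {\<omega> \<in> space M. Y n \<omega> = i}) * ennreal (jump_prob D i c j) * emeasure (density lborel (exponential_density (exit_rate i))) C"
proof -
  let ?X = "density lborel (exponential_density (exit_rate i))"
  define A' where "A' = A \<inter> {\<omega> \<in> space M. Y n \<omega> = i \<and> B n \<omega> = c \<and> Y (Suc n) \<omega> = j}"
  define \<kappa> where "\<kappa> = emeasure M (A \<inter> {\<omega> \<in> space M. Y n \<omega> = i}) * ennreal (jump_prob D i c j)"
  have [measurable]: "A \<in> sets M" using A sets_F_subset by blast
  have [measurable]: "A' \<in> sets M" unfolding A'_def by measurable
  define N1 where "N1 = distr (density M (indicator A')) borel (H n)"
  define N2 where "N2 = scale_measure \<kappa> ?X"
  have N1: "emeasure N1 C = emeasure M (A \<inter> {\<omega> \<in> space M. Y n \<omega> = i \<and> H n \<omega> \<in> C \<and> B n \<omega> = c \<and> Y (Suc n) \<omega> = j})"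
    if "C \<in> sets borel" for C
  proof -
    have [measurable]: "C \<in> sets borel" by fact
    have "emeasure N1 C = emeasure M (A' \<inter> (H n -` C \<inter> space M))"
      unfolding N1_def by (subst emeasure_distr) (auto simp: emeasure_density simp flip: indicator_inter_arith)
    also have "A' \<inter> (H n -` C \<inter> space M) = A \<inter> {\<omega> \<in> space M. Y n \<omega> = i \<and> H n \<omega> \<in> C \<and> B n \<omega> = c \<and> Y (Suc n) \<omega> = j}"
      by (auto simp: A'_def)
    finally show ?thesis .
  qed
  have "N1 = N2"
  proof (rule measure_eqI_lessThan)
    show "emeasure N1 {x<..} < \<infinity>" for x by (subst N1) (auto simp: less_top[symmetric])
    fix x
    have "A \<inter> {\<omega> \<in> space M. Y n \<omega> = i \<and> H n \<omega> \<in> {x<..} \<and> B n \<omega> = c \<and> Y (Suc n) \<omega> = j}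
       = A \<inter> {\<omega> \<in> space M. Y n \<omega> = i \<and> max 0 x < H n \<omega> \<and> B n \<omega> = c \<and> Y (Suc n) \<omega> = j}"
      using H_pos by auto
    hence "emeasure N1 {x<..} = emeasure M (A \<inter> {\<omega> \<in> space M. Y n \<omega> = i}) * ennreal (exp (D 0 $ i $ i * max 0 x) * jump_prob D i c j)"
      using next_jump_ray[OF A, of "max 0 x" i c j] by (simp add: N1)
    also have "\<dots> = emeasure N2 {x<..}"
      using emeasure_exponential_greaterThan[OF exit_rate_pos, of i x] jump_prob_nonneg[of i c j]
      by (simp add: N2_def \<kappa>_def exit_rate_def ennreal_mult mult_ac)
    finally show "emeasure N1 {x<..} = emeasure N2 {x<..}" .
  qed (simp_all add: N1_def N2_def)
  thus ?thesis using N1[OF C] by (simp add: N2_def \<kappa>_def)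
qed

lemma jump_prob_eq: "jump_prob D i c j = (D c $ i $ j + (if c = 0 \<and> j = i then exit_rate i else 0)) / exit_rate i"
  using D0_diag[of i] by (auto simp: jump_prob_def exit_rate_def)

lemma jump_prob_sums: "(\<lambda>c. \<Sum>j\<in>UNIV. jump_prob D i c j) sums 1"
proof -
  have "(\<lambda>c. \<Sum>j\<in>UNIV. (D c $ i $ j + (if c = 0 \<and> j = i then exit_rate i else 0)) / exit_rate i) sums
    (\<Sum>j\<in>UNIV. ((\<Sum>c. D c $ i $ j) + (if j = i then exit_rate i else 0)) / exit_rate i)"
  proof (intro sums_sum sums_divide sums_add summable_sums D_summable)
    fix j
    show "(\<lambda>c. if c = 0 \<and> j = i then exit_rate i else 0) sums (if j = i then exit_rate i else 0)"
      using sums_single[of 0 "\<lambda>c. if j = i then exit_rate i else 0"] by (simp add: if_distrib conj_commute cong: if_cong)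
  qed
  also have "(\<Sum>j\<in>UNIV. ((\<Sum>c. D c $ i $ j) + (if j = i then exit_rate i else 0)) / exit_rate i) = 1"
    using exit_rate_pos[of i] by (simp add: sum.distrib D_generator flip: sum_divide_distrib)
  finally show ?thesis by (simp add: jump_prob_eq)
qed

text \<open>Given phase \<open>i\<close>, the next holding time is independent of the past, so on
  the event considered \<open>(T, H n)\<close> has a product law with an exponential second factor.
  \<open>T\<close> will be the time elapsed since the start of service.\<close>

lemma next_jump_nn_integral:
  assumes A: "A \<in> sets (past n)" "A \<subseteq> {\<omega> \<in> space M. Y n \<omega> = i}"
    and T: "T \<in> borel_measurable (past n)"
    and f [measurable]: "f \<in> borel_measurable (borel \<Otimes>\<^sub>M borel)"
  shows "(\<integral>\<^sup>+\<omega>. indicator (A \<inter> {\<omega> \<in> space M. B n \<omega> = c \<and> Y (Suc n) \<omega> = j}) \<omega> * f (T \<omega>, H n \<omega>) \<partial>M)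
    = ennreal (jump_prob D i c j) *
      (\<integral>\<^sup>+\<omega>. indicator A \<omega> * (\<integral>\<^sup>+h. ennreal (exponential_density (exit_rate i) h) * f (T \<omega>, h) \<partial>lborel) \<partial>M)"
proof -
  let ?X = "density lborel (exponential_density (exit_rate i))"
  interpret X: prob_space ?X by (rule prob_space_exponential_density[OF exit_rate_pos])
  define C where "C = A \<inter> {\<omega> \<in> space M. B n \<omega> = c \<and> Y (Suc n) \<omega> = j}"
  define p where "p = ennreal (jump_prob D i c j)"
  have [measurable]: "A \<in> sets M" using A sets_F_subset by blast
  have [measurable]: "C \<in> sets M" unfolding C_def by measurable
  have [measurable]: "T \<in> borel_measurable M" using T by (rule measurable_FD)
  define N1 where "N1 = distr (density M (indicator C)) (borel \<Otimes>\<^sub>M borel) (\<lambda>\<omega>. (T \<omega>, H n \<omega>))"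
  define NT where "NT = distr (density M (\<lambda>\<omega>. p * indicator A \<omega>)) borel T"
  have NT: "emeasure NT S = p * emeasure M (A \<inter> (T -` S \<inter> space M))" if [measurable]: "S \<in> sets borel" for S
  proof -
    have "emeasure NT S = (\<integral>\<^sup>+\<omega>. p * indicator A \<omega> * indicator (T -` S \<inter> space M) \<omega> \<partial>M)"
      unfolding NT_def by (subst emeasure_distr) (auto simp: emeasure_density)
    also have "\<dots> = p * emeasure M (A \<inter> (T -` S \<inter> space M))"
      by (simp add: mult.assoc nn_integral_cmult flip: indicator_inter_arith)
    finally show ?thesis .
  qed
  have N1: "emeasure N1 S = emeasure M (C \<inter> ((\<lambda>\<omega>. (T \<omega>, H n \<omega>)) -` S \<inter> space M))" if [measurable]: "S \<in> sets (borel \<Otimes>\<^sub>M borel)" for S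
    unfolding N1_def by (subst emeasure_distr) (auto simp: emeasure_density simp flip: indicator_inter_arith)
  have fin: "finite_measure NT"
    by (rule finite_measureI, subst NT) (auto simp: NT_def p_def ennreal_mult_eq_top_iff)
  have eq: "NT \<Otimes>\<^sub>M ?X = N1"
  proof (rule pair_measure_eqI)
    show "sigma_finite_measure NT" using fin by (simp add: finite_measure_def)
    show "sigma_finite_measure ?X" ..
    show "sets (NT \<Otimes>\<^sub>M ?X) = sets N1"
      unfolding N1_def sets_distr by (intro sets_pair_measure_cong) (auto simp: NT_def)
    fix S S' assume "S \<in> sets NT" "S' \<in> sets ?X"
    hence S [measurable]: "S \<in> sets borel" "S' \<in> sets borel" by (auto simp: NT_def)
    have "A \<inter> (T -` S \<inter> space M) \<in> sets (past n)"
      using A measurable_sets[OF T S(1)] by auto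
    from next_jump[OF this S(2), of i c j]
    have "emeasure M (A \<inter> (T -` S \<inter> space M) \<inter> {\<omega> \<in> space M. Y n \<omega> = i \<and> H n \<omega> \<in> S' \<and> B n \<omega> = c \<and> Y (Suc n) \<omega> = j})
       = emeasure M (A \<inter> (T -` S \<inter> space M) \<inter> {\<omega> \<in> space M. Y n \<omega> = i}) * p * emeasure ?X S'"
      by (simp add: p_def)
    moreover have "A \<inter> (T -` S \<inter> space M) \<inter> {\<omega> \<in> space M. Y n \<omega> = i \<and> H n \<omega> \<in> S' \<and> B n \<omega> = c \<and> Y (Suc n) \<omega> = j}
       = C \<inter> ((\<lambda>\<omega>. (T \<omega>, H n \<omega>)) -` (S \<times> S') \<inter> space M)"
      using A(2) by (auto simp: C_def)
    moreover have "A \<inter> (T -` S \<inter> space M) \<inter> {\<omega> \<in> space M. Y n \<omega> = i} = A \<inter> (T -` S \<inter> space M)"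
      using A(2) by auto
    ultimately show "emeasure NT S * emeasure ?X S' = emeasure N1 (S \<times> S')"
      by (simp add: NT N1 mult_ac)
  qed
  have "(\<integral>\<^sup>+\<omega>. indicator C \<omega> * f (T \<omega>, H n \<omega>) \<partial>M) = (\<integral>\<^sup>+x. f x \<partial>N1)"
    unfolding N1_def by (subst nn_integral_distr) (auto simp: nn_integral_density)
  also have "\<dots> = (\<integral>\<^sup>+x. f x \<partial>(NT \<Otimes>\<^sub>M ?X))" by (simp add: eq)
  also have "\<dots> = (\<integral>\<^sup>+t. (\<integral>\<^sup>+h. f (t, h) \<partial>?X) \<partial>NT)"
  proof (rule X.nn_integral_fst[symmetric])
    have "sets (NT \<Otimes>\<^sub>M ?X) = sets (borel \<Otimes>\<^sub>M borel)"
      by (intro sets_pair_measure_cong) (auto simp: NT_def)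
    from measurable_cong_sets[OF this refl] f show "f \<in> borel_measurable (NT \<Otimes>\<^sub>M ?X)" by blast
  qed
  also have "\<dots> = (\<integral>\<^sup>+t. (\<integral>\<^sup>+h. ennreal (exponential_density (exit_rate i) h) * f (t, h) \<partial>lborel) \<partial>NT)"
    by (subst nn_integral_density) auto
  also have "\<dots> = (\<integral>\<^sup>+\<omega>. p * indicator A \<omega> * (\<integral>\<^sup>+h. ennreal (exponential_density (exit_rate i) h) * f (T \<omega>, h) \<partial>lborel) \<partial>M)"
    unfolding NT_def by (subst nn_integral_distr) (auto simp: nn_integral_density)
  also have "\<dots> = p * (\<integral>\<^sup>+\<omega>. indicator A \<omega> * (\<integral>\<^sup>+h. ennreal (exponential_density (exit_rate i) h) * f (T \<omega>, h) \<partial>lborel) \<partial>M)"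
    unfolding mult.assoc by (rule nn_integral_cmult) measurable
  finally show ?thesis by (simp add: C_def p_def)
qed

text \<open>Follows from \<open>next_jump_nn_integral\<close> by summing over batch and phase of the
  next transition; the jump probabilities add up to 1.\<close>

lemma holding_time_nn_integral:
  assumes A: "A \<in> sets (past n)" "A \<subseteq> {\<omega> \<in> space M. Y n \<omega> = i}"
    and T: "T \<in> borel_measurable (past n)"
    and f [measurable]: "f \<in> borel_measurable (borel \<Otimes>\<^sub>M borel)"
  shows "(\<integral>\<^sup>+\<omega>. indicator A \<omega> * f (T \<omega>, H n \<omega>) \<partial>M)
    = (\<integral>\<^sup>+\<omega>. indicator A \<omega> * (\<integral>\<^sup>+h. ennreal (exponential_density (exit_rate i) h) * f (T \<omega>, h) \<partial>lborel) \<partial>M)" (is "_ = ?R")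
proof -
  have [measurable]: "A \<in> sets M" using A sets_F_subset by blast
  have [measurable]: "T \<in> borel_measurable M" using T by (rule measurable_FD)
  let ?I = "\<lambda>c j. indicator (A \<inter> {\<omega> \<in> space M. B n \<omega> = c \<and> Y (Suc n) \<omega> = j}) :: 'w \<Rightarrow> ennreal"
  have "indicator A \<omega> = (\<Sum>c. \<Sum>j\<in>UNIV. ?I c j \<omega>)" if "\<omega> \<in> space M" for \<omega>
  proof -
    have 1: "(\<Sum>j\<in>UNIV. ?I c j \<omega>) = (if c = B n \<omega> then indicator A \<omega> else 0)" for c
    proof -
      have "(\<Sum>j\<in>UNIV. ?I c j \<omega>) = (\<Sum>j\<in>UNIV. if j = Y (Suc n) \<omega> then (if c = B n \<omega> then indicator A \<omega> else 0) else 0)"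
        using that by (intro sum.cong refl) (auto simp: indicator_def)
      thus ?thesis by simp
    qed
    show ?thesis unfolding 1 by (subst suminf_finite[of "{B n \<omega>}"]) auto
  qed
  hence "(\<integral>\<^sup>+\<omega>. indicator A \<omega> * f (T \<omega>, H n \<omega>) \<partial>M) = (\<integral>\<^sup>+\<omega>. (\<Sum>c. \<Sum>j\<in>UNIV. ?I c j \<omega> * f (T \<omega>, H n \<omega>)) \<partial>M)"
    by (intro nn_integral_cong) (simp only: sum_distrib_right[symmetric] ennreal_suminf_multc)
  also have "\<dots> = (\<Sum>c. \<Sum>j\<in>UNIV. (\<integral>\<^sup>+\<omega>. ?I c j \<omega> * f (T \<omega>, H n \<omega>) \<partial>M))"
  proof -
    have "(\<integral>\<^sup>+\<omega>. (\<Sum>c. \<Sum>j\<in>UNIV. ?I c j \<omega> * f (T \<omega>, H n \<omega>)) \<partial>M) = (\<Sum>c. (\<integral>\<^sup>+\<omega>. (\<Sum>j\<in>UNIV. ?I c j \<omega> * f (T \<omega>, H n \<omega>)) \<partial>M))"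
      by (rule nn_integral_suminf) measurable
    also have "\<dots> = (\<Sum>c. \<Sum>j\<in>UNIV. (\<integral>\<^sup>+\<omega>. ?I c j \<omega> * f (T \<omega>, H n \<omega>) \<partial>M))"
      by (intro suminf_cong nn_integral_sum) measurable
    finally show ?thesis .
  qed
  also have "\<dots> = (\<Sum>c. (\<Sum>j\<in>UNIV. ennreal (jump_prob D i c j)) * ?R)"
    by (simp only: next_jump_nn_integral[OF A T f] sum_distrib_right)
  also have "\<dots> = (\<Sum>c. (\<Sum>j\<in>UNIV. ennreal (jump_prob D i c j))) * ?R"
    by (rule ennreal_suminf_multc)
  also have "(\<Sum>c. (\<Sum>j\<in>UNIV. ennreal (jump_prob D i c j))) = (\<Sum>c. ennreal (\<Sum>j\<in>UNIV. jump_prob D i c j))"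
    by (intro suminf_cong sum_ennreal jump_prob_nonneg)
  also have "\<dots> = ennreal 1"
    by (rule suminf_ennreal_eq[OF sum_nonneg jump_prob_sums]) (rule jump_prob_nonneg)
  finally show ?thesis by simp
qed

text \<open>Departures are not subtracted, so this counts queue and server together until the first
  service ends; one cycle needs no more. Silent transitions have batch size 0 and leave it
  unchanged.\<close>

definition level :: "nat \<Rightarrow> 'w \<Rightarrow> nat" where "level n \<omega> = X0 \<omega> + (\<Sum>k<n. B k \<omega>)"

lemma level_F: "k \<le> n \<Longrightarrow> level k \<in> measurable (past n) (count_space UNIV)"
proof (induction k)
  case 0 show ?case unfolding level_def using X0_F by simp
next
  case (Suc k)
  have [measurable]: "B k \<in> measurable (past n) (count_space UNIV)" "level k \<in> measurable (past n) (count_space UNIV)"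
    using Suc by (auto intro: B_F)
  have "(\<lambda>\<omega>. (\<lambda>x y. x + y) (level k \<omega>) (B k \<omega>)) \<in> measurable (past n) (count_space UNIV)"
    by (rule measurable_compose_countable[where g="level k"]) measurable
  thus ?case by (simp add: level_def add.assoc)
qed

lemma level_measurable [measurable]: "level k \<in> measurable M (count_space UNIV)"
  using level_F[OF order_refl] by (rule measurable_FD)

text \<open>
  For \<open>a \<le> l\<close> this is the event that the first service starts at the \<open>k\<close>-th transition with \<open>l\<close>
  customers present, for \<open>l < a\<close> the event that the server is still idle and the queue length is \<open>l\<close>.
\<close>

definition start :: "nat \<Rightarrow> nat \<Rightarrow> 'w set" where
  "start k l = {\<omega> \<in> space M. level k \<omega> = l \<and> (\<forall>i<k. level i \<omega> < a)}"

lemma start_F: "k \<le> n \<Longrightarrow> start k l \<in> sets (past n)"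
proof -
  assume k: "k \<le> n"
  have level: "{\<omega> \<in> space (past n). level i \<omega> \<in> S} \<in> sets (past n)" if "i \<le> k" for i S
    using measurable_sets[OF level_F, of i n S] that k by (simp add: vimage_def Int_def conj_commute)
  have "{\<omega> \<in> space (past n). level k \<omega> \<in> {l} \<and> (\<forall>i\<in>{..<k}. level i \<omega> \<in> {..<a})} \<in> sets (past n)"
    by (intro sets.sets_Collect_conj sets.sets_Collect_finite_All level) auto
  thus ?thesis by (simp add: start_def Ball_def)
qed

lemma start_sets [measurable]: "start k l \<in> sets M"
  using start_F[OF order_refl] sets_F_subset by blast

definition visit_prob :: "nat \<Rightarrow> nat \<Rightarrow> 'm \<Rightarrow> real" where
  "visit_prob k l j = prob (start k l \<inter> {\<omega> \<in> space M. Y k \<omega> = j})"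

lemma jump_measure:
  assumes A: "A \<in> sets (past n)"
  shows "prob (A \<inter> {\<omega> \<in> space M. Y n \<omega> = i \<and> B n \<omega> = c \<and> Y (Suc n) \<omega> = j})
    = prob (A \<inter> {\<omega> \<in> space M. Y n \<omega> = i}) * jump_prob D i c j"
proof -
  interpret X: prob_space "density lborel (exponential_density (exit_rate i))"
    by (rule prob_space_exponential_density[OF exit_rate_pos])
  have "emeasure M (A \<inter> {\<omega> \<in> space M. Y n \<omega> = i \<and> H n \<omega> \<in> UNIV \<and> B n \<omega> = c \<and> Y (Suc n) \<omega> = j})
    = emeasure M (A \<inter> {\<omega> \<in> space M. Y n \<omega> = i}) * ennreal (jump_prob D i c j)"
    using next_jump[OF A, of UNIV i c j] X.emeasure_space_1 by simp
  thus ?thesis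
    using jump_prob_nonneg[of i c j] by (simp add: emeasure_eq_measure flip: ennreal_mult)
qed

text \<open>Decomposition by the state before the last transition. That level is below
  \<open>a\<close> since \<open>start\<close> keeps all earlier levels there; the case
  \<open>l' = l\<close> is a silent phase change.\<close>

lemma visit_prob_Suc: "visit_prob (Suc k) l j = (\<Sum>l' | l' < a \<and> l' \<le> l. \<Sum>i\<in>UNIV. visit_prob k l' i * jump_prob D i (l - l') j)"
proof -
  let ?A = "\<lambda>l'. start k l'"
  let ?E = "\<lambda>(l', i). ?A l' \<inter> {\<omega> \<in> space M. Y k \<omega> = i \<and> B k \<omega> = l - l' \<and> Y (Suc k) \<omega> = j}"
  let ?I = "{l'. l' < a \<and> l' \<le> l} \<times> (UNIV :: 'm set)"
  have fin: "finite {l'. l' < a \<and> l' \<le> l}" by (rule finite_subset[of _ "{..l}"]) auto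
  have "start (Suc k) l \<inter> {\<omega> \<in> space M. Y (Suc k) \<omega> = j} = (\<Union>p\<in>?I. ?E p)"
    by (auto simp: start_def less_Suc_eq level_def)
  hence "visit_prob (Suc k) l j = measure M (\<Union>p\<in>?I. ?E p)" by (simp add: visit_prob_def)
  also have "\<dots> = (\<Sum>p\<in>?I. measure M (?E p))"
  proof (rule finite_measure_finite_Union)
    show "finite ?I" using fin by simp
    have "?E p \<in> sets M" for p by (cases p) (simp only: prod.case, measurable)
    thus "?E ` ?I \<subseteq> sets M" by blast
    show "disjoint_family_on ?E ?I" unfolding disjoint_family_on_def start_def by blast
  qed
  also have "\<dots> = (\<Sum>(l', i)\<in>?I. visit_prob k l' i * jump_prob D i (l - l') j)"
    unfolding visit_prob_def by (intro sum.cong refl) (auto simp: jump_measure[OF start_F[OF order_refl]])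
  finally show ?thesis by (simp add: sum.cartesian_product)
qed

section \<open>Transitions after the start of service\<close>

definition elapsed :: "nat \<Rightarrow> nat \<Rightarrow> 'w \<Rightarrow> real" where "elapsed k q \<omega> = (\<Sum>i<q. H (k + i) \<omega>)"

lemma elapsed_0 [simp]: "elapsed k 0 \<omega> = 0" by (simp add: elapsed_def)

lemma elapsed_Suc: "elapsed k (Suc q) \<omega> = elapsed k q \<omega> + H (k + q) \<omega>" by (simp add: elapsed_def)

lemma elapsed_nonneg: "\<omega> \<in> space M \<Longrightarrow> 0 \<le> elapsed k q \<omega>"
  unfolding elapsed_def by (intro sum_nonneg) (simp add: H_pos less_imp_le)

lemma elapsed_F: "elapsed k q \<in> borel_measurable (past (k + q))"
  unfolding elapsed_def by (intro borel_measurable_sum H_F) simp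

lemma elapsed_measurable [measurable]: "elapsed k q \<in> borel_measurable M"
  using elapsed_F by (rule measurable_FD)

definition busy :: "nat \<Rightarrow> nat \<Rightarrow> nat \<Rightarrow> nat \<Rightarrow> 'm \<Rightarrow> 'w set" where
  "busy k l q d j = start k l \<inter> {\<omega> \<in> space M. level (k + q) \<omega> = l + d \<and> Y (k + q) \<omega> = j}"

lemma busy_F: "busy k l q d j \<in> sets (past (k + q))"
proof -
  have [measurable]: "level (k + q) \<in> measurable (past (k + q)) (count_space UNIV)" "Y (k + q) \<in> measurable (past (k + q)) (count_space UNIV)"
    by (intro level_F Y_F order_refl)+
  have "{\<omega> \<in> space (past (k + q)). level (k + q) \<omega> = l + d \<and> Y (k + q) \<omega> = j} \<in> sets (past (k + q))"
    by measurable
  thus ?thesis unfolding busy_def using start_F[of k "k + q" l] by auto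
qed

lemma busy_sets [measurable]: "busy k l q d j \<in> sets M"
  using busy_F sets_F_subset by blast

text \<open>The two inequalities say that exactly \<open>q\<close> transitions take place in the
  \<open>v\<close> time units after the \<open>k\<close>-th one. Here \<open>v\<close> is
  deterministic; the random service time replaces it later by independence.\<close>

definition busy_prob :: "nat \<Rightarrow> nat \<Rightarrow> nat \<Rightarrow> nat \<Rightarrow> 'm \<Rightarrow> real \<Rightarrow> ennreal" where
  "busy_prob k l q d j v = emeasure M (busy k l q d j \<inter> {\<omega> \<in> space M. elapsed k q \<omega> \<le> v \<and> v < elapsed k (Suc q) \<omega>})"

lemma nn_integral_holding_exceeds:
  "(\<integral>\<^sup>+h. ennreal (exponential_density (exit_rate j) h) * indicator {t..<t + h} v \<partial>lborel)
     = indicator {t..} v * ennreal (exp (- exit_rate j * (v - t)))"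
proof (cases "t \<le> v")
  case True
  have "(\<integral>\<^sup>+h. ennreal (exponential_density (exit_rate j) h) * indicator {t..<t + h} v \<partial>lborel)
      = (\<integral>\<^sup>+h. ennreal (exponential_density (exit_rate j) h) * indicator {v - t<..} h \<partial>lborel)"
    using True by (intro nn_integral_cong) (auto simp: indicator_def)
  also have "\<dots> = emeasure (density lborel (exponential_density (exit_rate j))) {v - t<..}"
    by (subst emeasure_density) auto
  also have "\<dots> = ennreal (exp (- exit_rate j * (v - t)))"
    using True by (simp add: emeasure_exponential_greaterThan[OF exit_rate_pos])
  finally show ?thesis using True by simp
next
  case False
  thus ?thesis by (simp add: indicator_def)
qed

text \<open>The holding time that covers \<open>v\<close> is integrated out, given the past at
  transition \<open>k + q\<close>. Afterwards \<open>v\<close> enters only through an explicit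
  survival factor, which gives measurability in \<open>v\<close> and prepares Tonelli.\<close>

lemma busy_prob_eq: "busy_prob k l q d j v = (\<integral>\<^sup>+\<omega>. indicator (busy k l q d j) \<omega> *
    (indicator {elapsed k q \<omega>..} v * ennreal (exp (- exit_rate j * (v - elapsed k q \<omega>)))) \<partial>M)"
proof -
  have sub: "busy k l q d j \<subseteq> {\<omega> \<in> space M. Y (k + q) \<omega> = j}" by (auto simp: busy_def)
  have "busy_prob k l q d j v = (\<integral>\<^sup>+\<omega>. indicator (busy k l q d j \<inter> {\<omega> \<in> space M. elapsed k q \<omega> \<le> v \<and> v < elapsed k (Suc q) \<omega>}) \<omega> \<partial>M)"
    unfolding busy_prob_def by (rule nn_integral_indicator[symmetric]) measurable
  also have "\<dots> = (\<integral>\<^sup>+\<omega>. indicator (busy k l q d j) \<omega> * (\<lambda>(t, h). indicator {t..<t + h} v) (elapsed k q \<omega>, H (k + q) \<omega>) \<partial>M)"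
    by (intro nn_integral_cong) (auto simp: indicator_def elapsed_Suc)
  also have "\<dots> = (\<integral>\<^sup>+\<omega>. indicator (busy k l q d j) \<omega> *
     (\<integral>\<^sup>+h. ennreal (exponential_density (exit_rate j) h) * (\<lambda>(t, h). indicator {t..<t + h} v) (elapsed k q \<omega>, h) \<partial>lborel) \<partial>M)"
  proof (rule holding_time_nn_integral[OF busy_F sub elapsed_F])
    have "(\<lambda>(t, h). indicator {t..<t + h} v) = (indicator {x. fst x \<le> v \<and> v < fst x + snd x} :: real \<times> real \<Rightarrow> ennreal)"
      by (auto simp: indicator_def)
    thus "(\<lambda>(t, h). indicator {t..<t + h} v :: ennreal) \<in> borel_measurable (borel \<Otimes>\<^sub>M borel)"
      by simp
  qed
  finally show ?thesis by (simp only: nn_integral_holding_exceeds prod.case)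
qed

lemma level_mono: "i \<le> k \<Longrightarrow> level i \<omega> \<le> level k \<omega>"
  unfolding level_def by (intro add_left_mono sum_mono2) auto

text \<open>At most one summand is nonzero, the one for the count and the phase before the last
  transition. The indicator form fits under an integral directly.\<close>

lemma busy_Suc_indicator:
  assumes "\<omega> \<in> space M"
  shows "(indicator (busy k l (Suc q) d' j') \<omega> :: ennreal) = (\<Sum>p\<in>{..d'} \<times> UNIV.
     indicator (busy k l q (fst p) (snd p) \<inter> {\<omega> \<in> space M. B (k + q) \<omega> = d' - fst p \<and> Y (Suc (k + q)) \<omega> = j'}) \<omega>)"
proof -
  have level: "level (k + Suc q) \<omega> = level (k + q) \<omega> + B (k + q) \<omega>" by (simp add: level_def)
  have mono: "level k \<omega> \<le> level (k + q) \<omega>" by (simp add: level_mono)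
  let ?p = "(level (k + q) \<omega> - l, Y (k + q) \<omega>)"
  have "(\<Sum>p\<in>{..d'} \<times> UNIV. indicator (busy k l q (fst p) (snd p) \<inter> {\<omega> \<in> space M. B (k + q) \<omega> = d' - fst p \<and> Y (Suc (k + q)) \<omega> = j'}) \<omega>)
     = (\<Sum>p\<in>{..d'} \<times> UNIV. if p = ?p then (indicator (busy k l (Suc q) d' j') \<omega> :: ennreal) else 0)"
    using assms level mono by (intro sum.cong refl) (auto simp: indicator_def busy_def start_def)
  also have "\<dots> = indicator (busy k l (Suc q) d' j') \<omega>"
    using level assms mono by (subst sum.delta) (auto simp: busy_def start_def indicator_def)
  finally show ?thesis by simp
qed

text \<open>Substitution u = t + h: from the length of a holding time to the epoch at which it
  ends.\<close>

lemma nn_integral_exponential_shift: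
  fixes \<phi> :: "real \<Rightarrow> ennreal"
  assumes [measurable]: "\<phi> \<in> borel_measurable borel"
  shows "(\<integral>\<^sup>+h. ennreal (exponential_density (exit_rate j) h) * \<phi> (t + h) \<partial>lborel)
    = (\<integral>\<^sup>+u. \<phi> u * (ennreal (exit_rate j) * (indicator {t..} u * ennreal (exp (- exit_rate j * (u - t))))) \<partial>lborel)"
proof -
  have "(\<integral>\<^sup>+u. \<phi> u * (ennreal (exit_rate j) * (indicator {t..} u * ennreal (exp (- exit_rate j * (u - t))))) \<partial>lborel)
     = (\<integral>\<^sup>+h. \<phi> (t + h) * (ennreal (exit_rate j) * (indicator {t..} (t + h) * ennreal (exp (- exit_rate j * h)))) \<partial>lborel)"
    by (subst nn_integral_real_affine[where c=1 and t=t]) auto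
  also have "\<dots> = (\<integral>\<^sup>+h. ennreal (exponential_density (exit_rate j) h) * \<phi> (t + h) \<partial>lborel)"
    using exit_rate_pos[of j]
    by (intro nn_integral_cong) (auto simp: exponential_density_def indicator_def ennreal_mult less_imp_le mult_ac)
  finally show ?thesis by simp
qed

lemma survival_measurable [measurable (raw)]:
  fixes X Z :: "'b \<Rightarrow> real"
  assumes [measurable]: "X \<in> borel_measurable N" "Z \<in> borel_measurable N"
  shows "(\<lambda>p. indicator {X p..} (Z p) :: ennreal) \<in> borel_measurable N"
proof -
  have "(\<lambda>p. indicator {X p..} (Z p) :: ennreal) = (\<lambda>p. if X p \<le> Z p then 1 else 0)"
    by (auto simp: indicator_def)
  thus ?thesis by simp
qed

lemma busy_prob_measurable [measurable]: "busy_prob k l q d j \<in> borel_measurable borel"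
proof -
  have "busy_prob k l q d j = (\<lambda>v. \<integral>\<^sup>+\<omega>. indicator (busy k l q d j) \<omega> *
    (indicator {elapsed k q \<omega>..} v * ennreal (exp (- exit_rate j * (v - elapsed k q \<omega>)))) \<partial>M)"
    by (rule ext) (rule busy_prob_eq)
  thus ?thesis by simp
qed

text \<open>Conditioning on the epoch \<open>u\<close> of the last transition before
  \<open>v\<close>: phase \<open>snd p\<close> is left at \<open>u\<close> with intensity
  \<open>exit_rate (snd p)\<close>, and the phase then entered must survive until
  \<open>v\<close>.\<close>

lemma busy_prob_Suc:
  "busy_prob k l (Suc q) d' j' v = (\<Sum>p\<in>{..d'} \<times> UNIV. ennreal (jump_prob D (snd p) (d' - fst p) j' * exit_rate (snd p)) *
     (\<integral>\<^sup>+u. indicator {..v} u * ennreal (exp (- exit_rate j' * (v - u))) * busy_prob k l q (fst p) (snd p) u \<partial>lborel))"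
proof -
  interpret L: pair_sigma_finite M lborel ..
  \<comment> \<open>The probability that phase \<open>j'\<close>, entered at \<open>u\<close>, is
    held without interruption until \<open>v\<close>.\<close>
  define \<phi> where "\<phi> u = indicator {..v} u * ennreal (exp (- exit_rate j' * (v - u)))" for u :: real
  have [measurable]: "\<phi> \<in> borel_measurable borel" unfolding \<phi>_def by measurable
  let ?I = "\<lambda>p. indicator (busy k l q (fst p) (snd p) \<inter> {\<omega> \<in> space M. B (k + q) \<omega> = d' - fst p \<and> Y (Suc (k + q)) \<omega> = j'}) :: 'w \<Rightarrow> ennreal"
  have "busy_prob k l (Suc q) d' j' v = (\<integral>\<^sup>+\<omega>. indicator (busy k l (Suc q) d' j') \<omega> * \<phi> (elapsed k (Suc q) \<omega>) \<partial>M)"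
    unfolding busy_prob_eq by (intro nn_integral_cong) (auto simp: \<phi>_def indicator_def)
  also have "\<dots> = (\<integral>\<^sup>+\<omega>. (\<Sum>p\<in>{..d'} \<times> UNIV. ?I p \<omega> * \<phi> (elapsed k q \<omega> + H (k + q) \<omega>)) \<partial>M)"
    by (intro nn_integral_cong) (simp only: busy_Suc_indicator elapsed_Suc sum_distrib_right)
  also have "\<dots> = (\<Sum>p\<in>{..d'} \<times> UNIV. (\<integral>\<^sup>+\<omega>. ?I p \<omega> * \<phi> (elapsed k q \<omega> + H (k + q) \<omega>) \<partial>M))"
    by (rule nn_integral_sum) measurable
  also have "\<dots> = (\<Sum>p\<in>{..d'} \<times> UNIV. ennreal (jump_prob D (snd p) (d' - fst p) j' * exit_rate (snd p)) *
     (\<integral>\<^sup>+u. \<phi> u * busy_prob k l q (fst p) (snd p) u \<partial>lborel))"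
  proof (intro sum.cong refl)
    fix p :: "nat \<times> 'm"
    obtain d j where p: "p = (d, j)" by (cases p)
    let ?\<psi> = "\<lambda>\<omega> u. indicator {elapsed k q \<omega>..} u * ennreal (exp (- exit_rate j * (u - elapsed k q \<omega>)))"
    have sub: "busy k l q d j \<subseteq> {\<omega> \<in> space M. Y (k + q) \<omega> = j}" by (auto simp: busy_def)
    have "(\<lambda>(t, h). \<phi> (t + h)) \<in> borel_measurable (borel \<Otimes>\<^sub>M borel)" by measurable
    from next_jump_nn_integral[OF busy_F sub elapsed_F this, of "d' - d" j']
    have "(\<integral>\<^sup>+\<omega>. ?I p \<omega> * \<phi> (elapsed k q \<omega> + H (k + q) \<omega>) \<partial>M) = ennreal (jump_prob D j (d' - d) j') *
      (\<integral>\<^sup>+\<omega>. indicator (busy k l q d j) \<omega> * (\<integral>\<^sup>+h. ennreal (exponential_density (exit_rate j) h) * \<phi> (elapsed k q \<omega> + h) \<partial>lborel) \<partial>M)"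
      by (simp add: p)
    also have "(\<integral>\<^sup>+\<omega>. indicator (busy k l q d j) \<omega> * (\<integral>\<^sup>+h. ennreal (exponential_density (exit_rate j) h) * \<phi> (elapsed k q \<omega> + h) \<partial>lborel) \<partial>M)
       = (\<integral>\<^sup>+\<omega>. (\<integral>\<^sup>+u. indicator (busy k l q d j) \<omega> * (\<phi> u * (ennreal (exit_rate j) * ?\<psi> \<omega> u)) \<partial>lborel) \<partial>M)"
      by (intro nn_integral_cong) (simp only: nn_integral_exponential_shift[OF \<open>\<phi> \<in> borel_measurable borel\<close>], subst nn_integral_cmult, auto)
    \<comment> \<open>Tonelli makes the integral over the sample point the inner one, where the
      survival factor turns back into \<open>busy_prob\<close> at \<open>u\<close>.\<close>
    also have "\<dots> = (\<integral>\<^sup>+u. (\<integral>\<^sup>+\<omega>. indicator (busy k l q d j) \<omega> * (\<phi> u * (ennreal (exit_rate j) * ?\<psi> \<omega> u)) \<partial>M) \<partial>lborel)"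
      by (rule L.Fubini'[symmetric]) measurable
    also have "\<dots> = (\<integral>\<^sup>+u. ennreal (exit_rate j) * (\<phi> u * busy_prob k l q d j u) \<partial>lborel)"
    proof (intro nn_integral_cong)
      fix u
      have "(\<integral>\<^sup>+\<omega>. indicator (busy k l q d j) \<omega> * (\<phi> u * (ennreal (exit_rate j) * ?\<psi> \<omega> u)) \<partial>M)
         = (\<integral>\<^sup>+\<omega>. (ennreal (exit_rate j) * \<phi> u) * (indicator (busy k l q d j) \<omega> * ?\<psi> \<omega> u) \<partial>M)"
        by (intro nn_integral_cong) (simp only: mult_ac)
      also have "\<dots> = (ennreal (exit_rate j) * \<phi> u) * busy_prob k l q d j u"
        unfolding busy_prob_eq by (rule nn_integral_cmult) measurable
      finally show "(\<integral>\<^sup>+\<omega>. indicator (busy k l q d j) \<omega> * (\<phi> u * (ennreal (exit_rate j) * ?\<psi> \<omega> u)) \<partial>M)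
         = ennreal (exit_rate j) * (\<phi> u * busy_prob k l q d j u)" by (simp only: mult.assoc)
    qed
    also have "\<dots> = ennreal (exit_rate j) * (\<integral>\<^sup>+u. \<phi> u * busy_prob k l q d j u \<partial>lborel)"
      by (rule nn_integral_cmult) measurable
    finally show "(\<integral>\<^sup>+\<omega>. ?I p \<omega> * \<phi> (elapsed k q \<omega> + H (k + q) \<omega>) \<partial>M) = ennreal (jump_prob D (snd p) (d' - fst p) j' * exit_rate (snd p)) *
     (\<integral>\<^sup>+u. \<phi> u * busy_prob k l q (fst p) (snd p) u \<partial>lborel)"
      using jump_prob_nonneg exit_rate_pos by (simp add: p ennreal_mult less_imp_le mult.assoc)
  qed
  finally show ?thesis by (simp add: \<phi>_def)
qed

lemma busy_prob_0:
  assumes "0 \<le> v"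
  shows "busy_prob k l 0 d j v = (if d = 0 then ennreal (visit_prob k l j * exp (- exit_rate j * v)) else 0)"
proof (cases "d = 0")
  case True
  have "busy_prob k l 0 d j v = (\<integral>\<^sup>+\<omega>. indicator (busy k l 0 d j) \<omega> * ennreal (exp (- exit_rate j * v)) \<partial>M)"
    unfolding busy_prob_eq using assms by simp
  also have "\<dots> = emeasure M (busy k l 0 d j) * ennreal (exp (- exit_rate j * v))"
    by (simp add: nn_integral_multc)
  also have "busy k l 0 d j = start k l \<inter> {\<omega> \<in> space M. Y k \<omega> = j}"
    using True by (auto simp: busy_def start_def)
  finally show ?thesis using True by (simp add: visit_prob_def emeasure_eq_measure ennreal_mult)
next
  case False
  hence "busy k l 0 d j = {}" by (auto simp: busy_def start_def)
  thus ?thesis using False by (simp add: busy_prob_def)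
qed

lemma busy_prob_neg: "v < 0 \<Longrightarrow> busy_prob k l q d j v = 0"
proof -
  assume "v < 0"
  hence "busy k l q d j \<inter> {\<omega> \<in> space M. elapsed k q \<omega> \<le> v \<and> v < elapsed k (Suc q) \<omega>} = {}"
    using elapsed_nonneg[of _ k q] by force
  thus ?thesis by (simp add: busy_prob_def)
qed

end

section \<open>The number of arrivals during a service\<close>

text \<open>Both sides run over all triples with e + c + f = n: associativity of
  convolution.\<close>

lemma sum_triangle_shift:
  "(\<Sum>d\<le>n. \<Sum>e\<le>d. X e (d - e) (n - d)) = (\<Sum>e\<le>(n::nat). \<Sum>c\<le>n - e. (X e c (n - e - c) :: 'a::comm_monoid_add))"
proof -
  have "(\<Sum>d\<le>n. \<Sum>e\<le>d. X e (d - e) (n - d)) = (\<Sum>(d, e)\<in>(SIGMA d:{..n}. {..d}). X e (d - e) (n - d))"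
    by (rule sum.Sigma) auto
  also have "\<dots> = (\<Sum>(e, c)\<in>(SIGMA e:{..n}. {..n - e}). X e c (n - e - c))"
    by (rule sum.reindex_bij_witness[of _ "\<lambda>(e, c). (e + c, e)" "\<lambda>(d, e). (e, d - e)"]) auto
  also have "\<dots> = (\<Sum>e\<le>n. \<Sum>c\<le>n - e. X e c (n - e - c))"
    by (rule sum.Sigma[symmetric]) auto
  finally show ?thesis .
qed

context stationary_bulk_queue
begin

lemma elapsed_mono: "\<omega> \<in> space M \<Longrightarrow> q \<le> q' \<Longrightarrow> elapsed k q \<omega> \<le> elapsed k q' \<omega>"
  unfolding elapsed_def by (intro sum_mono2) (auto simp: H_pos less_imp_le)

lemma start_disjoint: "a \<le> l \<Longrightarrow> disjoint_family (\<lambda>k. start k l)"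
  unfolding disjoint_family_on_def start_def
  by (auto simp: nat_neq_iff)

lemma start_total_le: "a \<le> l \<Longrightarrow> (\<Sum>k. emeasure M (start k l)) \<le> 1"
proof -
  assume "a \<le> l"
  hence "(\<Sum>k. emeasure M (start k l)) = emeasure M (\<Union>k. start k l)"
    by (intro suminf_emeasure start_disjoint) auto
  thus ?thesis using emeasure_le_1 by simp
qed

text \<open>For \<open>a \<le> l\<close>: the probability that the first service starts with
  \<open>l\<close> customers and that \<open>v\<close> time units later, whatever the service time,
  \<open>d\<close> more have come and the phase is \<open>j\<close>. Values in
  \<open>ennreal\<close> make all exchanges of sums and integrals unconditional.\<close>

definition after_start_enn :: "nat \<Rightarrow> nat \<Rightarrow> 'm \<Rightarrow> real \<Rightarrow> ennreal" where
  "after_start_enn l d j v = (\<Sum>k. \<Sum>q. busy_prob k l q d j v)"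

text \<open>The events are disjoint in \<open>q\<close>, as each fixes the number of transitions up
  to \<open>v\<close>, and in \<open>k\<close>, as the first service starts only once.\<close>

lemma after_start_enn_le: assumes "a \<le> l" shows "after_start_enn l d j v \<le> 1"
proof -
  have "(\<Sum>q. busy_prob k l q d j v) \<le> emeasure M (start k l)" for k
  proof -
    let ?E = "\<lambda>q. busy k l q d j \<inter> {\<omega> \<in> space M. elapsed k q \<omega> \<le> v \<and> v < elapsed k (Suc q) \<omega>}"
    have "False" if "\<omega> \<in> ?E q" "\<omega> \<in> ?E q'" "q < q'" for \<omega> q q'
      using that elapsed_mono[of \<omega> "Suc q" q' k] by auto
    hence "?E q \<inter> ?E q' = {}" if "q \<noteq> q'" for q q'
      using that by (cases q q' rule: linorder_cases) blast+
    hence "disjoint_family ?E" by (simp add: disjoint_family_on_def)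
    hence "(\<Sum>q. busy_prob k l q d j v) = emeasure M (\<Union>q. ?E q)"
      unfolding busy_prob_def by (intro suminf_emeasure) auto
    also have "\<dots> \<le> emeasure M (start k l)"
      by (intro emeasure_mono) (auto simp: busy_def)
    finally show ?thesis .
  qed
  hence "after_start_enn l d j v \<le> (\<Sum>k. emeasure M (start k l))"
    unfolding after_start_enn_def by (intro suminf_le) auto
  also have "\<dots> \<le> 1" by (rule start_total_le[OF assms])
  finally show ?thesis .
qed

lemma after_start_enn_measurable [measurable]: "after_start_enn l d j \<in> borel_measurable borel"
  unfolding after_start_enn_def by measurable

lemma after_start_enn_neg: "v < 0 \<Longrightarrow> after_start_enn l d j v = 0"
  by (simp add: after_start_enn_def busy_prob_neg)

lemma visit_prob_nonneg: "0 \<le> visit_prob k l j" by (simp add: visit_prob_def)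

text \<open>The mean number of visits. For \<open>a \<le> l\<close> at most one visit occurs and
  this is the row vector \<alpha>(l) of the overview; for \<open>l < a\<close> every silent phase
  change counts again.\<close>

definition visits :: "nat \<Rightarrow> 'm \<Rightarrow> real" where "visits l j = (\<Sum>k. visit_prob k l j)"

lemma visit_prob_summable_ge:
  assumes "a \<le> l" shows "summable (\<lambda>k. visit_prob k l j)"
proof (rule summableI_nonneg_bounded[OF visit_prob_nonneg])
  fix n
  have "(\<Sum>k<n. ennreal (visit_prob k l j)) \<le> (\<Sum>k<n. emeasure M (start k l))"
    unfolding visit_prob_def emeasure_eq_measure by (intro sum_mono ennreal_leI finite_measure_mono) auto
  also have "\<dots> \<le> (\<Sum>k. emeasure M (start k l))" by (rule sum_le_suminf) auto
  also have "\<dots> \<le> 1" by (rule start_total_le[OF assms])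
  finally show "(\<Sum>k<n. visit_prob k l j) \<le> 1" by (simp add: visit_prob_nonneg sum_nonneg)
qed

text \<open>The intensities of actual transitions: \<open>D\<close> with the diagonal of
  \<open>D 0\<close> removed.\<close>

definition rate :: "nat \<Rightarrow> 'm \<Rightarrow> 'm \<Rightarrow> real" where
  "rate c i j = D c $ i $ j + (if c = 0 \<and> j = i then exit_rate i else 0)"

lemma rate_eq: "jump_prob D i c j * exit_rate i = rate c i j"
  using exit_rate_pos[of i] by (simp add: jump_prob_eq rate_def)

lemma rate_nonneg: "0 \<le> rate c i j"
  unfolding rate_eq[symmetric] using jump_prob_nonneg exit_rate_pos by (simp add: less_imp_le)

text \<open>Summed over \<open>k\<close> and \<open>q\<close>, the decomposition at the last
  transition becomes a Volterra equation: either no transition has occurred by \<open>v\<close>, or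
  the last one came at \<open>u\<close>.\<close>

lemma after_start_enn_renewal:
  assumes l: "a \<le> l" and v: "0 \<le> v"
  shows "after_start_enn l d' j' v = ennreal ((if d' = 0 then visits l j' else 0) * exp (- exit_rate j' * v)) +
    (\<Sum>p\<in>{..d'} \<times> UNIV. ennreal (rate (d' - fst p) (snd p) j') *
     (\<integral>\<^sup>+u. indicator {..v} u * ennreal (exp (- exit_rate j' * (v - u))) * after_start_enn l (fst p) (snd p) u \<partial>lborel))"
proof -
  let ?K = "\<lambda>u. indicator {..v} u * ennreal (exp (- exit_rate j' * (v - u)))"
  have "after_start_enn l d' j' v = (\<Sum>k. busy_prob k l 0 d' j' v + (\<Sum>q. busy_prob k l (Suc q) d' j' v))"
    unfolding after_start_enn_def by (intro suminf_cong) (subst suminf_offset[of _ 1], simp_all)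
  also have "\<dots> = (\<Sum>k. busy_prob k l 0 d' j' v) + (\<Sum>k. \<Sum>q. busy_prob k l (Suc q) d' j' v)"
    by (rule suminf_add[symmetric]) auto
  also have "(\<Sum>k. busy_prob k l 0 d' j' v) = ennreal ((if d' = 0 then visits l j' else 0) * exp (- exit_rate j' * v))"
  proof (cases "d' = 0")
    case True
    have "(\<Sum>k. busy_prob k l 0 d' j' v) = (\<Sum>k. ennreal (visit_prob k l j' * exp (- exit_rate j' * v)))"
      using True by (simp add: busy_prob_0[OF v])
    also have "\<dots> = ennreal (\<Sum>k. visit_prob k l j' * exp (- exit_rate j' * v))"
      by (rule suminf_ennreal2) (auto simp: visit_prob_nonneg intro!: summable_mult2 visit_prob_summable_ge l)
    also have "(\<Sum>k. visit_prob k l j' * exp (- exit_rate j' * v)) = visits l j' * exp (- exit_rate j' * v)"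
      unfolding visits_def by (rule suminf_mult2[symmetric]) (rule visit_prob_summable_ge[OF l])
    finally show ?thesis using True by simp
  qed (simp add: busy_prob_0[OF v])
  also have "(\<Sum>k. \<Sum>q. busy_prob k l (Suc q) d' j' v) = (\<Sum>p\<in>{..d'} \<times> UNIV. ennreal (rate (d' - fst p) (snd p) j') *
     (\<integral>\<^sup>+u. ?K u * after_start_enn l (fst p) (snd p) u \<partial>lborel))"
  proof -
    have "(\<Sum>k. \<Sum>q. \<Sum>p\<in>{..d'} \<times> UNIV. ennreal (rate (d' - fst p) (snd p) j') * (\<integral>\<^sup>+u. ?K u * busy_prob k l q (fst p) (snd p) u \<partial>lborel))
       = (\<Sum>p\<in>{..d'} \<times> UNIV. ennreal (rate (d' - fst p) (snd p) j') * (\<Sum>k. \<Sum>q. \<integral>\<^sup>+u. ?K u * busy_prob k l q (fst p) (snd p) u \<partial>lborel))"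
    proof -
      let ?c = "\<lambda>p. ennreal (rate (d' - fst p) (snd p) j')" and ?G = "\<lambda>k q p. \<integral>\<^sup>+u. ?K u * busy_prob k l q (fst p) (snd p) u \<partial>lborel"
      have "(\<Sum>k. \<Sum>q. \<Sum>p\<in>{..d'} \<times> UNIV. ?c p * ?G k q p) = (\<Sum>k. \<Sum>p\<in>{..d'} \<times> UNIV. \<Sum>q. ?c p * ?G k q p)"
        by (intro suminf_cong suminf_sum summableI)
      also have "\<dots> = (\<Sum>p\<in>{..d'} \<times> UNIV. \<Sum>k. \<Sum>q. ?c p * ?G k q p)"
        by (intro suminf_sum summableI)
      finally show ?thesis by (simp only: ennreal_suminf_cmult)
    qed
    also have "\<dots> = (\<Sum>p\<in>{..d'} \<times> UNIV. ennreal (rate (d' - fst p) (snd p) j') * (\<integral>\<^sup>+u. ?K u * after_start_enn l (fst p) (snd p) u \<partial>lborel))"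
    proof (intro sum.cong refl arg_cong[where f="\<lambda>x. _ * x"])
      fix p :: "nat \<times> 'm"
      have "(\<Sum>k. \<Sum>q. \<integral>\<^sup>+u. ?K u * busy_prob k l q (fst p) (snd p) u \<partial>lborel) = (\<Sum>k. \<integral>\<^sup>+u. (\<Sum>q. ?K u * busy_prob k l q (fst p) (snd p) u) \<partial>lborel)"
        by (intro suminf_cong nn_integral_suminf[symmetric]) measurable
      also have "\<dots> = (\<integral>\<^sup>+u. (\<Sum>k. \<Sum>q. ?K u * busy_prob k l q (fst p) (snd p) u) \<partial>lborel)"
        by (intro nn_integral_suminf[symmetric]) measurable
      finally show "(\<Sum>k. \<Sum>q. \<integral>\<^sup>+u. ?K u * busy_prob k l q (fst p) (snd p) u \<partial>lborel) = (\<integral>\<^sup>+u. ?K u * after_start_enn l (fst p) (snd p) u \<partial>lborel)"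
        by (simp only: after_start_enn_def ennreal_suminf_cmult)
    qed
    finally show ?thesis unfolding busy_prob_Suc rate_eq .
  qed
  finally show ?thesis .
qed

definition after_start :: "nat \<Rightarrow> nat \<Rightarrow> 'm \<Rightarrow> real \<Rightarrow> real" where "after_start l d j v = enn2real (after_start_enn l d j v)"

lemma after_start_measurable [measurable]: "after_start l d j \<in> borel_measurable borel"
  unfolding after_start_def by measurable

lemma after_start_nonneg: "0 \<le> after_start l d j v" by (simp add: after_start_def)

lemma ennreal_after_start: "a \<le> l \<Longrightarrow> ennreal (after_start l d j v) = after_start_enn l d j v"
  using after_start_enn_le[of l d j v] unfolding after_start_def by (intro ennreal_enn2real) (auto simp: less_top[symmetric] top_unique)

lemma after_start_le: "a \<le> l \<Longrightarrow> after_start l d j v \<le> 1"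
  using after_start_enn_le[of l d j v] unfolding after_start_def by (simp add: enn2real_leI)

lemma exp_after_start_integrable:
  assumes "a \<le> l"
  shows "set_integrable lborel {0..v} (\<lambda>u. exp (c * u) * after_start l d j u)"
proof -
  have "set_integrable lborel {0..v} (\<lambda>u. exp (\<bar>c\<bar> * v))"
    by (intro borel_integrable_atLeastAtMost' continuous_intros)
  thus ?thesis
  proof (rule set_integrable_bound)
    show "set_borel_measurable lborel {0..v} (\<lambda>u. exp (c * u) * after_start l d j u)"
      unfolding set_borel_measurable_def by measurable
    have "c * u \<le> \<bar>c\<bar> * v" if "0 \<le> u" "u \<le> v" for u
      using that by (intro mult_mono) auto
    hence "exp (c * u) * after_start l d j u \<le> exp (\<bar>c\<bar> * v)" if "0 \<le> u" "u \<le> v" for u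
      using that after_start_le[OF assms, of d j u] after_start_nonneg[of l d j u] mult_mono[of "exp (c * u)" "exp (\<bar>c\<bar> * v)" "after_start l d j u" 1] by simp
    thus "AE u in lborel. u \<in> {0..v} \<longrightarrow> norm (exp (c * u) * after_start l d j u) \<le> norm (exp (\<bar>c\<bar> * v))"
      using after_start_nonneg by (auto simp: abs_mult)
  qed
qed

text \<open>The survival factor is split as e^(-cv) e^(cu) so that the integrand no longer contains
  \<open>v\<close>; the fundamental theorem of calculus then becomes applicable.\<close>

lemma after_start_renewal:
  assumes l: "a \<le> l" and v: "0 \<le> v"
  shows "after_start l d' j' v = exp (- exit_rate j' * v) * ((if d' = 0 then visits l j' else 0) +
    integral {0..v} (\<lambda>u. \<Sum>p\<in>{..d'} \<times> UNIV. rate (d' - fst p) (snd p) j' * (exp (exit_rate j' * u) * after_start l (fst p) (snd p) u)))"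
proof -
  let ?c = "exit_rate j'"
  let ?J = "\<lambda>p. integral {0..v} (\<lambda>u. exp (?c * u) * after_start l (fst p) (snd p) u)"
  let ?r = "\<lambda>p. rate (d' - fst p) (snd p) j'"
  have J_nonneg: "0 \<le> ?J p" for p
    using set_borel_integral_eq_integral(1)[OF exp_after_start_integrable[OF l, of v ?c "fst p" "snd p"]]
    by (intro integral_nonneg) (auto simp: after_start_nonneg)
  have U: "0 \<le> visits l j'" unfolding visits_def by (intro suminf_nonneg visit_prob_summable_ge l visit_prob_nonneg)
  have J: "(\<integral>\<^sup>+u. indicator {..v} u * ennreal (exp (- ?c * (v - u))) * after_start_enn l (fst p) (snd p) u \<partial>lborel)
      = ennreal (exp (- ?c * v) * ?J p)" for p
  proof -
    have "indicator {..v} u * ennreal (exp (- ?c * (v - u))) * after_start_enn l (fst p) (snd p) u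
       = ennreal (exp (- ?c * v)) * ennreal (indicator {0..v} u *\<^sub>R (exp (?c * u) * after_start l (fst p) (snd p) u))" for u
    proof (cases "0 \<le> u \<and> u \<le> v")
      case True
      have "exp (- ?c * (v - u)) = exp (- ?c * v) * exp (?c * u)"
        by (simp add: algebra_simps flip: exp_add)
      thus ?thesis using True after_start_nonneg
        by (simp add: ennreal_after_start[OF l, symmetric] ennreal_mult mult.assoc)
    next
      case False
      thus ?thesis by (auto simp: after_start_enn_neg)
    qed
    hence "(\<integral>\<^sup>+u. indicator {..v} u * ennreal (exp (- ?c * (v - u))) * after_start_enn l (fst p) (snd p) u \<partial>lborel)
      = ennreal (exp (- ?c * v)) * (\<integral>\<^sup>+u. ennreal (indicator {0..v} u *\<^sub>R (exp (?c * u) * after_start l (fst p) (snd p) u)) \<partial>lborel)"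
      by (simp add: nn_integral_cmult)
    also have "(\<integral>\<^sup>+u. ennreal (indicator {0..v} u *\<^sub>R (exp (?c * u) * after_start l (fst p) (snd p) u)) \<partial>lborel)
      = ennreal (LINT u:{0..v}|lborel. exp (?c * u) * after_start l (fst p) (snd p) u)"
      unfolding set_lebesgue_integral_def
      using exp_after_start_integrable[OF l, of v ?c "fst p" "snd p"] after_start_nonneg
      by (intro nn_integral_eq_integral) (auto simp: set_integrable_def)
    also have "(LINT u:{0..v}|lborel. exp (?c * u) * after_start l (fst p) (snd p) u) = ?J p"
      by (rule set_borel_integral_eq_integral(2)[OF exp_after_start_integrable[OF l]])
    finally show ?thesis by (simp only: ennreal_mult'[OF exp_ge_zero])
  qed
  have "ennreal (after_start l d' j' v) = ennreal ((if d' = 0 then visits l j' else 0) * exp (- ?c * v)) +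
     (\<Sum>p\<in>{..d'} \<times> UNIV. ennreal (?r p * (exp (- ?c * v) * ?J p)))"
    unfolding ennreal_after_start[OF l] after_start_enn_renewal[OF l v] J
    by (intro arg_cong2[where f="(+)"] sum.cong refl ennreal_mult[symmetric] rate_nonneg mult_nonneg_nonneg J_nonneg) auto
  also have "\<dots> = ennreal ((if d' = 0 then visits l j' else 0) * exp (- ?c * v) + (\<Sum>p\<in>{..d'} \<times> UNIV. ?r p * (exp (- ?c * v) * ?J p)))"
    using U J_nonneg rate_nonneg by (subst sum_ennreal) (auto simp: ennreal_plus[symmetric] sum_nonneg simp del: ennreal_plus)
  finally have "after_start l d' j' v = (if d' = 0 then visits l j' else 0) * exp (- ?c * v) + (\<Sum>p\<in>{..d'} \<times> UNIV. ?r p * (exp (- ?c * v) * ?J p))"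
    using U J_nonneg rate_nonneg after_start_nonneg by (subst (asm) ennreal_inj) (auto intro!: add_nonneg_nonneg sum_nonneg mult_nonneg_nonneg)
  also have "\<dots> = exp (- ?c * v) * ((if d' = 0 then visits l j' else 0) + (\<Sum>p\<in>{..d'} \<times> UNIV. ?r p * ?J p))"
    by (simp add: distrib_left sum_distrib_left mult_ac)
  also have "(\<Sum>p\<in>{..d'} \<times> UNIV. ?r p * ?J p)
     = integral {0..v} (\<lambda>u. \<Sum>p\<in>{..d'} \<times> UNIV. ?r p * (exp (?c * u) * after_start l (fst p) (snd p) u))"
    using set_borel_integral_eq_integral(1)[OF exp_after_start_integrable[OF l]]
    by (subst integral_sum) (auto intro!: integrable_on_mult_right)
  finally show ?thesis .
qed

text \<open>A bootstrap: boundedness gives integrability, the renewal equation then gives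
  continuity, and continuity of the integrand will allow the equation to be differentiated.\<close>

lemma after_start_continuous:
  assumes l: "a \<le> l"
  shows "continuous_on {0..T} (after_start l d j)"
proof -
  have "(\<lambda>u. \<Sum>p\<in>{..d} \<times> UNIV. rate (d - fst p) (snd p) j * (exp (exit_rate j * u) * after_start l (fst p) (snd p) u)) integrable_on {0..T}"
    using set_borel_integral_eq_integral(1)[OF exp_after_start_integrable[OF l]]
    by (intro integrable_sum integrable_on_mult_right) auto
  hence "continuous_on {0..T} (\<lambda>v. exp (- exit_rate j * v) * ((if d = 0 then visits l j else 0) +
    integral {0..v} (\<lambda>u. \<Sum>p\<in>{..d} \<times> UNIV. rate (d - fst p) (snd p) j * (exp (exit_rate j * u) * after_start l (fst p) (snd p) u))))"
    by (intro continuous_intros indefinite_integral_continuous_1)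
  thus ?thesis
    by (rule continuous_on_eq) (simp add: after_start_renewal[OF l])
qed

text \<open>The exit rate coming from the exponential factor is what \<open>rate\<close> lacks on
  the diagonal of \<open>D 0\<close>. So the generator appears, to the right of the vector: the
  forward equation.\<close>

lemma after_start_derivative:
  assumes l: "a \<le> l" and v: "v \<in> {0..T}"
  shows "(after_start l d j has_real_derivative (\<Sum>p\<in>{..d} \<times> UNIV. D (d - fst p) $ snd p $ j * after_start l (fst p) (snd p) v)) (at v within {0..T})"
proof -
  let ?c = "exit_rate j"
  let ?h = "\<lambda>u. \<Sum>p\<in>{..d} \<times> UNIV. rate (d - fst p) (snd p) j * (exp (?c * u) * after_start l (fst p) (snd p) u)"
  let ?I = "\<lambda>v. (if d = 0 then visits l j else 0) + integral {0..v} ?h"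
  have "continuous_on {0..T} ?h"
    by (intro continuous_intros after_start_continuous l)
  hence I: "((\<lambda>v. integral {0..v} ?h) has_real_derivative ?h v) (at v within {0..T})"
    using v by (rule integral_has_real_derivative)
  have "((\<lambda>v. exp (- ?c * v) * ?I v) has_real_derivative (- ?c * (exp (- ?c * v) * ?I v) + exp (- ?c * v) * ?h v)) (at v within {0..T})"
  proof -
    have E: "((\<lambda>v. exp (- ?c * v)) has_real_derivative - ?c * exp (- ?c * v)) (at v within {0..T})"
      by (auto intro!: derivative_eq_intros)
    have "(?I has_real_derivative ?h v) (at v within {0..T})"
      by (rule DERIV_cong[OF DERIV_add[OF DERIV_const I]]) (rule add_0_left)
    from DERIV_mult[OF E this] show ?thesis by (simp only: mult.assoc mult.commute[of "?h v"])
  qed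
  hence 1: "(after_start l d j has_real_derivative (- ?c * (exp (- ?c * v) * ?I v) + exp (- ?c * v) * ?h v)) (at v within {0..T})"
    by (rule has_field_derivative_transform_within[OF _ zero_less_one]) (use v in \<open>auto simp: after_start_renewal[OF l]\<close>)
  have 2: "exp (- ?c * v) * ?I v = after_start l d j v"
    using v by (simp add: after_start_renewal[OF l])
  have "exp (- ?c * v) * ?h v = (\<Sum>p\<in>{..d} \<times> UNIV. rate (d - fst p) (snd p) j * after_start l (fst p) (snd p) v)"
    unfolding sum_distrib_left by (intro sum.cong refl) (simp add: exp_minus field_simps)
  also have "\<dots> = (\<Sum>p\<in>{..d} \<times> UNIV. D (d - fst p) $ snd p $ j * after_start l (fst p) (snd p) v + (if p = (d, j) then ?c * after_start l d j v else 0))"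
    by (intro sum.cong refl) (auto simp: rate_def distrib_right)
  also have "\<dots> = (\<Sum>p\<in>{..d} \<times> UNIV. D (d - fst p) $ snd p $ j * after_start l (fst p) (snd p) v) + ?c * after_start l d j v"
    by (simp add: sum.distrib)
  finally show ?thesis using 1 unfolding 2 by simp
qed

lemma after_start_0: "a \<le> l \<Longrightarrow> after_start l d j 0 = (if d = 0 then visits l j else 0)"
  by (simp add: after_start_renewal)

text \<open>For a solution \<open>F\<close> of the forward equation, \<open>F(u) P(v - u)\<close> does not depend on \<open>u\<close>.\<close>

lemma after_start_eq:
  assumes l: "a \<le> l" and v: "0 \<le> v"
  shows "after_start l n i v = (\<Sum>j\<in>UNIV. visits l j * count_prob n v $ j $ i)"
proof -
  define \<phi> where "\<phi> u = (\<Sum>d\<le>n. \<Sum>j\<in>UNIV. after_start l d j u * count_prob (n - d) (v - u) $ j $ i)" for u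
  have "(\<phi> has_real_derivative 0) (at u within {0..v})" if u: "u \<in> {0..v}" for u
  proof -
    \<comment> \<open>The common summand of both halves of the product rule: \<open>e\<close>
      arrivals before, \<open>c\<close> at and \<open>f\<close> after a transition at
      \<open>u\<close>. The halves bracket e + c + f = n differently and cancel.\<close>
    define X where "X e c f = (\<Sum>h\<in>UNIV. \<Sum>j\<in>UNIV. after_start l e h u * D c $ h $ j * count_prob f (v - u) $ j $ i)" for e c f
    let ?F' = "\<lambda>d j. \<Sum>p\<in>{..d} \<times> UNIV. D (d - fst p) $ snd p $ j * after_start l (fst p) (snd p) u"
    let ?P' = "\<lambda>d j. \<Sum>c\<le>d. (D c ** count_prob (d - c) (v - u)) $ j $ i"
    have P': "((\<lambda>u. count_prob d (v - u) $ j $ i) has_real_derivative - ?P' d j) (at u within {0..v})" for d j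
    proof -
      have "((\<lambda>u. v - u) has_real_derivative - 1) (at u within {0..v})"
        by (auto intro!: derivative_eq_intros)
      from DERIV_chain2[where f="\<lambda>t. count_prob d t $ j $ i" and g="\<lambda>u. v - u", OF count_prob_has_derivative this]
      show ?thesis by simp
    qed
    have "(\<phi> has_real_derivative (\<Sum>d\<le>n. \<Sum>j\<in>UNIV. ?F' d j * count_prob (n - d) (v - u) $ j $ i + (- ?P' (n - d) j) * after_start l d j u)) (at u within {0..v})"
      unfolding \<phi>_def by (intro DERIV_sum DERIV_mult after_start_derivative[OF l u] P')
    moreover have "(\<Sum>d\<le>n. \<Sum>j\<in>UNIV. ?F' d j * count_prob (n - d) (v - u) $ j $ i) = (\<Sum>d\<le>n. \<Sum>e\<le>d. X e (d - e) (n - d))"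
    proof (intro sum.cong refl)
      fix d
      have "(\<Sum>j\<in>UNIV. ?F' d j * count_prob (n - d) (v - u) $ j $ i)
        = (\<Sum>j\<in>UNIV. \<Sum>e\<le>d. \<Sum>h\<in>UNIV. after_start l e h u * D (d - e) $ h $ j * count_prob (n - d) (v - u) $ j $ i)"
        by (simp add: sum.cartesian_product[symmetric] split_beta sum_distrib_right sum_distrib_left mult_ac
              flip: sum.cartesian_product[of "\<lambda>e h. D (d - e) $ h $ _ * after_start l e h u", unfolded split_beta])
      also have "\<dots> = (\<Sum>e\<le>d. \<Sum>h\<in>UNIV. \<Sum>j\<in>UNIV. after_start l e h u * D (d - e) $ h $ j * count_prob (n - d) (v - u) $ j $ i)"
        by (rule trans[OF sum.swap sum.cong[OF refl sum.swap]])
      finally show "(\<Sum>j\<in>UNIV. ?F' d j * count_prob (n - d) (v - u) $ j $ i) = (\<Sum>e\<le>d. X e (d - e) (n - d))"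
        by (simp add: X_def)
    qed
    moreover have "(\<Sum>d\<le>n. \<Sum>j\<in>UNIV. ?P' (n - d) j * after_start l d j u) = (\<Sum>e\<le>n. \<Sum>c\<le>n - e. X e c (n - e - c))"
    proof (intro sum.cong refl)
      fix d
      have "(\<Sum>j\<in>UNIV. ?P' (n - d) j * after_start l d j u)
        = (\<Sum>j\<in>UNIV. \<Sum>c\<le>n - d. \<Sum>h\<in>UNIV. after_start l d j u * D c $ j $ h * count_prob (n - d - c) (v - u) $ h $ i)"
        by (simp add: matrix_matrix_mult_def sum_distrib_right sum_distrib_left mult_ac)
      also have "\<dots> = (\<Sum>c\<le>n - d. X d c (n - d - c))"
        unfolding X_def by (rule sum.swap)
      finally show "(\<Sum>j\<in>UNIV. ?P' (n - d) j * after_start l d j u) = (\<Sum>c\<le>n - d. X d c (n - d - c))" .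
    qed
    ultimately show ?thesis
      by (simp add: sum.distrib sum_negf sum_subtractf sum_triangle_shift)
  qed
  then obtain c where c: "\<And>u. u \<in> {0..v} \<Longrightarrow> \<phi> u = c"
    using has_field_derivative_zero_constant[of "{0..v}" \<phi>] by auto
  have "\<phi> v = after_start l n i v"
  proof -
    have "\<phi> v = (\<Sum>d\<le>n. \<Sum>j\<in>UNIV. if d = n \<and> j = i then after_start l n i v else 0)"
      unfolding \<phi>_def by (intro sum.cong refl) (auto simp: count_prob_0 mat_def)
    also have "\<dots> = (\<Sum>d\<le>n. if d = n then after_start l n i v else 0)"
      by (intro sum.cong refl) auto
    finally show ?thesis by simp
  qed
  moreover have "\<phi> 0 = (\<Sum>j\<in>UNIV. visits l j * count_prob n v $ j $ i)"
  proof -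
    have "\<phi> 0 = (\<Sum>d\<le>n. if d = 0 then (\<Sum>j\<in>UNIV. visits l j * count_prob n v $ j $ i) else 0)"
      unfolding \<phi>_def by (intro sum.cong refl) (auto simp: after_start_0[OF l])
    thus ?thesis by simp
  qed
  ultimately show ?thesis using c[of v] c[of 0] v by simp
qed

end

section \<open>The idle period\<close>

lemma invertible_uminus:
  fixes A :: "'a::comm_ring_1^'n^'n"
  assumes "invertible A" shows "invertible (- A)"
proof -
  obtain B where "A ** B = mat 1" "B ** A = mat 1" using assms unfolding invertible_def by blast
  moreover have "(- X) ** (- Z) = X ** Z" for X Z :: "'a^'n^'n"
    by (simp add: matrix_matrix_mult_def)
  ultimately show ?thesis unfolding invertible_def by metis
qed

lemma
  assumes "invertible A"
  shows mult_matrix_inv: "A ** matrix_inv A = mat 1" and matrix_inv_mult: "matrix_inv A ** A = mat 1"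
proof -
  have "\<exists>A'. A ** A' = mat 1 \<and> A' ** A = mat 1" using assms by (simp add: invertible_def)
  from someI_ex[OF this] show "A ** matrix_inv A = mat 1" "matrix_inv A ** A = mat 1"
    by (simp_all add: matrix_inv_def)
qed

context stationary_bulk_queue
begin

lemma D_eq: "D c $ i $ j = exit_rate i * (jump_prob D i c j - (if c = 0 \<and> j = i then 1 else 0))"
  using exit_rate_pos[of i] by (simp add: jump_prob_eq field_simps)

text \<open>
  \<open>h i\<close> is the mean number of transitions up to and including the first arrival, starting from
  phase \<open>i\<close>; the invertibility of \<open>D 0\<close> makes it finite.
\<close>

lemma ex_mean_silent_jumps:
  "\<exists>h. \<forall>i. 1 \<le> h i \<and> h i = 1 + (\<Sum>j\<in>UNIV. jump_prob D i 0 j * h j)"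
proof -
  \<comment> \<open>This solves h = 1 + P h for the matrix P of silent jumps, since
    \<open>- D 0\<close> is the diagonal matrix of exit rates times I - P.\<close>
  define w where "w = matrix_inv (- D 0) *v (\<chi> i. exit_rate i)"
  define h where "h i = w $ i" for i
  have "- D 0 *v w = (\<chi> i. exit_rate i)"
    unfolding w_def using mult_matrix_inv[OF invertible_uminus[OF D0_invertible]]
    by (simp add: matrix_vector_mul_assoc)
  hence eq: "(\<Sum>j\<in>UNIV. - D 0 $ i $ j * h j) = exit_rate i" for i
    by (simp add: matrix_vector_mult_def vec_eq_iff h_def)
  have h: "h i = 1 + (\<Sum>j\<in>UNIV. jump_prob D i 0 j * h j)" for i
  proof -
    have "(\<Sum>j\<in>UNIV. - D 0 $ i $ j * h j) = (\<Sum>j\<in>UNIV. exit_rate i * ((if j = i then h i else 0) - jump_prob D i 0 j * h j))"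
      by (intro sum.cong refl) (auto simp: D_eq algebra_simps)
    also have "\<dots> = exit_rate i * (h i - (\<Sum>j\<in>UNIV. jump_prob D i 0 j * h j))"
      by (simp add: sum_subtractf flip: sum_distrib_left)
    finally show ?thesis using eq[of i] exit_rate_pos[of i] by simp
  qed
  have row: "(\<Sum>j\<in>UNIV. jump_prob D i 0 j) \<le> 1" for i
    using sum_le_suminf[OF sums_summable[OF jump_prob_sums[of i]], of "{0}"] sums_unique[OF jump_prob_sums[of i]]
    by (auto simp: sum_nonneg jump_prob_nonneg)
  obtain i0 where i0: "\<And>i. h i0 \<le> h i"
    using ex_min_if_finite[of "range h"] by (auto simp: not_less)
  \<comment> \<open>Minimum principle: the rows of P sum to at most 1, so at a negative minimum P h
    is at least \<open>h i0\<close>, against h = 1 + P h.\<close>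
  have "0 \<le> h i0"
  proof (rule ccontr)
    assume neg: "\<not> 0 \<le> h i0"
    have "h i0 \<le> (\<Sum>j\<in>UNIV. jump_prob D i0 0 j) * h i0"
      using neg row[of i0] mult_right_mono_neg[of "\<Sum>j\<in>UNIV. jump_prob D i0 0 j" 1 "h i0"] by simp
    also have "\<dots> \<le> (\<Sum>j\<in>UNIV. jump_prob D i0 0 j * h j)"
      unfolding sum_distrib_right by (intro sum_mono mult_left_mono i0 jump_prob_nonneg)
    finally show False using h[of i0] by simp
  qed
  hence "0 \<le> h i" for i using i0 order_trans by blast
  hence "0 \<le> (\<Sum>j\<in>UNIV. jump_prob D i 0 j * h j)" for i
    by (intro sum_nonneg mult_nonneg_nonneg jump_prob_nonneg)
  thus ?thesis using h by (metis add.right_neutral add_left_mono)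
qed

text \<open>Induction on the level. From \<open>a\<close> on there is at most one visit. Below
  \<open>a\<close>, partial sums are weighted with \<open>h\<close>: a silent step lowers
  \<open>h\<close> by one in the mean, so the weighted recursion bounds the unweighted partial sums
  by the inflow.\<close>

lemma visit_prob_summable: "summable (\<lambda>k. visit_prob k l j)"
proof (induction l arbitrary: j rule: less_induct)
  case (less l)
  show ?case
  proof (cases "a \<le> l")
    case True thus ?thesis by (rule visit_prob_summable_ge)
  next
    case False
    obtain h where h: "\<And>i. 1 \<le> h i" "\<And>i. h i = 1 + (\<Sum>j\<in>UNIV. jump_prob D i 0 j * h j)"
      using ex_mean_silent_jumps by blast
    have h0: "0 \<le> h i" for i using h(1)[of i] by simp
    \<comment> \<open>The \<open>h\<close>-weighted inflow into level \<open>l\<close>: the initial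
      mass and the arrivals from lower levels, where \<open>visits\<close> is meaningful by
      induction.\<close>
    define C where "C = (\<Sum>j\<in>UNIV. (visit_prob 0 l j + (\<Sum>l'<l. \<Sum>i\<in>UNIV. visits l' i * jump_prob D i (l - l') j)) * h j)"
    have "(\<Sum>k<n. visit_prob k l j) \<le> C" for n
    proof -
      define S where "S l' i = (\<Sum>k<n. visit_prob k l' i)" for l' i
      have S0: "0 \<le> S l' i" for l' i unfolding S_def by (intro sum_nonneg visit_prob_nonneg)
      have SU: "S l' i \<le> visits l' i" if "l' < l" for l' i
        unfolding S_def visits_def by (rule sum_le_suminf[OF less[OF that]]) (auto simp: visit_prob_nonneg)
      have set: "{l'. l' < a \<and> l' \<le> l} = insert l {..<l}" using False by auto
      have rec: "(\<Sum>k<Suc n. visit_prob k l j) = visit_prob 0 l j + (\<Sum>l'<l. \<Sum>i\<in>UNIV. S l' i * jump_prob D i (l - l') j)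
          + (\<Sum>i\<in>UNIV. S l i * jump_prob D i 0 j)" for j
      proof -
        have "(\<Sum>k<n. \<Sum>l'<l. \<Sum>i\<in>UNIV. visit_prob k l' i * jump_prob D i (l - l') j) = (\<Sum>l'<l. \<Sum>i\<in>UNIV. S l' i * jump_prob D i (l - l') j)"
          unfolding S_def sum_distrib_right by (rule trans[OF sum.swap sum.cong[OF refl sum.swap]])
        moreover have "(\<Sum>k<n. \<Sum>i\<in>UNIV. visit_prob k l i * jump_prob D i 0 j) = (\<Sum>i\<in>UNIV. S l i * jump_prob D i 0 j)"
          unfolding S_def sum_distrib_right by (rule sum.swap)
        ultimately show ?thesis
          unfolding sum.lessThan_Suc_shift visit_prob_Suc set by (simp add: sum.distrib)
      qed
      have "(\<Sum>j\<in>UNIV. S l j * h j) \<le> (\<Sum>j\<in>UNIV. (\<Sum>k<Suc n. visit_prob k l j) * h j)"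
        unfolding S_def by (intro sum_mono mult_right_mono h0) (simp add: visit_prob_nonneg)
      also have "\<dots> = (\<Sum>j\<in>UNIV. (visit_prob 0 l j + (\<Sum>l'<l. \<Sum>i\<in>UNIV. S l' i * jump_prob D i (l - l') j)) * h j)
         + (\<Sum>j\<in>UNIV. (\<Sum>i\<in>UNIV. S l i * jump_prob D i 0 j) * h j)"
        unfolding rec by (simp add: distrib_right sum.distrib)
      also have "(\<Sum>j\<in>UNIV. (\<Sum>i\<in>UNIV. S l i * jump_prob D i 0 j) * h j) = (\<Sum>i\<in>UNIV. S l i * (h i - 1))"
      proof -
        have "(\<Sum>j\<in>UNIV. (\<Sum>i\<in>UNIV. S l i * jump_prob D i 0 j) * h j) = (\<Sum>i\<in>UNIV. S l i * (\<Sum>j\<in>UNIV. jump_prob D i 0 j * h j))"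
          unfolding sum_distrib_right sum_distrib_left by (subst sum.swap) (simp add: mult.assoc)
        moreover have "(\<Sum>j\<in>UNIV. jump_prob D i 0 j * h j) = h i - 1" for i using h(2)[of i] by simp
        ultimately show ?thesis by simp
      qed
      also have "(\<Sum>j\<in>UNIV. (visit_prob 0 l j + (\<Sum>l'<l. \<Sum>i\<in>UNIV. S l' i * jump_prob D i (l - l') j)) * h j) \<le> C"
        unfolding C_def by (intro sum_mono mult_right_mono add_left_mono h0 jump_prob_nonneg SU) auto
      finally have "(\<Sum>i\<in>UNIV. S l i) \<le> C" by (simp add: algebra_simps sum_subtractf)
      moreover have "S l j \<le> (\<Sum>i\<in>UNIV. S l i)" by (rule member_le_sum) (auto simp: S0)
      ultimately show ?thesis by (simp add: S_def)
    qed
    thus ?thesis by (rule summableI_nonneg_bounded[OF visit_prob_nonneg])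
  qed
qed

lemma visits_nonneg: "0 \<le> visits l j"
  unfolding visits_def by (intro suminf_nonneg visit_prob_summable visit_prob_nonneg)

lemma visits_renewal:
  "visits l j = visit_prob 0 l j + (\<Sum>l' | l' < a \<and> l' \<le> l. \<Sum>i\<in>UNIV. visits l' i * jump_prob D i (l - l') j)"
proof -
  have "(\<lambda>k. visit_prob (Suc k) l j) sums (\<Sum>l' | l' < a \<and> l' \<le> l. \<Sum>i\<in>UNIV. visits l' i * jump_prob D i (l - l') j)"
    unfolding visit_prob_Suc visits_def by (intro sums_sum sums_mult2 summable_sums visit_prob_summable)
  from sums_unique[OF this] show ?thesis
    unfolding visits_def[of l j] using suminf_split_head[OF visit_prob_summable, of l j] by simp
qed

text \<open>A path idle after \<open>k\<close> transitions is in one of finitely many states below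
  \<open>a\<close>, and the terms of the convergent series over \<open>k\<close> tend to 0.\<close>

lemma idle_ends_AE: "prob {\<omega> \<in> space M. \<forall>k. level k \<omega> < a} = 0"
proof -
  let ?N = "{\<omega> \<in> space M. \<forall>k. level k \<omega> < a}"
  have "prob ?N \<le> (\<Sum>l<a. \<Sum>j\<in>UNIV. visit_prob k l j)" for k
  proof -
    let ?E = "\<lambda>l j. start k l \<inter> {\<omega> \<in> space M. Y k \<omega> = j}"
    have "prob ?N \<le> prob (\<Union>l\<in>{..<a}. \<Union>j\<in>UNIV. ?E l j)"
      by (intro finite_measure_mono) (auto simp: start_def)
    also have "\<dots> \<le> (\<Sum>l<a. prob (\<Union>j\<in>UNIV. ?E l j))"
      by (intro finite_measure_subadditive_finite) auto
    also have "\<dots> \<le> (\<Sum>l<a. \<Sum>j\<in>UNIV. prob (?E l j))"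
      by (intro sum_mono finite_measure_subadditive_finite) auto
    finally show ?thesis by (simp add: visit_prob_def)
  qed
  moreover have "(\<lambda>k. \<Sum>l<a. \<Sum>j\<in>UNIV. visit_prob k l j) \<longlonglongrightarrow> (\<Sum>l<a. \<Sum>j\<in>(UNIV::'m set). 0)"
    by (intro tendsto_sum summable_LIMSEQ_zero visit_prob_summable)
  ultimately have "prob ?N \<le> 0"
    by (intro LIMSEQ_le_const[of _ 0]) auto
  thus ?thesis by (simp add: measure_le_0_iff)
qed

end

section \<open>The first departure\<close>

context stationary_bulk_queue
begin

definition hist :: "'w \<Rightarrow> nat \<times> nat \<times> (nat \<Rightarrow> real \<times> nat \<times> 'm)" where
  "hist \<omega> = (X0 \<omega>, R0 \<omega>, \<lambda>k. (H k \<omega>, B k \<omega>, Y k \<omega>))"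

text \<open>The sigma-algebra of the whole arrival process, in the form used by
  \<open>arrivals_indep_service\<close>. It contains every \<open>past n\<close>, so the
  independence of service times passes to all events built from transitions.\<close>

definition paths :: "'w measure" where
  "paths = vimage_algebra (space M) hist
    (count_space UNIV \<Otimes>\<^sub>M count_space UNIV \<Otimes>\<^sub>M (\<Pi>\<^sub>M k\<in>UNIV. borel \<Otimes>\<^sub>M count_space UNIV \<Otimes>\<^sub>M count_space UNIV))"

lemma space_G [simp]: "space paths = space M" by (simp add: paths_def)

lemma hist_G: "hist \<in> measurable paths
    (count_space UNIV \<Otimes>\<^sub>M count_space UNIV \<Otimes>\<^sub>M (\<Pi>\<^sub>M k\<in>UNIV. borel \<Otimes>\<^sub>M count_space UNIV \<Otimes>\<^sub>M count_space UNIV))"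
  unfolding paths_def by (rule measurable_vimage_algebra1) (auto simp: space_pair_measure space_PiM)

lemma X0_G: "X0 \<in> measurable paths (count_space UNIV)"
  using measurable_compose[OF hist_G measurable_fst] by (simp add: hist_def)

lemma R0_G: "R0 \<in> measurable paths (count_space UNIV)"
  using measurable_compose[OF measurable_compose[OF hist_G measurable_snd] measurable_fst] by (simp add: hist_def)

lemma path_G: "(\<lambda>\<omega>. (H k \<omega>, B k \<omega>, Y k \<omega>)) \<in> measurable paths (borel \<Otimes>\<^sub>M count_space UNIV \<Otimes>\<^sub>M count_space UNIV)"
  using measurable_compose[OF measurable_compose[OF measurable_compose[OF hist_G measurable_snd] measurable_snd]
      measurable_component_singleton[of k UNIV]] by (simp add: hist_def)

lemma H_G: "H k \<in> measurable paths borel"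
  using measurable_compose[OF path_G measurable_fst] by simp

lemma B_G: "B k \<in> measurable paths (count_space UNIV)"
  using measurable_compose[OF measurable_compose[OF path_G measurable_snd] measurable_fst] by simp

lemma Y_G: "Y k \<in> measurable paths (count_space UNIV)"
  using measurable_compose[OF measurable_compose[OF path_G measurable_snd] measurable_snd] by simp

lemma cyls_G: "cyls n \<subseteq> sets paths"
proof -
  have 1: "{\<omega> \<in> space paths. Z \<omega> = x} \<in> sets paths" if "Z \<in> measurable paths (count_space UNIV)" for Z :: "'w \<Rightarrow> 'b" and x
    using measurable_sets[OF that, of "{x}"] by (simp add: vimage_def Int_def conj_commute)
  have 2: "{\<omega> \<in> space paths. x < H k \<omega>} \<in> sets paths" for k x
    using H_G[of k] unfolding borel_measurable_iff_greater by blast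
  have "{\<omega> \<in> space paths. X0 \<omega> = x \<and> R0 \<omega> = r \<and> Y 0 \<omega> = y 0 \<and>
     (\<forall>k\<in>{..<n}. w k < H k \<omega> \<and> B k \<omega> = c k \<and> Y (Suc k) \<omega> = y (Suc k))} \<in> sets paths" for x r y c w
    by (intro sets.sets_Collect_conj sets.sets_Collect_finite_All 1 2 X0_G R0_G B_G Y_G) auto
  thus ?thesis by (auto simp: cyls_def cyl_def Ball_def)
qed

lemma sets_F_G: "sets (past n) \<subseteq> sets paths"
  unfolding sets_F using cyls_G[of n] sets.sigma_sets_subset[of "cyls n" paths] by simp

lemma measurable_F_G: "f \<in> measurable (past n) N \<Longrightarrow> f \<in> measurable paths N"
  using sets_F_G by (auto simp: measurable_def)

lemma G_M: "f \<in> measurable paths N \<Longrightarrow> f \<in> measurable M N"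
  and sets_G_M: "sets paths \<subseteq> sets M"
proof -
  have "hist \<in> measurable M (count_space UNIV \<Otimes>\<^sub>M count_space UNIV \<Otimes>\<^sub>M (\<Pi>\<^sub>M k\<in>UNIV. borel \<Otimes>\<^sub>M count_space UNIV \<Otimes>\<^sub>M count_space UNIV))"
    unfolding hist_def by (intro measurable_Pair measurable_abs_UNIV) measurable
  thus "sets paths \<subseteq> sets M"
    unfolding paths_def by (intro sets_image_in_sets) auto
  thus "f \<in> measurable paths N \<Longrightarrow> f \<in> measurable M N" by (auto simp: measurable_def)
qed

lemma V_measurable: "a \<le> r \<Longrightarrow> r \<le> b \<Longrightarrow> V k r \<in> borel_measurable M"
  using service_law[of r k] by (auto dest: distributed_measurable)

lemma indep_G_V:
  assumes r: "a \<le> r" "r \<le> b" and A: "A \<in> sets paths" and C: "C \<in> sets borel"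
  shows "prob (A \<inter> (V k r -` C \<inter> space M)) = prob A * prob (V k r -` C \<inter> space M)"
proof -
  let ?VV = "\<lambda>\<omega>. \<lambda>(k, r)\<in>UNIV \<times> {a..b}. V k r \<omega>"
  let ?G2 = "vimage_algebra (space M) ?VV (\<Pi>\<^sub>M p\<in>UNIV \<times> {a..b}. borel :: real measure)"
  have ind: "indep_set (sets paths) (sets ?G2)"
    using arrivals_indep_service by (simp add: paths_def hist_def[abs_def])
  have "?VV \<in> measurable ?G2 (\<Pi>\<^sub>M p\<in>UNIV \<times> {a..b}. borel)"
    by (rule measurable_vimage_algebra1) (auto simp: space_PiM)
  from measurable_compose[OF this measurable_component_singleton[of "(k, r)"]]
  have "V k r \<in> measurable ?G2 borel" using r by simp
  from measurable_sets[OF this C] have "V k r -` C \<inter> space M \<in> sets ?G2" by simp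
  with ind A show ?thesis by (rule indep_setD)
qed

text \<open>\<open>Z\<close> codes the event \<open>A\<close> and both bounds in one variable of the
  arrival process. It is independent of the service time, so the joint law is a product and the
  value of the service time can be integrated out last.\<close>

lemma emeasure_service_between:
  assumes r: "a \<le> r" "r \<le> b" and A: "A \<in> sets paths"
    and T: "T \<in> borel_measurable paths" "T' \<in> borel_measurable paths"
  shows "emeasure M (A \<inter> {\<omega> \<in> space M. T \<omega> \<le> V k r \<omega> \<and> V k r \<omega> < T' \<omega>})
    = (\<integral>\<^sup>+v. ennreal (s r v) * emeasure M (A \<inter> {\<omega> \<in> space M. T \<omega> \<le> v \<and> v < T' \<omega>}) \<partial>lborel)"
proof -
  have sf: "sigma_finite_measure M" ..
  note [measurable] = A T V_measurable[OF r]
  define Z where "Z \<omega> = (if \<omega> \<in> A then (T \<omega>, T' \<omega>) else (1, 0))" for \<omega>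
  \<comment> \<open>outside \<open>A\<close> the condition becomes \<open>1 \<le> v \<and> v < 0\<close>\<close>
  have Z: "Z \<in> measurable paths (borel \<Otimes>\<^sub>M borel)" unfolding Z_def by measurable
  have [measurable]: "Z \<in> measurable M (borel \<Otimes>\<^sub>M borel)" by (rule G_M[OF Z])
  define C :: "((real \<times> real) \<times> real) set" where "C = {p \<in> space ((borel \<Otimes>\<^sub>M borel) \<Otimes>\<^sub>M borel). fst (fst p) \<le> snd p \<and> snd p < snd (fst p)}"
  have C [measurable]: "C \<in> sets ((borel \<Otimes>\<^sub>M borel) \<Otimes>\<^sub>M borel)" unfolding C_def by measurable
  have AM: "A \<subseteq> space M" using sets.sets_into_space[OF A] by simp
  interpret dZ: prob_space "distr M (borel \<Otimes>\<^sub>M borel) Z" by (rule prob_space_distr) measurable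
  interpret dV: prob_space "distr M borel (V k r)" by (rule prob_space_distr) measurable
  interpret pair_sigma_finite "distr M (borel \<Otimes>\<^sub>M borel) Z" "distr M borel (V k r)" ..
  have "A \<inter> {\<omega> \<in> space M. T \<omega> \<le> V k r \<omega> \<and> V k r \<omega> < T' \<omega>} = (\<lambda>\<omega>. (Z \<omega>, V k r \<omega>)) -` C \<inter> space M"
    using AM by (auto simp: Z_def C_def space_pair_measure split: if_splits)
  hence "emeasure M (A \<inter> {\<omega> \<in> space M. T \<omega> \<le> V k r \<omega> \<and> V k r \<omega> < T' \<omega>})
    = emeasure (distr M ((borel \<Otimes>\<^sub>M borel) \<Otimes>\<^sub>M borel) (\<lambda>\<omega>. (Z \<omega>, V k r \<omega>))) C"
    by (simp add: emeasure_distr)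
  also have "distr M ((borel \<Otimes>\<^sub>M borel) \<Otimes>\<^sub>M borel) (\<lambda>\<omega>. (Z \<omega>, V k r \<omega>)) = distr M (borel \<Otimes>\<^sub>M borel) Z \<Otimes>\<^sub>M distr M borel (V k r)"
  proof (rule pair_measure_eqI[symmetric])
    fix S S' assume "S \<in> sets (distr M (borel \<Otimes>\<^sub>M borel) Z)" "S' \<in> sets (distr M borel (V k r))"
    hence S [measurable]: "S \<in> sets (borel \<Otimes>\<^sub>M borel)" "S' \<in> sets borel" by auto
    have "(\<lambda>\<omega>. (Z \<omega>, V k r \<omega>)) -` (S \<times> S') \<inter> space M = (Z -` S \<inter> space M) \<inter> (V k r -` S' \<inter> space M)" by auto
    moreover have "Z -` S \<inter> space M \<in> sets paths" using measurable_sets[OF Z S(1)] by simp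
    ultimately show "emeasure (distr M (borel \<Otimes>\<^sub>M borel) Z) S * emeasure (distr M borel (V k r)) S'
      = emeasure (distr M ((borel \<Otimes>\<^sub>M borel) \<Otimes>\<^sub>M borel) (\<lambda>\<omega>. (Z \<omega>, V k r \<omega>))) (S \<times> S')"
      using indep_G_V[OF r _ S(2), of "Z -` S \<inter> space M" k]
      by (simp add: emeasure_distr emeasure_eq_measure flip: ennreal_mult)
  qed (unfold_locales, unfold_locales, simp cong: sets_pair_measure_cong)
  also have "emeasure \<dots> C = (\<integral>\<^sup>+v. emeasure (distr M (borel \<Otimes>\<^sub>M borel) Z) ((\<lambda>x. (x, v)) -` C) \<partial>distr M borel (V k r))"
    by (rule emeasure_pair_measure_alt2) simp
  also have "\<dots> = (\<integral>\<^sup>+v. emeasure M (A \<inter> {\<omega> \<in> space M. T \<omega> \<le> v \<and> v < T' \<omega>}) \<partial>distr M borel (V k r))"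
  proof (intro nn_integral_cong)
    fix v
    have "Z -` ((\<lambda>x. (x, v)) -` C) \<inter> space M = A \<inter> {\<omega> \<in> space M. T \<omega> \<le> v \<and> v < T' \<omega>}"
      using AM by (auto simp: Z_def C_def space_pair_measure split: if_splits)
    moreover have "(\<lambda>x. (x, v)) -` C \<in> sets (borel \<Otimes>\<^sub>M borel)"
      using sets_Pair2[OF C] .
    ultimately show "emeasure (distr M (borel \<Otimes>\<^sub>M borel) Z) ((\<lambda>x. (x, v)) -` C) = emeasure M (A \<inter> {\<omega> \<in> space M. T \<omega> \<le> v \<and> v < T' \<omega>})"
      by (simp add: emeasure_distr)
  qed
  also have "distr M borel (V k r) = density lborel (\<lambda>t. ennreal (s r t))"
    using distributed_distr_eq_density[OF service_law[OF r, of k]] by (simp cong: distr_cong)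
  also have "(\<integral>\<^sup>+v. emeasure M (A \<inter> {\<omega> \<in> space M. T \<omega> \<le> v \<and> v < T' \<omega>}) \<partial>density lborel (\<lambda>t. ennreal (s r t)))
     = (\<integral>\<^sup>+v. ennreal (s r v) * emeasure M (A \<inter> {\<omega> \<in> space M. T \<omega> \<le> v \<and> v < T' \<omega>}) \<partial>lborel)"
  proof (rule nn_integral_density)
    show "(\<lambda>t. ennreal (s r t)) \<in> borel_measurable lborel"
      using service_law[OF r] by (rule distributed_borel_measurable)
    have [measurable]: "A \<in> sets M" "T \<in> borel_measurable M" "T' \<in> borel_measurable M"
      using sets_G_M A G_M[OF assms(4)] G_M[OF assms(5)] by auto
    have "{p \<in> space (lborel \<Otimes>\<^sub>M M). snd p \<in> A \<and> T (snd p) \<le> fst p \<and> fst p < T' (snd p)} \<in> sets (lborel \<Otimes>\<^sub>M M)" (is "?Q \<in> _")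
      by measurable
    from sigma_finite_measure.measurable_emeasure_Pair[OF sf this]
    have "(\<lambda>v. emeasure M (Pair v -` ?Q)) \<in> borel_measurable lborel" .
    moreover have "Pair v -` ?Q = A \<inter> {\<omega> \<in> space M. T \<omega> \<le> v \<and> v < T' \<omega>}" for v
      using AM by (auto simp: space_pair_measure)
    ultimately show "(\<lambda>v. emeasure M (A \<inter> {\<omega> \<in> space M. T \<omega> \<le> v \<and> v < T' \<omega>})) \<in> borel_measurable lborel"
      by simp
  qed
  finally show ?thesis .
qed

section \<open>Transitions counted along a path\<close>

definition jump_count :: "'w \<Rightarrow> real \<Rightarrow> nat" where
  "jump_count \<omega> t = card {k. jump_epoch (\<lambda>l. H l \<omega>) (Suc k) \<le> t}"

lemma jump_epoch_eq: "jump_epoch (\<lambda>l. H l \<omega>) k = elapsed 0 k \<omega>"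
  by (simp add: jump_epoch_def elapsed_def)

lemma elapsed_add: "elapsed 0 (k + q) \<omega> = elapsed 0 k \<omega> + elapsed k q \<omega>"
  by (induction q) (auto simp: elapsed_Suc)

text \<open>Non-explosion keeps the set finite; on an infinite set \<open>card\<close> would return
  0. It is an initial segment because the epochs increase.\<close>

lemma jump_count_set:
  assumes "\<omega> \<in> space M"
  shows "{k. elapsed 0 (Suc k) \<omega> \<le> t} = {..<jump_count \<omega> t}"
proof -
  have "eventually (\<lambda>n. t < elapsed 0 n \<omega>) sequentially"
    using no_explosion[OF assms] unfolding filterlim_at_top_dense jump_epoch_eq by blast
  then obtain N where "\<And>n. N \<le> n \<Longrightarrow> t < elapsed 0 n \<omega>" by (auto simp: eventually_sequentially)
  hence ex: "t < elapsed 0 (Suc N) \<omega>" by simp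
  define q where "q = (LEAST q. t < elapsed 0 (Suc q) \<omega>)"
  have q: "t < elapsed 0 (Suc q) \<omega>" unfolding q_def using ex by (rule LeastI)
  have "elapsed 0 (Suc k) \<omega> \<le> t" if "k < q" for k
    using not_less_Least[of k "\<lambda>q. t < elapsed 0 (Suc q) \<omega>"] that by (simp add: q_def)
  moreover have "t < elapsed 0 (Suc k) \<omega>" if "q \<le> k" for k
    using q elapsed_mono[OF assms, of "Suc q" "Suc k" 0] that by simp
  ultimately have "{k. elapsed 0 (Suc k) \<omega> \<le> t} = {..<q}"
    by (auto simp: not_less[symmetric])
  thus ?thesis by (simp add: jump_count_def jump_epoch_eq)
qed

lemma Suc_le_jump_count_iff:
  assumes "\<omega> \<in> space M"
  shows "Suc k \<le> jump_count \<omega> t \<longleftrightarrow> elapsed 0 (Suc k) \<omega> \<le> t"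
  using jump_count_set[OF assms, of t] by (auto simp: set_eq_iff less_eq_Suc_le)

lemma le_jump_count_iff:
  assumes "\<omega> \<in> space M" "0 \<le> t"
  shows "k \<le> jump_count \<omega> t \<longleftrightarrow> elapsed 0 k \<omega> \<le> t"
  using Suc_le_jump_count_iff[OF assms(1)] assms(2) by (cases k) auto

lemma jump_count_eq_iff:
  assumes "\<omega> \<in> space M" "0 \<le> t"
  shows "jump_count \<omega> t = k \<longleftrightarrow> elapsed 0 k \<omega> \<le> t \<and> t < elapsed 0 (Suc k) \<omega>"
  using le_jump_count_iff[OF assms, of k] le_jump_count_iff[OF assms, of "Suc k"] by auto

lemma jump_count_elapsed: "\<omega> \<in> space M \<Longrightarrow> jump_count \<omega> (elapsed 0 k \<omega>) = k"
  by (subst jump_count_eq_iff) (auto simp: elapsed_nonneg elapsed_Suc H_pos)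

lemma jump_count_0: "\<omega> \<in> space M \<Longrightarrow> jump_count \<omega> 0 = 0"
  using jump_count_elapsed[of \<omega> 0] by simp

lemma arrivals_eq:
  assumes "\<omega> \<in> space M"
  shows "arrivals (\<lambda>l. H l \<omega>) (\<lambda>l. B l \<omega>) t = level (jump_count \<omega> t) \<omega> - X0 \<omega>"
  using jump_count_set[OF assms] by (simp add: arrivals_def jump_epoch_eq level_def)

lemma X0_le_level: "X0 \<omega> \<le> level k \<omega>" by (simp add: level_def)

lemma jump_count_measurable [measurable]:
  assumes [measurable]: "T \<in> borel_measurable M"
  shows "(\<lambda>\<omega>. jump_count \<omega> (T \<omega>)) \<in> measurable M (count_space UNIV)"
  unfolding measurable_count_space_eq2_countable
proof (intro conjI ballI)
  fix q :: nat
  \<comment> \<open>\<open>T\<close> may be negative, and the count is then 0; hence there is no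
    lower bound on \<open>T\<close> for \<open>q = 0\<close>.\<close>
  have "jump_count \<omega> (T \<omega>) = q \<longleftrightarrow> (q = 0 \<or> elapsed 0 q \<omega> \<le> T \<omega>) \<and> T \<omega> < elapsed 0 (Suc q) \<omega>" if "\<omega> \<in> space M" for \<omega>
    using Suc_le_jump_count_iff[OF that, of "q - 1" "T \<omega>"] Suc_le_jump_count_iff[OF that, of q "T \<omega>"] by (cases q) auto
  hence "(\<lambda>\<omega>. jump_count \<omega> (T \<omega>)) -` {q} \<inter> space M = {\<omega> \<in> space M. (q = 0 \<or> elapsed 0 q \<omega> \<le> T \<omega>) \<and> T \<omega> < elapsed 0 (Suc q) \<omega>}"
    by auto
  also have "\<dots> \<in> sets M" by measurable
  finally show "(\<lambda>\<omega>. jump_count \<omega> (T \<omega>)) -` {q} \<inter> space M \<in> sets M" .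
qed auto

text \<open>The outcome of the first departure as a function of the epoch \<open>u\<close> at which
  service starts. With \<open>u\<close> as a parameter, measurability can be shown for one candidate
  epoch at a time.\<close>

definition leaves :: "nat \<Rightarrow> nat \<Rightarrow> 'm \<Rightarrow> real \<Rightarrow> 'w \<Rightarrow> bool" where
  "leaves n r i u \<omega> \<longleftrightarrow> min (level (jump_count \<omega> u) \<omega>) b = r \<and>
     (level (jump_count \<omega> u) \<omega> - r) + (level (jump_count \<omega> (u + V 0 r \<omega>)) \<omega> - level (jump_count \<omega> u) \<omega>) = n \<and> Y (jump_count \<omega> (u + V 0 r \<omega>)) \<omega> = i"

lemma leaves_measurable:
  assumes r: "a \<le> r" "r \<le> b" and T: "T \<in> borel_measurable M"
  shows "{\<omega> \<in> space M. leaves n r i (T \<omega>) \<omega>} \<in> sets M"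
proof -
  have T': "(\<lambda>\<omega>. T \<omega> + V 0 r \<omega>) \<in> borel_measurable M"
    by (intro borel_measurable_add T V_measurable r)
  have [measurable]: "(\<lambda>\<omega>. level (jump_count \<omega> (T \<omega>)) \<omega>) \<in> measurable M (count_space UNIV)"
    by (rule measurable_compose_countable[OF level_measurable jump_count_measurable[OF T]])
  have [measurable]: "(\<lambda>\<omega>. level (jump_count \<omega> (T \<omega> + V 0 r \<omega>)) \<omega>) \<in> measurable M (count_space UNIV)"
    by (rule measurable_compose_countable[OF level_measurable jump_count_measurable[OF T']])
  have [measurable]: "(\<lambda>\<omega>. Y (jump_count \<omega> (T \<omega> + V 0 r \<omega>)) \<omega>) \<in> measurable M (count_space UNIV)"
    by (rule measurable_compose_countable[OF Y_measurable jump_count_measurable[OF T']])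
  show ?thesis unfolding leaves_def by measurable
qed

definition first_start :: "'w \<Rightarrow> real" where
  "first_start \<omega> = service_start a (arrivals (\<lambda>l. H l \<omega>) (\<lambda>l. B l \<omega>)) 0 (X0 \<omega>)"

lemma first_departure_iff:
  assumes "\<omega> \<in> space M"
  shows "(case departure a b (arrivals (\<lambda>l. H l \<omega>) (\<lambda>l. B l \<omega>)) (\<lambda>l q. V l q \<omega>) (X0 \<omega>) (R0 \<omega>) (Suc 0)
         of (t, x, q) \<Rightarrow> x = n \<and> q = r \<and> phase_at (\<lambda>l. H l \<omega>) (\<lambda>l. Y l \<omega>) t = i)
     \<longleftrightarrow> leaves n r i (first_start \<omega>) \<omega>"
proof -
  have 0: "level 0 \<omega> = X0 \<omega>" by (simp add: level_def)
  have 1: "X0 \<omega> + (level k \<omega> - X0 \<omega>) = level k \<omega>" for k using X0_le_level[of \<omega> k] by simp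
  have 2: "level k \<omega> - X0 \<omega> - (level k' \<omega> - X0 \<omega>) = level k \<omega> - level k' \<omega>" for k k'
    using X0_le_level[of \<omega> k] X0_le_level[of \<omega> k'] by simp
  show ?thesis
    by (auto simp: Let_def arrivals_eq[OF assms] jump_count_0[OF assms] 0 1 2 leaves_def first_start_def[symmetric]
        phase_at_def jump_count_def[symmetric])
qed

lemma first_start_set:
  assumes "\<omega> \<in> space M"
  shows "first_start \<omega> = Inf {u. 0 \<le> u \<and> a \<le> level (jump_count \<omega> u) \<omega>}"
proof -
  have "X0 \<omega> + (level (jump_count \<omega> u) \<omega> - X0 \<omega>) = level (jump_count \<omega> u) \<omega>" for u using X0_le_level[of \<omega> "jump_count \<omega> u"] by simp
  thus ?thesis
    by (simp add: first_start_def service_start_def arrivals_eq[OF assms] jump_count_0[OF assms] level_def[of 0])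
qed

text \<open>Levels never decrease, so the set under \<open>Inf\<close> is the half-line that begins
  at the \<open>k\<close>-th transition.\<close>

lemma first_start_eq:
  assumes \<omega>: "\<omega> \<in> start k l" and l: "a \<le> l"
  shows "first_start \<omega> = elapsed 0 k \<omega>"
proof -
  have M: "\<omega> \<in> space M" using \<omega> by (simp add: start_def)
  have "a \<le> level q \<omega> \<longleftrightarrow> k \<le> q" for q
    using \<omega> l level_mono[of k q \<omega>] by (auto simp: start_def not_le[symmetric])
  hence "{u. 0 \<le> u \<and> a \<le> level (jump_count \<omega> u) \<omega>} = {elapsed 0 k \<omega>..}"
    using le_jump_count_iff[OF M] elapsed_nonneg[OF M, of 0 k] order_trans by auto
  thus ?thesis by (simp add: first_start_set[OF M])
qed

lemma start_cases:
  assumes "\<omega> \<in> space M"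
  shows "(\<forall>k. level k \<omega> < a) \<or> (\<exists>k. \<omega> \<in> start k (level k \<omega>) \<and> a \<le> level k \<omega>)"
proof (cases "\<forall>k. level k \<omega> < a")
  case False
  hence ex: "\<exists>k. a \<le> level k \<omega>" by (auto simp: not_less)
  have "a \<le> level (LEAST k. a \<le> level k \<omega>) \<omega>" using ex by (rule LeastI_ex)
  moreover have "level i \<omega> < a" if "i < (LEAST k. a \<le> level k \<omega>)" for i
    using not_less_Least[OF that] by simp
  ultimately show ?thesis using assms by (auto simp: start_def)
qed auto

abbreviation service_dist :: "nat \<Rightarrow> real measure" where
  "service_dist r \<equiv> density lborel (\<lambda>t. ennreal (s r t))"

lemma s_measurable: "a \<le> r \<Longrightarrow> r \<le> b \<Longrightarrow> (\<lambda>t. ennreal (s r t)) \<in> borel_measurable lborel"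
  using service_law by (rule distributed_borel_measurable)

lemma
  assumes r: "a \<le> r" "r \<le> b"
  shows service_dist_prob_space: "prob_space (service_dist r)"
    and service_dist_nonneg: "AE t in service_dist r. 0 \<le> t"
    and V_nonneg: "AE \<omega> in M. 0 \<le> V k r \<omega>"
proof -
  have eq: "distr M lborel (V k r) = service_dist r" for k
    by (rule distributed_distr_eq_density[OF service_law[OF r]])
  have [measurable]: "V k r \<in> measurable M lborel" for k
    using V_measurable[OF r] by simp
  have "prob_space (distr M lborel (V 0 r))" by (rule prob_space_distr) measurable
  thus "prob_space (service_dist r)" by (simp add: eq)
  show 1: "AE t in service_dist r. 0 \<le> t"
    using s_measurable[OF r] s_neg_arg[OF r] by (subst AE_density) (auto simp: not_less[symmetric])
  have "AE t in distr M lborel (V k r). 0 \<le> t" unfolding eq by (rule 1)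
  thus "AE \<omega> in M. 0 \<le> V k r \<omega>" by (subst (asm) AE_distr_iff) (auto intro: V_measurable[OF r])
qed

lemma idle_ends: "AE \<omega> in M. \<exists>k. a \<le> level k \<omega>"
proof -
  have "{\<omega> \<in> space M. \<forall>k. level k \<omega> < a} \<in> null_sets M"
    using idle_ends_AE by (intro null_setsI) (auto simp: emeasure_eq_measure)
  thus ?thesis by (rule AE_I') (auto simp: not_le)
qed

lemma start_unique:
  assumes "\<omega> \<in> start k l" "\<omega> \<in> start k' l'" "a \<le> l" "a \<le> l'"
  shows "k = k'" "l = l'"
proof -
  show "k = k'" using assms by (cases k k' rule: linorder_cases) (auto simp: start_def)
  thus "l = l'" using assms by (auto simp: start_def)
qed

text \<open>By the departure \<open>k + q\<close> transitions have taken place. The condition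
  \<open>l \<le> n + r\<close> says that the \<open>l - r\<close> customers left over are among the
  \<open>n\<close>; it guards the truncated subtraction \<open>n - (l - r)\<close>.\<close>

lemma leaves_start:
  assumes \<omega>: "\<omega> \<in> start k l" and l: "a \<le> l" and q: "elapsed k q \<omega> \<le> V 0 r \<omega>" "V 0 r \<omega> < elapsed k (Suc q) \<omega>"
  shows "leaves n r i (first_start \<omega>) \<omega> \<longleftrightarrow> min l b = r \<and> l \<le> n + r \<and> level (k + q) \<omega> = l + (n - (l - r)) \<and> Y (k + q) \<omega> = i"
proof -
  have M: "\<omega> \<in> space M" and levk: "level k \<omega> = l" using \<omega> by (auto simp: start_def)
  have "jump_count \<omega> (first_start \<omega> + V 0 r \<omega>) = k + q"
    unfolding first_start_eq[OF \<omega> l] using q elapsed_add[of k q \<omega>] elapsed_add[of k "Suc q" \<omega>] elapsed_nonneg[OF M]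
    by (subst jump_count_eq_iff[OF M]) (auto intro!: add_nonneg_nonneg intro: order_trans)
  moreover have "jump_count \<omega> (first_start \<omega>) = k"
    unfolding first_start_eq[OF \<omega> l] by (rule jump_count_elapsed[OF M])
  ultimately show ?thesis
    using levk level_mono[of k "k + q" \<omega>] unfolding leaves_def by auto
qed

text \<open>
  If the queue never reaches \<open>a\<close>, the first service starts at the unspecified number \<open>Inf {}\<close>; this
  null event still has to be shown measurable.
\<close>

lemma leaves_sets:
  assumes r: "a \<le> r" "r \<le> b"
  shows "{\<omega> \<in> space M. leaves n r i (first_start \<omega>) \<omega>} \<in> sets M"
proof -
  let ?S = "\<lambda>k. (\<Union>l\<in>{a..}. start k l) \<inter> {\<omega> \<in> space M. leaves n r i (elapsed 0 k \<omega>) \<omega>}"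
  let ?N = "{\<omega> \<in> space M. \<forall>k. level k \<omega> < a} \<inter> {\<omega> \<in> space M. leaves n r i (Inf {}) \<omega>}"
  have "{\<omega> \<in> space M. leaves n r i (first_start \<omega>) \<omega>} = (\<Union>k. ?S k) \<union> ?N"
  proof (intro set_eqI iffI)
    fix \<omega> assume "\<omega> \<in> {\<omega> \<in> space M. leaves n r i (first_start \<omega>) \<omega>}"
    hence \<omega>: "\<omega> \<in> space M" "leaves n r i (first_start \<omega>) \<omega>" by auto
    from start_cases[OF \<omega>(1)] show "\<omega> \<in> (\<Union>k. ?S k) \<union> ?N"
    proof
      assume "\<forall>k. level k \<omega> < a"
      hence "{u. 0 \<le> u \<and> a \<le> level (jump_count \<omega> u) \<omega>} = {}" by (auto simp: not_le)
      hence "first_start \<omega> = Inf {}" by (simp only: first_start_set[OF \<omega>(1)])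
      thus ?thesis using \<omega> \<open>\<forall>k. level k \<omega> < a\<close> by auto
    next
      assume "\<exists>k. \<omega> \<in> start k (level k \<omega>) \<and> a \<le> level k \<omega>"
      thus ?thesis using \<omega> first_start_eq by fastforce
    qed
  next
    fix \<omega> assume "\<omega> \<in> (\<Union>k. ?S k) \<union> ?N"
    thus "\<omega> \<in> {\<omega> \<in> space M. leaves n r i (first_start \<omega>) \<omega>}"
    proof
      assume "\<omega> \<in> (\<Union>k. ?S k)"
      thus ?thesis using first_start_eq by fastforce
    next
      assume N: "\<omega> \<in> ?N"
      hence "{u. 0 \<le> u \<and> a \<le> level (jump_count \<omega> u) \<omega>} = {}" by (auto simp: not_le)
      hence "first_start \<omega> = Inf {}" using N by (simp only: first_start_set Int_iff mem_Collect_eq)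
      thus ?thesis using N by auto
    qed
  qed
  moreover have "?S k \<in> sets M" for k
    by (intro sets.Int leaves_measurable r elapsed_measurable sets.countable_UN') auto
  moreover have "?N \<in> sets M"
    by (intro sets.Int leaves_measurable r borel_measurable_const) measurable
  ultimately show ?thesis by auto
qed

text \<open>Stationarity read at departure 1. Together with \<open>piplus_eq_init\<close>, which
  reads it at departure 0, it turns one cycle into an equation for \<open>piplus\<close>.\<close>

lemma piplus_eq_prob: "piplus n r $ i = prob {\<omega> \<in> space M. leaves n r i (first_start \<omega>) \<omega>}"
  unfolding steady_state[of n r i "Suc 0"] by (intro arg_cong[where f=prob] Collect_cong conj_cong refl first_departure_iff)

lemma piplus_eq_init: "piplus n r $ i = prob {\<omega> \<in> space M. X0 \<omega> = n \<and> R0 \<omega> = r \<and> Y 0 \<omega> = i}"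
  unfolding steady_state[of n r i 0]
  by (intro arg_cong[where f=prob] Collect_cong conj_cong refl) (auto simp: phase_at_def jump_count_def[symmetric] jump_count_0)

text \<open>
  For \<open>r\<close> outside \<open>{a..b}\<close> nothing is assumed about \<open>V 0 r\<close>, so the event need not be measurable,
  but then its \<open>prob\<close> is \<open>0\<close> by convention.
\<close>

lemma piplus_eq_0:
  assumes "\<not> (a \<le> r \<and> r \<le> b)"
  shows "piplus n r $ i = 0"
proof (cases "{\<omega> \<in> space M. leaves n r i (first_start \<omega>) \<omega>} \<in> sets M")
  case True
  \<comment> \<open>A first service that does start takes \<open>min l b\<close> customers, between
    \<open>a\<close> and \<open>b\<close>; the event is therefore confined to paths that stay idle
    forever.\<close>
  have "{\<omega> \<in> space M. leaves n r i (first_start \<omega>) \<omega>} \<subseteq> {\<omega> \<in> space M. \<forall>k. level k \<omega> < a}"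
  proof safe
    fix \<omega> k assume \<omega>: "\<omega> \<in> space M" "leaves n r i (first_start \<omega>) \<omega>"
    show "level k \<omega> < a"
      using start_cases[OF \<omega>(1)]
    proof
      assume "\<exists>k. \<omega> \<in> start k (level k \<omega>) \<and> a \<le> level k \<omega>"
      then obtain k where k: "\<omega> \<in> start k (level k \<omega>)" "a \<le> level k \<omega>" by blast
      have "min (level k \<omega>) b = r"
        using \<omega>(2) jump_count_elapsed[OF \<omega>(1), of k] unfolding leaves_def first_start_eq[OF k] by simp
      thus ?thesis using assms k(2) a_le_b by auto
    qed auto
  qed
  hence "prob {\<omega> \<in> space M. leaves n r i (first_start \<omega>) \<omega>} \<le> prob {\<omega> \<in> space M. \<forall>k. level k \<omega> < a}"
    by (rule finite_measure_mono) measurable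
  thus ?thesis by (simp add: piplus_eq_prob idle_ends_AE measure_le_0_iff)
next
  case False
  thus ?thesis by (simp add: piplus_eq_prob measure_notin_sets)
qed

text \<open>By \<open>piplus_eq_0\<close> the sum over \<open>{a..b}\<close> is the sum over all
  batch sizes, so the size of the departing batch is summed out of the initial law.\<close>

lemma psiplus_eq: "psiplus a b piplus n $ i = visit_prob 0 n i"
proof -
  let ?E = "\<lambda>r. {\<omega> \<in> space M. X0 \<omega> = n \<and> R0 \<omega> = r \<and> Y 0 \<omega> = i}"
  have "start 0 n \<inter> {\<omega> \<in> space M. Y 0 \<omega> = i} = (\<Union>r. ?E r)"
    by (auto simp: start_def level_def)
  moreover have "(\<lambda>r. prob (?E r)) sums prob (\<Union>r. ?E r)"
    by (intro finite_measure_UNION) (auto simp: disjoint_family_on_def)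
  moreover have "(\<lambda>r. prob (?E r)) sums (\<Sum>r=a..b. prob (?E r))"
    using piplus_eq_0 by (intro sums_finite) (auto simp: piplus_eq_init)
  ultimately show ?thesis
    by (simp add: visit_prob_def psiplus_def sum_component piplus_eq_init sums_unique2)
qed

text \<open>The event is cut by the level \<open>l\<close> at the start of service, the transition
  \<open>k\<close> at which it starts and the number \<open>q\<close> of transitions during it.
  Conditioning on the service time turns the sum over \<open>k\<close> and \<open>q\<close> into
  \<open>after_start_enn\<close>, whose closed form integrates to \<open>count_mix\<close>.\<close>

lemma piplus_eq:
  assumes r: "a \<le> r" "r \<le> b"
  shows "piplus n r $ i = (\<Sum>l | a \<le> l \<and> min l b = r \<and> l \<le> n + r. \<Sum>j\<in>UNIV. visits l j * count_mix (service_dist r) (n - (l - r)) $ j $ i)"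
proof -
  let ?L = "{l. a \<le> l \<and> min l b = r \<and> l \<le> n + r}"
  let ?d = "\<lambda>l. n - (l - r)"
  let ?K = "\<lambda>l k q. busy k l q (?d l) i \<inter> {\<omega> \<in> space M. elapsed k q \<omega> \<le> V 0 r \<omega> \<and> V 0 r \<omega> < elapsed k (Suc q) \<omega>}"
  let ?E = "{\<omega> \<in> space M. leaves n r i (first_start \<omega>) \<omega>}"
  have [measurable]: "V 0 r \<in> borel_measurable M" by (rule V_measurable[OF r])
  have K [measurable]: "?K l k q \<in> sets M" for l k q by measurable
  have fin: "finite ?L" by (rule finite_subset[of _ "{..n + r}"]) auto
  have ex: "\<exists>q. elapsed k q \<omega> \<le> V 0 r \<omega> \<and> V 0 r \<omega> < elapsed k (Suc q) \<omega>" if "\<omega> \<in> space M" "0 \<le> V 0 r \<omega>" for \<omega> k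
  proof -
    have "0 \<le> elapsed 0 k \<omega> + V 0 r \<omega>" using elapsed_nonneg[OF that(1), of 0 k] that(2) by simp
    moreover have "k \<le> jump_count \<omega> (elapsed 0 k \<omega> + V 0 r \<omega>)" using le_jump_count_iff[OF that(1) calculation, of k] that(2) by simp
    then obtain q where "jump_count \<omega> (elapsed 0 k \<omega> + V 0 r \<omega>) = k + q" by (auto simp: le_iff_add)
    ultimately have "elapsed 0 (k + q) \<omega> \<le> elapsed 0 k \<omega> + V 0 r \<omega> \<and> elapsed 0 k \<omega> + V 0 r \<omega> < elapsed 0 (k + Suc q) \<omega>"
      using jump_count_eq_iff[OF that(1)] by simp
    thus ?thesis unfolding elapsed_add by auto
  qed
  have sub: "?K l k q \<subseteq> ?E" if "l \<in> ?L" for l k q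
    using that leaves_start[of _ k l q r n i] by (auto simp: busy_def start_def)
  \<comment> \<open>Equality holds up to two null events: a negative service time and an idle period
    without end.\<close>
  have "emeasure M ?E = emeasure M (\<Union>l\<in>?L. \<Union>k. \<Union>q. ?K l k q)"
  proof (rule emeasure_eq_AE)
    show "AE \<omega> in M. \<omega> \<in> ?E \<longleftrightarrow> \<omega> \<in> (\<Union>l\<in>?L. \<Union>k. \<Union>q. ?K l k q)"
      using V_nonneg[OF r, of 0] idle_ends AE_space
    proof eventually_elim
      case (elim \<omega>)
      then obtain k where k: "\<omega> \<in> start k (level k \<omega>)" "a \<le> level k \<omega>"
        using start_cases[of \<omega>] by (auto simp: not_le[symmetric])
      obtain q where q: "elapsed k q \<omega> \<le> V 0 r \<omega>" "V 0 r \<omega> < elapsed k (Suc q) \<omega>"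
        using ex[of \<omega> k] elim by auto
      have "\<omega> \<in> ?E \<Longrightarrow> \<omega> \<in> ?K (level k \<omega>) k q \<and> level k \<omega> \<in> ?L"
        using leaves_start[OF k q] k q by (auto simp: busy_def)
      moreover have "\<omega> \<in> (\<Union>l\<in>?L. \<Union>k. \<Union>q. ?K l k q) \<Longrightarrow> \<omega> \<in> ?E" using sub by blast
      ultimately show ?case by blast
    qed
    show "?E \<in> sets M" by (rule leaves_sets[OF r])
    show "(\<Union>l\<in>?L. \<Union>k. \<Union>q. ?K l k q) \<in> sets M" using fin by measurable
  qed
  also have "\<dots> = (\<Sum>l\<in>?L. emeasure M (\<Union>k. \<Union>q. ?K l k q))"
  proof (rule sum_emeasure[symmetric])
    show "disjoint_family_on (\<lambda>l. \<Union>k. \<Union>q. ?K l k q) ?L"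
      using start_unique by (auto simp: disjoint_family_on_def busy_def)
    show "(\<lambda>l. \<Union>k. \<Union>q. ?K l k q) ` ?L \<subseteq> sets M"
      by (intro image_subsetI sets.countable_UN'' K countableI_type)
  qed (rule fin)
  also have "\<dots> = (\<Sum>l\<in>?L. \<Sum>k. emeasure M (\<Union>q. ?K l k q))"
  proof (intro sum.cong refl suminf_emeasure[symmetric])
    fix l assume l: "l \<in> ?L"
    show "disjoint_family (\<lambda>k. \<Union>q. ?K l k q)"
      using start_unique l by (auto simp: disjoint_family_on_def busy_def)
  qed (intro image_subsetI sets.countable_UN'' K countableI_type)
  also have "\<dots> = (\<Sum>l\<in>?L. \<Sum>k. \<Sum>q. emeasure M (?K l k q))"
  proof (intro sum.cong refl suminf_cong suminf_emeasure[symmetric])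
    fix l k
    have "?K l k q \<inter> ?K l k q' = {}" if "q < q'" for q q'
      using elapsed_mono[of _ "Suc q" q' k] that by fastforce
    hence "?K l k q \<inter> ?K l k q' = {}" if "q \<noteq> q'" for q q'
      using that by (cases q q' rule: linorder_cases) blast+
    thus "disjoint_family (?K l k)" by (simp add: disjoint_family_on_def)
  qed (intro image_subsetI K)
  also have "\<dots> = (\<Sum>l\<in>?L. ennreal (\<Sum>j\<in>UNIV. visits l j * count_mix (service_dist r) (?d l) $ j $ i))"
  proof (intro sum.cong refl)
    fix l assume "l \<in> ?L"
    hence l: "a \<le> l" by simp
    note [measurable] = s_measurable[OF r]
    interpret N: prob_space "service_dist r" by (rule service_dist_prob_space[OF r])
    have int: "integrable (service_dist r) (\<lambda>v. count_prob d v $ j $ i)" for d j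
      by (rule count_prob_integrable[OF service_dist_prob_space[OF r] _ service_dist_nonneg[OF r]]) simp
    have "emeasure M (?K l k q) = (\<integral>\<^sup>+v. ennreal (s r v) * busy_prob k l q (?d l) i v \<partial>lborel)" for k q
      unfolding busy_prob_def using busy_F[of k l q "?d l" i] sets_F_G
      by (intro emeasure_service_between r measurable_F_G[OF elapsed_F]) blast
    hence "(\<Sum>k. \<Sum>q. emeasure M (?K l k q)) = (\<Sum>k. \<Sum>q. (\<integral>\<^sup>+v. ennreal (s r v) * busy_prob k l q (?d l) i v \<partial>lborel))"
      by (simp only:)
    also have "\<dots> = (\<Sum>k. (\<integral>\<^sup>+v. (\<Sum>q. ennreal (s r v) * busy_prob k l q (?d l) i v) \<partial>lborel))"
      by (intro suminf_cong nn_integral_suminf[symmetric]) measurable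
    also have "\<dots> = (\<integral>\<^sup>+v. (\<Sum>k. \<Sum>q. ennreal (s r v) * busy_prob k l q (?d l) i v) \<partial>lborel)"
      by (intro nn_integral_suminf[symmetric]) measurable
    also have "\<dots> = (\<integral>\<^sup>+v. ennreal (s r v) * after_start_enn l (?d l) i v \<partial>lborel)"
      by (simp only: after_start_enn_def ennreal_suminf_cmult)
    also have "\<dots> = (\<integral>\<^sup>+v. after_start_enn l (?d l) i v \<partial>service_dist r)"
      by (rule nn_integral_density[symmetric]) measurable
    also have "\<dots> = (\<integral>\<^sup>+v. ennreal (\<Sum>j\<in>UNIV. visits l j * count_prob (?d l) v $ j $ i) \<partial>service_dist r)"
      using service_dist_nonneg[OF r]
      by (intro nn_integral_cong_AE) (auto simp: after_start_eq[OF l] ennreal_after_start[OF l, symmetric])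
    also have "\<dots> = ennreal (LINT v|service_dist r. (\<Sum>j\<in>UNIV. visits l j * count_prob (?d l) v $ j $ i))"
    proof (rule nn_integral_eq_integral)
      show "AE v in service_dist r. 0 \<le> (\<Sum>j\<in>UNIV. visits l j * count_prob (?d l) v $ j $ i)"
        using service_dist_nonneg[OF r] by eventually_elim (intro sum_nonneg mult_nonneg_nonneg visits_nonneg count_prob_nonneg)
    qed (intro Bochner_Integration.integrable_sum integrable_mult_right int)
    also have "(LINT v|service_dist r. (\<Sum>j\<in>UNIV. visits l j * count_prob (?d l) v $ j $ i)) = (\<Sum>j\<in>UNIV. visits l j * count_mix (service_dist r) (?d l) $ j $ i)"
      by (simp add: count_mix_def int)
    finally show "(\<Sum>k. \<Sum>q. emeasure M (?K l k q)) = ennreal (\<Sum>j\<in>UNIV. visits l j * count_mix (service_dist r) (?d l) $ j $ i)" .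
  qed
  also have "\<dots> = ennreal (\<Sum>l\<in>?L. \<Sum>j\<in>UNIV. visits l j * count_mix (service_dist r) (?d l) $ j $ i)"
    by (intro sum_ennreal sum_nonneg mult_nonneg_nonneg visits_nonneg count_mix_nonneg service_dist_prob_space r service_dist_nonneg) simp
  finally show ?thesis
    unfolding piplus_eq_prob emeasure_eq_measure
    by (subst (asm) ennreal_inj) (auto intro!: sum_nonneg mult_nonneg_nonneg visits_nonneg count_mix_nonneg service_dist_prob_space r service_dist_nonneg a_le_b)
qed

end

section \<open>Generating functions\<close>

lemma vm_entry: "(x v* A) $ j = (\<Sum>i\<in>UNIV. x $ i * (A $ i $ j :: 'a::comm_semiring_1))"
  by (simp add: vector_matrix_mult_def mult.commute)

lemma vm_sum: "x v* (\<Sum>k\<in>K. A k) = (\<Sum>k\<in>K. (x :: 'a::comm_semiring_1^'n) v* A k)"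
proof (induction K rule: infinite_finite_induct)
  case (insert k K) thus ?case by (simp add: vector_matrix_mult_add_rdistrib)
qed (simp_all add: vec_eq_iff vm_entry)

lemma sum_vm: "(\<Sum>k\<in>K. x k) v* A = (\<Sum>k\<in>K. (x k :: 'a::comm_semiring_1^'n) v* A)"
proof (induction K rule: infinite_finite_induct)
  case (insert k K) thus ?case by (simp add: vector_matrix_left_distrib)
qed (simp_all add: vec_eq_iff vm_entry)

lemma vm_mat: "x v* mat c = c *s (x :: 'a::comm_semiring_1^'n)"
  by (simp add: vec_eq_iff vm_entry mat_def if_distrib[of "\<lambda>y. _ * y"] mult.commute cong: if_cong)

lemma cvec_entry [simp]: "cvec v $ i = complex_of_real (v $ i)" by (simp add: cvec_def)

lemma cvec_add: "cvec (x + y) = cvec x + cvec y" by (simp add: vec_eq_iff)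

lemma cvec_sum: "cvec (\<Sum>k\<in>K. x k) = (\<Sum>k\<in>K. cvec (x k))" by (simp add: vec_eq_iff sum_component)

lemma cvec_vm: "cvec (x v* A) = cvec x v* cmat A" by (simp add: vec_eq_iff vm_entry)

lemma sums_vec_nth: "(f :: nat \<Rightarrow> ('a::real_normed_vector)^'n::finite) sums s \<Longrightarrow> (\<lambda>k. f k $ i) sums (s $ i)"
  by (rule bounded_linear.sums[OF bounded_linear_vec_nth])

lemma sums_scale: "f sums s \<Longrightarrow> (\<lambda>k. z *s f k) sums (z *s (s :: complex^'n::finite))"
  by (rule sums_vecI) (auto intro!: sums_mult dest: sums_vec_nth)

lemma sums_vm:
  fixes x :: "complex^'n::finite"
  assumes "\<And>i j. (\<lambda>n. A n $ i $ j) sums (S $ i $ j)"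
  shows "(\<lambda>n. x v* A n) sums (x v* S)"
  by (rule sums_vecI) (auto simp: vm_entry intro!: sums_sum sums_mult assms)

lemma matrix_mult_sum: "A ** (\<Sum>k\<in>K. B k) = (\<Sum>k\<in>K. (A :: 'a::comm_semiring_1^'n^'m) ** B k)"
proof (induction K rule: infinite_finite_induct)
  case (insert k K) thus ?case by (simp add: matrix_add_ldistrib)
qed (simp_all add: vec_eq_iff matrix_matrix_mult_def)

lemma matrix_sum_mult: "(\<Sum>k\<in>K. B k) ** A = (\<Sum>k\<in>K. B k ** (A :: 'a::comm_semiring_1^'n^'m))"
proof (induction K rule: infinite_finite_induct)
  case (insert k K)
  have "(B k + sum B K) ** A = B k ** A + sum B K ** A"
    by (simp add: vec_eq_iff matrix_matrix_mult_def distrib_right sum.distrib)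
  with insert show ?case by simp
qed (simp_all add: vec_eq_iff matrix_matrix_mult_def)

lemma sum_triangle_swap:
  "(\<Sum>k=lo..hi. \<Sum>j=lo..k. f k j) = (\<Sum>j=lo..hi. \<Sum>k=j..(hi::nat). (f k j :: 'a::comm_monoid_add))"
proof -
  have "(\<Sum>k=lo..hi. \<Sum>j=lo..k. f k j) = (\<Sum>(k, j)\<in>(SIGMA k:{lo..hi}. {lo..k}). f k j)"
    by (rule sum.Sigma) auto
  also have "\<dots> = (\<Sum>(j, k)\<in>(SIGMA j:{lo..hi}. {j..hi}). f k j)"
    by (rule sum.reindex_bij_witness[of _ "\<lambda>(j, k). (k, j)" "\<lambda>(k, j). (j, k)"]) auto
  also have "\<dots> = (\<Sum>j=lo..hi. \<Sum>k=j..hi. f k j)"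
    by (rule sum.Sigma[symmetric]) auto
  finally show ?thesis .
qed

section \<open>The matrices Q and C as sums over batch sequences\<close>

lemma Q_mat_last: "n \<noteq> 0 \<Longrightarrow> Q_mat D n = (\<Sum>j<n. Q_mat D j ** Dbar D (n - j))"
proof -
  assume n: "n \<noteq> 0"
  have "{..<n} = insert 0 {1..n - 1}" using n by auto
  hence "(\<Sum>j<n. Q_mat D j ** Dbar D (n - j)) = Q_mat D 0 ** Dbar D n + (\<Sum>j=1..n - 1. Q_mat D j ** Dbar D (n - j))"
    by simp
  thus ?thesis using n by (simp add: Q_mat.simps[of D n] Q_mat.simps[of D 0])
qed

text \<open>Unrolled, \<open>Q_mat D n\<close> sums the products of \<open>Dbar\<close> over all
  compositions of \<open>n\<close>. The definition splits off the last part, this form the first, to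
  match the recursion of \<open>C_mat\<close>.\<close>

lemma Q_mat_first: "n \<noteq> 0 \<Longrightarrow> Q_mat D n = (\<Sum>j=1..n. Dbar D j ** Q_mat D (n - j))"
proof (induction n rule: less_induct)
  case (less n)
  have "Q_mat D n = Dbar D n + (\<Sum>k=1..n - 1. Q_mat D k ** Dbar D (n - k))"
    using less.prems by (simp add: Q_mat.simps[of D n])
  also have "(\<Sum>k=1..n - 1. Q_mat D k ** Dbar D (n - k)) = (\<Sum>k=1..n - 1. \<Sum>j=1..k. Dbar D j ** (Q_mat D (k - j) ** Dbar D (n - k)))"
    using less.IH by (intro sum.cong refl) (auto simp: matrix_sum_mult matrix_mul_assoc)
  also have "\<dots> = (\<Sum>j=1..n - 1. \<Sum>k=j..n - 1. Dbar D j ** (Q_mat D (k - j) ** Dbar D (n - k)))"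
    by (rule sum_triangle_swap)
  also have "\<dots> = (\<Sum>j=1..n - 1. Dbar D j ** Q_mat D (n - j))"
  proof (intro sum.cong refl)
    fix j assume j: "j \<in> {1..n - 1}"
    have "(\<Sum>k=j..n - 1. Q_mat D (k - j) ** Dbar D (n - k)) = (\<Sum>m<n - j. Q_mat D m ** Dbar D (n - j - m))"
      using j by (intro sum.reindex_bij_witness[of _ "\<lambda>m. m + j" "\<lambda>k. k - j"]) auto
    also have "\<dots> = Q_mat D (n - j)" using j by (intro Q_mat_last[symmetric]) auto
    finally show "(\<Sum>k=j..n - 1. Dbar D j ** (Q_mat D (k - j) ** Dbar D (n - k))) = Dbar D j ** Q_mat D (n - j)"
      by (simp add: matrix_mult_sum[symmetric])
  qed
  also have "Dbar D n + (\<Sum>j=1..n - 1. Dbar D j ** Q_mat D (n - j)) = (\<Sum>j=1..n. Dbar D j ** Q_mat D (n - j))"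
    using less.prems by (cases n) (simp_all add: Q_mat.simps[of D 0])
  finally show ?case .
qed

text \<open>\<open>l'\<close> is the last level below \<open>a\<close> before the batch that lifts
  the queue to \<open>l\<close>; \<open>Q_mat\<close> collects all routes from \<open>j\<close> to
  \<open>l'\<close>.\<close>

lemma C_mat_eq:
  assumes "j < a" "a \<le> l"
  shows "C_mat D a l j = (\<Sum>l'=j..a - 1. Q_mat D (l' - j) ** Dbar D (l - l'))"
  using assms(1)
proof (induction "a - j" arbitrary: j rule: less_induct)
  case less
  have "C_mat D a l j = (\<Sum>m=j + 1..a - 1. Dbar D (m - j) ** C_mat D a l m) + Dbar D (l - j)"
    using assms less.prems by (subst C_mat.simps) (auto simp: Suc_diff_le)
  also have "(\<Sum>m=j + 1..a - 1. Dbar D (m - j) ** C_mat D a l m)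
      = (\<Sum>m=j + 1..a - 1. \<Sum>l'=m..a - 1. Dbar D (m - j) ** (Q_mat D (l' - m) ** Dbar D (l - l')))"
  proof (intro sum.cong refl)
    fix m assume "m \<in> {j + 1..a - 1}"
    hence "C_mat D a l m = (\<Sum>l'=m..a - 1. Q_mat D (l' - m) ** Dbar D (l - l'))"
      using less.prems by (intro less.hyps) auto
    thus "Dbar D (m - j) ** C_mat D a l m = (\<Sum>l'=m..a - 1. Dbar D (m - j) ** (Q_mat D (l' - m) ** Dbar D (l - l')))"
      by (simp add: matrix_mult_sum)
  qed
  also have "\<dots> = (\<Sum>l'=j + 1..a - 1. \<Sum>m=j + 1..l'. Dbar D (m - j) ** (Q_mat D (l' - m) ** Dbar D (l - l')))"
    by (rule sum_triangle_swap[symmetric])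
  also have "\<dots> = (\<Sum>l'=j + 1..a - 1. Q_mat D (l' - j) ** Dbar D (l - l'))"
  proof (intro sum.cong refl)
    fix l' assume l': "l' \<in> {j + 1..a - 1}"
    hence "Q_mat D (l' - j) = (\<Sum>i=1..l' - j. Dbar D i ** Q_mat D (l' - j - i))"
      by (intro Q_mat_first) auto
    also have "\<dots> = (\<Sum>m=j + 1..l'. Dbar D (m - j) ** Q_mat D (l' - m))"
      using l' by (intro sum.reindex_bij_witness[of _ "\<lambda>m. m - j" "\<lambda>i. j + i"]) auto
    finally show "(\<Sum>m=j + 1..l'. Dbar D (m - j) ** (Q_mat D (l' - m) ** Dbar D (l - l'))) = Q_mat D (l' - j) ** Dbar D (l - l')"
      by (simp add: matrix_sum_mult matrix_mul_assoc)
  qed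
  also have "\<dots> + Dbar D (l - j) = (\<Sum>l'=j..a - 1. Q_mat D (l' - j) ** Dbar D (l - l'))"
    using less.prems by (subst (2) sum.atLeast_Suc_atMost) (auto simp: Q_mat.simps[of D 0] add.commute)
  finally show ?case .
qed

context stationary_bulk_queue
begin

section \<open>The state at the start of service in terms of \<psi>\<close>

definition visit_vec :: "nat \<Rightarrow> real^'m" where "visit_vec l = (\<chi> j. visits l j)"

definition \<psi> :: "nat \<Rightarrow> real^'m" where "\<psi> n = psiplus a b piplus n"

text \<open>
  The mean time spent at level \<open>l\<close> during the idle period, multiplied by \<open>- D 0\<close>, is the law of the
  phase at the first visit to \<open>l\<close>.
\<close>

definition level_law :: "nat \<Rightarrow> real^'m" where "level_law l = (\<chi> i. visits l i / exit_rate i) v* (- D 0)"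

lemma level_law_Dbar: "level_law l v* Dbar D c = (\<chi> i. visits l i / exit_rate i) v* D c"
  unfolding level_law_def Dbar_def vector_matrix_mul_assoc matrix_mul_assoc
  by (simp add: mult_matrix_inv[OF invertible_uminus[OF D0_invertible]])

text \<open>Mean time in a phase times an intensity is a mean number of transitions; for
  \<open>c = 0\<close> the diagonal of \<open>D 0\<close> subtracts the visits themselves.\<close>

lemma idle_time_vm: "((\<chi> i. visits l i / exit_rate i) v* D c) $ j = (\<Sum>i\<in>UNIV. visits l i * jump_prob D i c j) - (if c = 0 then visits l j else 0)"
proof -
  have "((\<chi> i. visits l i / exit_rate i) v* D c) $ j = (\<Sum>i\<in>UNIV. visits l i * jump_prob D i c j - (if i = j then (if c = 0 then visits l j else 0) else 0))"
    unfolding vm_entry using exit_rate_pos by (intro sum.cong refl) (auto simp: D_eq less_imp_neq[symmetric] algebra_simps)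
  thus ?thesis by (simp add: sum_subtractf)
qed

text \<open>Service starts with \<open>l\<close> customers either at once, when the departure leaves
  \<open>l\<close>, or through the batch that ends the idle period at its last level
  \<open>l'\<close>.\<close>

lemma visit_vec_eq_level_law:
  assumes "a \<le> l"
  shows "visit_vec l = \<psi> l + (\<Sum>l'<a. level_law l' v* Dbar D (l - l'))"
proof -
  have "{l'. l' < a \<and> l' \<le> l} = {..<a}" using assms by auto
  thus ?thesis
    using assms by (auto simp: vec_eq_iff visit_vec_def \<psi>_def psiplus_eq visits_renewal[of l] sum_component level_law_Dbar idle_time_vm intro!: sum.cong)
qed

text \<open>Silent phase changes are absorbed by the factor \<open>- D 0\<close>, so only strictly
  lower levels remain in the recursion.\<close>

lemma level_law_rec:
  assumes "l < a"
  shows "level_law l = \<psi> l + (\<Sum>l'<l. level_law l' v* Dbar D (l - l'))"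
proof -
  have eq: "{l'. l' < a \<and> l' \<le> l} = insert l {..<l}" using assms by auto
  have "level_law l $ j = visits l j - (\<Sum>i\<in>UNIV. visits l i * jump_prob D i 0 j)" for j
    using idle_time_vm[of l 0 j] by (simp add: level_law_def vm_entry sum_negf)
  moreover have "(\<Sum>l'<l. level_law l' v* Dbar D (l - l')) $ j = (\<Sum>l'<l. \<Sum>i\<in>UNIV. visits l' i * jump_prob D i (l - l') j)" for j
    by (auto simp: sum_component level_law_Dbar idle_time_vm intro!: sum.cong)
  ultimately show ?thesis
    using visits_renewal[of l] unfolding eq by (simp add: vec_eq_iff \<psi>_def psiplus_eq)
qed

text \<open>\<open>level_law_rec\<close> and the definition of \<open>Q_mat\<close> both split off
  the last batch, so they match after one exchange of sums.\<close>

lemma level_law_eq: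
  assumes "l < a"
  shows "level_law l = (\<Sum>j\<le>l. \<psi> j v* Q_mat D (l - j))"
  using assms
proof (induction l rule: less_induct)
  case (less l)
  have "level_law l = \<psi> l + (\<Sum>l'<l. \<Sum>j\<le>l'. \<psi> j v* (Q_mat D (l' - j) ** Dbar D (l - l')))"
    using less by (simp add: level_law_rec[of l] sum_vm vector_matrix_mul_assoc)
  also have "(\<Sum>l'<l. \<Sum>j\<le>l'. \<psi> j v* (Q_mat D (l' - j) ** Dbar D (l - l')))
     = (\<Sum>j<l. \<Sum>l'=j..<l. \<psi> j v* (Q_mat D (l' - j) ** Dbar D (l - l')))"
  proof (cases l)
    case (Suc k)
    thus ?thesis
      using sum_triangle_swap[of "\<lambda>l' j. \<psi> j v* (Q_mat D (l' - j) ** Dbar D (l - l'))" 0 k]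
      by (simp add: atLeast0AtMost lessThan_Suc_atMost atLeastLessThanSuc_atLeastAtMost)
  qed simp
  also have "\<dots> = (\<Sum>j<l. \<psi> j v* Q_mat D (l - j))"
  proof (intro sum.cong refl)
    fix j assume j: "j \<in> {..<l}"
    have "(\<Sum>l'=j..<l. Q_mat D (l' - j) ** Dbar D (l - l')) = (\<Sum>m<l - j. Q_mat D m ** Dbar D (l - j - m))"
      using j by (intro sum.reindex_bij_witness[of _ "\<lambda>m. m + j" "\<lambda>k. k - j"]) auto
    also have "\<dots> = Q_mat D (l - j)" using j by (intro Q_mat_last[symmetric]) auto
    finally show "(\<Sum>l'=j..<l. \<psi> j v* (Q_mat D (l' - j) ** Dbar D (l - l'))) = \<psi> j v* Q_mat D (l - j)"
      by (simp add: vm_sum[symmetric])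
  qed
  finally show ?case
    by (simp add: lessThan_Suc_atMost[symmetric] Q_mat.simps[of D 0] add.commute)
qed

lemma visit_vec_eq:
  assumes "a \<le> l"
  shows "visit_vec l = \<psi> l + (\<Sum>j=0..a - 1. \<psi> j v* C_mat D a l j)"
proof -
  have "(\<Sum>l'<a. level_law l' v* Dbar D (l - l')) = (\<Sum>l'=0..a - 1. \<Sum>j=0..l'. \<psi> j v* (Q_mat D (l' - j) ** Dbar D (l - l')))"
    using a_pos by (intro sum.cong) (auto simp: level_law_eq sum_vm vector_matrix_mul_assoc atLeast0AtMost)
  also have "\<dots> = (\<Sum>j=0..a - 1. \<psi> j v* C_mat D a l j)"
    unfolding sum_triangle_swap using a_pos assms by (intro sum.cong refl) (auto simp: C_mat_eq vm_sum)
  finally show ?thesis by (simp add: visit_vec_eq_level_law[OF assms])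
qed

lemma piplus_lt:
  assumes "a \<le> r" "r < b"
  shows "piplus n r = visit_vec r v* count_mix (service_dist r) n"
proof -
  have "{l. a \<le> l \<and> min l b = r \<and> l \<le> n + r} = {r}" using assms by auto
  thus ?thesis using assms by (simp add: vec_eq_iff piplus_eq vm_entry visit_vec_def)
qed

lemma piplus_b: "piplus n b = (\<Sum>c\<le>n. visit_vec (b + c) v* count_mix (service_dist b) (n - c))"
proof -
  have "(\<Sum>l | a \<le> l \<and> min l b = b \<and> l \<le> n + b. visit_vec l v* count_mix (service_dist b) (n - (l - b)))
     = (\<Sum>c\<le>n. visit_vec (b + c) v* count_mix (service_dist b) (n - c))"
    using a_le_b by (intro sum.reindex_bij_witness[of _ "\<lambda>c. b + c" "\<lambda>l. l - b"]) (auto simp: min_def split: if_splits)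
  thus ?thesis using a_le_b by (simp add: vec_eq_iff piplus_eq vm_entry visit_vec_def sum_component)
qed

section \<open>Generating functions at departure epochs\<close>

lemma gf_sums:
  assumes r: "a \<le> r" "r \<le> b" and z: "norm z \<le> 1"
  shows "(\<lambda>n. complex_of_real (count_mix (service_dist r) n $ i $ j) * z ^ n) sums (A_gf D s r z $ i $ j)"
  unfolding A_gf_def
  by (rule mat_exp_mix_sums[OF service_dist_prob_space[OF r] _ service_dist_nonneg[OF r] z]) simp

lemma piplus_lt_sums:
  assumes r: "a \<le> r" "r < b" and z: "norm z \<le> 1"
  shows "(\<lambda>n. z ^ n *s cvec (piplus n r)) sums (cvec (visit_vec r) v* A_gf D s r z)"
proof -
  have "(\<lambda>n. cvec (visit_vec r) v* (\<chi> i j. complex_of_real (count_mix (service_dist r) n $ i $ j) * z ^ n)) sums (cvec (visit_vec r) v* A_gf D s r z)"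
    by (rule sums_vm) (use r gf_sums[OF _ _ z] in auto)
  also have "(\<lambda>n. cvec (visit_vec r) v* (\<chi> i j. complex_of_real (count_mix (service_dist r) n $ i $ j) * z ^ n)) = (\<lambda>n. z ^ n *s cvec (piplus n r))"
    by (simp add: fun_eq_iff vec_eq_iff piplus_lt[OF r] vm_entry sum_distrib_left mult_ac)
  finally show ?thesis .
qed

lemma \<psi>_summable: "summable (\<lambda>n. \<psi> n $ i)" and \<psi>_nonneg: "0 \<le> \<psi> n $ i"
proof -
  let ?E = "\<lambda>n. start 0 n \<inter> {\<omega> \<in> space M. Y 0 \<omega> = i}"
  have "(\<lambda>n. prob (?E n)) sums prob (\<Union>n. ?E n)"
    by (intro finite_measure_UNION) (auto simp: disjoint_family_on_def start_def)
  thus "summable (\<lambda>n. \<psi> n $ i)" by (auto simp: \<psi>_def psiplus_eq visit_prob_def sums_iff)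
  show "0 \<le> \<psi> n $ i" by (simp add: \<psi>_def psiplus_eq visit_prob_nonneg)
qed

lemma Dbar_summable: "summable (\<lambda>k. \<bar>Dbar D k $ i $ j\<bar>)"
proof -
  \<comment> \<open>Only \<open>D 0\<close> has negative entries, so dropping the first term removes
    the absolute values.\<close>
  have D: "summable (\<lambda>k. \<bar>D k $ h $ j\<bar>)" for h
  proof (subst summable_iff_shift[of _ 1, symmetric])
    show "summable (\<lambda>k. \<bar>D (k + 1) $ h $ j\<bar>)"
      using summable_ignore_initial_segment[OF D_summable[of h j], of 1] by (simp add: Dk_nonneg)
  qed
  show ?thesis
  proof (rule summable_comparison_test')
    show "summable (\<lambda>k. \<Sum>h\<in>UNIV. \<bar>matrix_inv (- D 0) $ i $ h\<bar> * \<bar>D k $ h $ j\<bar>)"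
      by (intro summable_sum summable_mult D)
    show "norm \<bar>Dbar D k $ i $ j\<bar> \<le> (\<Sum>h\<in>UNIV. \<bar>matrix_inv (- D 0) $ i $ h\<bar> * \<bar>D k $ h $ j\<bar>)" for k
      unfolding Dbar_def matrix_matrix_mult_def by (simp add: abs_mult[symmetric])
  qed
qed

lemma summable_power_le:
  fixes f :: "nat \<Rightarrow> real" and z :: complex
  assumes "summable (\<lambda>n. \<bar>f n\<bar>)" "norm z \<le> 1"
  shows "summable (\<lambda>n. norm (complex_of_real (f n) * z ^ e n))"
  by (rule summable_comparison_test'[OF assms(1), of 0])
     (use assms(2) in \<open>auto simp: norm_mult norm_power intro!: mult_left_le power_le_one\<close>)

lemma tau_sums:
  assumes "norm z \<le> 1"
  shows "(\<lambda>k. complex_of_real (Dbar D (i + k) $ h $ h') * z ^ (i + k)) sums (tau D i z $ h $ h')"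
proof -
  have "summable (\<lambda>k. \<bar>Dbar D (i + k) $ h $ h'\<bar>)"
    using summable_ignore_initial_segment[OF Dbar_summable, of i h h'] by (simp add: add.commute)
  from summable_norm_cancel[OF summable_power_le[OF this assms]] show ?thesis
    unfolding tau_def by (simp add: summable_sums)
qed

text \<open>\<open>\<psi>\<close> is summable as a family of probabilities of disjoint events,
  \<open>Dbar\<close> is absolutely summable, and finitely many \<open>level_law\<close> vectors
  enter as constants. Absolute values spare sign arguments for the last two.\<close>

lemma visit_vec_summable: "summable (\<lambda>c. \<bar>visit_vec (b + c) $ j\<bar>)"
proof -
  have D: "summable (\<lambda>c. \<bar>Dbar D (b + c - l') $ i $ j\<bar>)" if "l' < a" for l' i
    using summable_ignore_initial_segment[OF Dbar_summable, of "b - l'" i j] that a_le_b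
    by (simp add: add.commute add_diff_assoc2)
  have "summable (\<lambda>c. \<psi> (b + c) $ j + (\<Sum>l'<a. \<Sum>i\<in>UNIV. \<bar>level_law l' $ i\<bar> * \<bar>Dbar D (b + c - l') $ i $ j\<bar>))"
    using summable_ignore_initial_segment[OF \<psi>_summable, of b j]
    by (intro summable_add summable_sum summable_mult D) (auto simp: add.commute)
  thus ?thesis
  proof (rule summable_comparison_test'[of _ 0])
    fix c
    have "\<bar>visit_vec (b + c) $ j\<bar> \<le> \<bar>\<psi> (b + c) $ j\<bar> + \<bar>\<Sum>l'<a. \<Sum>i\<in>UNIV. level_law l' $ i * Dbar D (b + c - l') $ i $ j\<bar>"
      using a_le_b by (simp add: visit_vec_eq_level_law sum_component vm_entry abs_triangle_ineq)
    also have "\<bar>\<Sum>l'<a. \<Sum>i\<in>UNIV. level_law l' $ i * Dbar D (b + c - l') $ i $ j\<bar>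
       \<le> (\<Sum>l'<a. \<bar>\<Sum>i\<in>UNIV. level_law l' $ i * Dbar D (b + c - l') $ i $ j\<bar>)" by (rule sum_abs)
    also have "\<dots> \<le> (\<Sum>l'<a. \<Sum>i\<in>UNIV. \<bar>level_law l' $ i\<bar> * \<bar>Dbar D (b + c - l') $ i $ j\<bar>)"
      unfolding abs_mult[symmetric] by (intro sum_mono sum_abs)
    finally show "norm \<bar>visit_vec (b + c) $ j\<bar> \<le> \<psi> (b + c) $ j + (\<Sum>l'<a. \<Sum>i\<in>UNIV. \<bar>level_law l' $ i\<bar> * \<bar>Dbar D (b + c - l') $ i $ j\<bar>)"
      by (simp add: \<psi>_nonneg)
  qed
qed

definition visit_vec_gf :: "complex \<Rightarrow> complex^'m" where
  "visit_vec_gf z = (\<chi> j. \<Sum>c. complex_of_real (visit_vec (b + c) $ j) * z ^ c)"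

lemma visit_vec_gf_sums:
  assumes z: "norm z \<le> 1"
  shows "(\<lambda>c. z ^ c *s cvec (visit_vec (b + c))) sums visit_vec_gf z"
proof (rule sums_vecI)
  fix i
  have "summable (\<lambda>c. complex_of_real (visit_vec (b + c) $ i) * z ^ c)"
    by (rule summable_norm_cancel[OF summable_power_le[OF visit_vec_summable z]])
  thus "(\<lambda>c. (z ^ c *s cvec (visit_vec (b + c))) $ i) sums (visit_vec_gf z $ i)"
    by (simp add: visit_vec_gf_def mult.commute summable_sums)
qed

lemma piplus_b_sums:
  assumes z: "norm z \<le> 1"
  shows "(\<lambda>n. z ^ n *s cvec (piplus n b)) sums (visit_vec_gf z v* A_gf D s b z)"
proof (rule sums_vecI)
  fix i
  have "(\<lambda>n. \<Sum>j\<in>UNIV. \<Sum>c\<le>n. (complex_of_real (visit_vec (b + c) $ j) * z ^ c) *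
      (complex_of_real (count_mix (service_dist b) (n - c) $ j $ i) * z ^ (n - c)))
     sums (\<Sum>j\<in>UNIV. (\<Sum>c. complex_of_real (visit_vec (b + c) $ j) * z ^ c) * (\<Sum>n. complex_of_real (count_mix (service_dist b) n $ j $ i) * z ^ n))"
    by (intro sums_sum Cauchy_product_sums summable_power_le z visit_vec_summable)
       (use count_mix_summable[OF service_dist_prob_space[OF a_le_b order_refl] _ service_dist_nonneg[OF a_le_b order_refl]]
            count_mix_nonneg[OF service_dist_prob_space[OF a_le_b order_refl] _ service_dist_nonneg[OF a_le_b order_refl]] in simp)
  also have "(\<Sum>j\<in>UNIV. (\<Sum>c. complex_of_real (visit_vec (b + c) $ j) * z ^ c) * (\<Sum>n. complex_of_real (count_mix (service_dist b) n $ j $ i) * z ^ n))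
      = (visit_vec_gf z v* A_gf D s b z) $ i"
    by (simp add: vm_entry visit_vec_gf_def sums_unique[OF gf_sums[OF a_le_b order_refl z], symmetric])
  also have "(\<lambda>n. \<Sum>j\<in>UNIV. \<Sum>c\<le>n. (complex_of_real (visit_vec (b + c) $ j) * z ^ c) *
      (complex_of_real (count_mix (service_dist b) (n - c) $ j $ i) * z ^ (n - c))) = (\<lambda>n. (z ^ n *s cvec (piplus n b)) $ i)"
  proof
    fix n
    have "(z ^ n *s cvec (piplus n b)) $ i
       = (\<Sum>c\<le>n. \<Sum>j\<in>UNIV. z ^ n * (complex_of_real (visit_vec (b + c) $ j) * complex_of_real (count_mix (service_dist b) (n - c) $ j $ i)))"
      by (simp add: piplus_b sum_component vm_entry sum_distrib_left)
    also have "\<dots> = (\<Sum>c\<le>n. \<Sum>j\<in>UNIV. (complex_of_real (visit_vec (b + c) $ j) * z ^ c) *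
      (complex_of_real (count_mix (service_dist b) (n - c) $ j $ i) * z ^ (n - c)))"
      by (intro sum.cong refl) (simp add: power_add[symmetric] mult_ac)
    finally show "(\<Sum>j\<in>UNIV. \<Sum>c\<le>n. (complex_of_real (visit_vec (b + c) $ j) * z ^ c) *
      (complex_of_real (count_mix (service_dist b) (n - c) $ j $ i) * z ^ (n - c))) = (z ^ n *s cvec (piplus n b)) $ i"
      by (subst sum.swap) simp
  qed
  finally show "(\<lambda>n. (z ^ n *s cvec (piplus n b)) $ i) sums ((visit_vec_gf z v* A_gf D s b z) $ i)" .
qed

text \<open>Two relations are combined: the generating function of \<open>\<psi>\<close> is the sum
  over batch sizes of those of \<open>piplus\<close>, and \<open>visit_vec (b + c)\<close> is
  \<open>\<psi> (b + c)\<close> plus the inflow from the idle levels.\<close>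

lemma visit_vec_gf_eq:
  assumes z: "norm z \<le> 1"
  shows "z ^ b *s visit_vec_gf z = (\<Sum>r=a..b - 1. cvec (visit_vec r) v* A_gf D s r z) + visit_vec_gf z v* A_gf D s b z
    - (\<Sum>n<b. z ^ n *s cvec (\<psi> n)) + (\<Sum>j=0..a - 1. z ^ b *s (cvec (\<psi> j) v* cmat (C_mat D a b j)))
    + (\<Sum>l'<a. z ^ l' *s (cvec (level_law l') v* tau D (b + 1 - l') z))"
proof -
  define \<Psi> where "\<Psi> = (\<Sum>r=a..b - 1. cvec (visit_vec r) v* A_gf D s r z) + visit_vec_gf z v* A_gf D s b z"
  have \<psi>: "cvec (\<psi> n) = (\<Sum>r=a..b - 1. cvec (piplus n r)) + cvec (piplus n b)" for n
  proof -
    have "{a..b} = insert b {a..b - 1}" "b \<notin> {a..b - 1}" using a_le_b a_pos by auto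
    thus ?thesis unfolding \<psi>_def psiplus_def by (simp add: cvec_sum cvec_add)
  qed
  have "(\<lambda>n. (\<Sum>r=a..b - 1. z ^ n *s cvec (piplus n r)) + z ^ n *s cvec (piplus n b)) sums \<Psi>"
    unfolding \<Psi>_def using a_pos a_le_b by (intro sums_add sums_sum piplus_lt_sums piplus_b_sums z) auto
  hence "(\<lambda>n. z ^ n *s cvec (\<psi> n)) sums \<Psi>"
    by (simp add: \<psi> vec_eq_iff distrib_left sum_distrib_left sum_component vector_add_ldistrib vec.scale_sum_right)
  \<comment> \<open>The cut is at \<open>b + 1\<close>, not at \<open>b\<close>: level
    \<open>b\<close> itself is expressed by \<open>C_mat\<close> and only the levels beyond it by
    \<open>tau\<close>, whose index therefore starts at \<open>b + 1 - l'\<close>.\<close>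
  from sums_split_initial_segment[OF this, of "b + 1"]
  have 1: "(\<lambda>c. z ^ (b + 1 + c) *s cvec (\<psi> (b + 1 + c))) sums (\<Psi> - (\<Sum>n<b + 1. z ^ n *s cvec (\<psi> n)))"
    by (simp add: add_ac)
  have 2: "(\<lambda>c. z ^ (b + 1 + c) *s (cvec (level_law l') v* cmat (Dbar D (b + 1 + c - l')))) sums (z ^ l' *s (cvec (level_law l') v* tau D (b + 1 - l') z))"
    if "l' < a" for l'
  proof -
    have idx: "b + 1 - l' + c = b + 1 + c - l'" "z ^ (b + 1 + c) = z ^ l' * z ^ (b + 1 + c - l')" for c
      using that a_le_b by (auto simp flip: power_add)
    have "(\<lambda>c. cvec (level_law l') v* (\<chi> i j. complex_of_real (Dbar D (b + 1 - l' + c) $ i $ j) * z ^ (b + 1 - l' + c))) sums (cvec (level_law l') v* tau D (b + 1 - l') z)"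
      by (rule sums_vm) (use tau_sums[OF z, of "b + 1 - l'"] in simp)
    from sums_scale[OF this, of "z ^ l'"]
    have "(\<lambda>c. z ^ l' *s (cvec (level_law l') v* (\<chi> i j. complex_of_real (Dbar D (b + 1 - l' + c) $ i $ j) * z ^ (b + 1 - l' + c)))) sums (z ^ l' *s (cvec (level_law l') v* tau D (b + 1 - l') z))" .
    also have "(\<lambda>c. z ^ l' *s (cvec (level_law l') v* (\<chi> i j. complex_of_real (Dbar D (b + 1 - l' + c) $ i $ j) * z ^ (b + 1 - l' + c))))
       = (\<lambda>c. z ^ (b + 1 + c) *s (cvec (level_law l') v* cmat (Dbar D (b + 1 + c - l'))))"
      unfolding idx by (simp add: fun_eq_iff vec_eq_iff vm_entry sum_distrib_left mult_ac)
    finally show ?thesis .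
  qed
  have u: "z ^ (b + 1 + c) *s cvec (visit_vec (b + 1 + c)) = z ^ (b + 1 + c) *s cvec (\<psi> (b + 1 + c))
      + (\<Sum>l'<a. z ^ (b + 1 + c) *s (cvec (level_law l') v* cmat (Dbar D (b + 1 + c - l'))))" for c
    using a_le_b by (simp only: visit_vec_eq_level_law cvec_add cvec_sum cvec_vm vector_add_ldistrib vec.scale_sum_right trans_le_add1)
  have 3: "(\<lambda>c. z ^ (b + 1 + c) *s cvec (visit_vec (b + 1 + c))) sums
     (\<Psi> - (\<Sum>n<b + 1. z ^ n *s cvec (\<psi> n)) + (\<Sum>l'<a. z ^ l' *s (cvec (level_law l') v* tau D (b + 1 - l') z)))"
    unfolding u by (intro sums_add sums_sum 1 2) auto
  from sums_scale[OF visit_vec_gf_sums[OF z], of "z ^ b"]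
  have "(\<lambda>c. z ^ (b + c) *s cvec (visit_vec (b + c))) sums (z ^ b *s visit_vec_gf z)"
    by (simp add: power_add vector_smult_assoc)
  from sums_split_initial_segment[OF this, of 1]
  have "(\<lambda>c. z ^ (b + 1 + c) *s cvec (visit_vec (b + 1 + c))) sums (z ^ b *s visit_vec_gf z - z ^ b *s cvec (visit_vec b))"
    by (simp add: add_ac)
  from sums_unique2[OF this 3]
  have "z ^ b *s visit_vec_gf z = z ^ b *s cvec (visit_vec b) + (\<Psi> - (\<Sum>n<b + 1. z ^ n *s cvec (\<psi> n)) + (\<Sum>l'<a. z ^ l' *s (cvec (level_law l') v* tau D (b + 1 - l') z)))"
    by (simp add: algebra_simps)
  \<comment> \<open>The term with \<open>\<psi> b\<close> gained here cancels the last term of the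
    sum over \<open>n < b + 1\<close>.\<close>
  also have "z ^ b *s cvec (visit_vec b) = z ^ b *s cvec (\<psi> b) + (\<Sum>j=0..a - 1. z ^ b *s (cvec (\<psi> j) v* cmat (C_mat D a b j)))"
    using a_le_b by (simp only: visit_vec_eq cvec_add cvec_sum cvec_vm vector_add_ldistrib vec.scale_sum_right)
  finally show ?thesis by (simp add: \<Psi>_def)
qed

text \<open>Substitute i = b + 1 - l' with \<open>l'\<close> the last idle level: \<open>i\<close>
  from \<open>b - a + 2\<close> to \<open>b + 1 - j\<close> means \<open>l'\<close> from
  \<open>a - 1\<close> down to \<open>j\<close>. Summed over \<open>j\<close>, the
  \<open>Q_mat\<close> terms add up to \<open>level_law l'\<close>.\<close>

lemma idle_gf_eq:
  "(\<Sum>j=0..a - 1. \<Sum>i=b - a + 2..b + 1 - j. z ^ (b + 1 - i) *s (cvec (\<psi> j) v* (cmat (Q_mat D (b + 1 - j - i)) ** tau D i z)))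
   = (\<Sum>l'<a. z ^ l' *s (cvec (level_law l') v* tau D (b + 1 - l') z))"
proof -
  have "(\<Sum>i=b - a + 2..b + 1 - j. z ^ (b + 1 - i) *s (cvec (\<psi> j) v* (cmat (Q_mat D (b + 1 - j - i)) ** tau D i z)))
     = (\<Sum>l'=j..a - 1. z ^ l' *s (cvec (\<psi> j v* Q_mat D (l' - j)) v* tau D (b + 1 - l') z))" if "j \<in> {0..a - 1}" for j
    using that a_pos a_le_b
    by (intro sum.reindex_bij_witness[of _ "\<lambda>l'. b + 1 - l'" "\<lambda>i. b + 1 - i"])
       (auto simp: cvec_vm vector_matrix_mul_assoc add.commute)
  hence "(\<Sum>j=0..a - 1. \<Sum>i=b - a + 2..b + 1 - j. z ^ (b + 1 - i) *s (cvec (\<psi> j) v* (cmat (Q_mat D (b + 1 - j - i)) ** tau D i z)))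
     = (\<Sum>j=0..a - 1. \<Sum>l'=j..a - 1. z ^ l' *s (cvec (\<psi> j v* Q_mat D (l' - j)) v* tau D (b + 1 - l') z))"
    by (rule sum.cong[OF refl])
  also have "\<dots> = (\<Sum>l'=0..a - 1. \<Sum>j=0..l'. z ^ l' *s (cvec (\<psi> j v* Q_mat D (l' - j)) v* tau D (b + 1 - l') z))"
    by (rule sum_triangle_swap[symmetric])
  also have "\<dots> = (\<Sum>l'<a. z ^ l' *s (cvec (level_law l') v* tau D (b + 1 - l') z))"
  proof (intro sum.cong)
    show "{0..a - 1} = {..<a}" using a_pos by auto
    fix l' assume "l' \<in> {..<a}"
    thus "(\<Sum>j=0..l'. z ^ l' *s (cvec (\<psi> j v* Q_mat D (l' - j)) v* tau D (b + 1 - l') z)) = z ^ l' *s (cvec (level_law l') v* tau D (b + 1 - l') z)"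
      by (simp add: level_law_eq cvec_sum sum_vm vec.scale_sum_right atLeast0AtMost)
  qed
  finally show ?thesis .
qed

text \<open>Removing the term for \<open>b\<close> leaves the batch sizes below \<open>b\<close>;
  their \<open>C_mat\<close> contributions and the separate terms with \<open>\<psi> j\<close>,
  \<open>a \<le> j\<close>, combine to \<open>visit_vec\<close>.\<close>

lemma bracket_eq:
  "(\<Sum>j = 0..a - 1. cvec (\<psi> j) v*
       ((\<Sum>l = a..b. cmat (C_mat D a l j) ** A_gf D s l z)
        - cmat (C_mat D a b j) ** A_gf D s b z
        + (cmat (C_mat D a b j) ** mat (z ^ b)
           + (\<Sum>i = b - a + 2..b + 1 - j.
                cmat (Q_mat D (b + 1 - j - i)) ** tau D i z ** mat (z ^ (b + 1 - i)))
           - mat (z ^ j))))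
    + (\<Sum>j = a..b - 1. cvec (\<psi> j) v* (A_gf D s j z - mat (z ^ j)))
   = (\<Sum>r=a..b - 1. cvec (visit_vec r) v* A_gf D s r z)
    - (\<Sum>n<b. z ^ n *s cvec (\<psi> n)) + (\<Sum>j=0..a - 1. z ^ b *s (cvec (\<psi> j) v* cmat (C_mat D a b j)))
    + (\<Sum>l'<a. z ^ l' *s (cvec (level_law l') v* tau D (b + 1 - l') z))"
proof -
  let ?A = "\<lambda>l. A_gf D s l z"
  have ab: "{a..b} = insert b {a..b - 1}" "b \<notin> {a..b - 1}" using a_le_b a_pos by auto
  have C: "(\<Sum>l = a..b. cmat (C_mat D a l j) ** ?A l) - cmat (C_mat D a b j) ** ?A b = (\<Sum>l = a..b - 1. cmat (C_mat D a l j) ** ?A l)" for j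
    using ab by simp
  have term_eq: "cvec (\<psi> j) v*
       ((\<Sum>l = a..b - 1. cmat (C_mat D a l j) ** ?A l)
        + (cmat (C_mat D a b j) ** mat (z ^ b)
           + (\<Sum>i = b - a + 2..b + 1 - j.
                cmat (Q_mat D (b + 1 - j - i)) ** tau D i z ** mat (z ^ (b + 1 - i)))
           - mat (z ^ j)))
    = (\<Sum>l = a..b - 1. cvec (\<psi> j v* C_mat D a l j) v* ?A l) + z ^ b *s (cvec (\<psi> j) v* cmat (C_mat D a b j))
      + (\<Sum>i=b - a + 2..b + 1 - j. z ^ (b + 1 - i) *s (cvec (\<psi> j) v* (cmat (Q_mat D (b + 1 - j - i)) ** tau D i z)))
      - z ^ j *s cvec (\<psi> j)" for j
    by (simp only: vector_matrix_mult_add_rdistrib vector_matrix_mult_diff_rdistrib vm_sum vector_matrix_mul_assoc[symmetric] vm_mat cvec_vm)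
       (simp add: algebra_simps)
  have swap: "(\<Sum>j=0..a - 1. \<Sum>l = a..b - 1. cvec (\<psi> j v* C_mat D a l j) v* ?A l) + (\<Sum>j = a..b - 1. cvec (\<psi> j) v* ?A j)
     = (\<Sum>r=a..b - 1. cvec (visit_vec r) v* ?A r)"
    by (subst sum.swap) (simp add: visit_vec_eq cvec_add cvec_sum vector_matrix_left_distrib sum_vm sum.distrib add.commute)
  have split: "(\<Sum>n<b. z ^ n *s cvec (\<psi> n)) = (\<Sum>j=0..a - 1. z ^ j *s cvec (\<psi> j)) + (\<Sum>j=a..b - 1. z ^ j *s cvec (\<psi> j))"
  proof -
    have "{..<b} = {0..a - 1} \<union> {a..b - 1}" "{0..a - 1} \<inter> {a..b - 1} = {}" using a_pos a_le_b by auto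
    thus ?thesis by (simp add: sum.union_disjoint)
  qed
  show ?thesis
    unfolding C term_eq idle_gf_eq[symmetric] swap[symmetric] split
    by (simp add: sum.distrib sum_subtractf vector_matrix_mult_diff_rdistrib vm_mat algebra_simps)
qed

text \<open>The equation for \<open>visit_vec_gf\<close> is multiplied by
  \<open>A_gf D s b z\<close> from the right before it is solved. It thereby becomes an equation for
  the wanted series, and that factor ends up to the left of the inverse.\<close>

lemma piplus_b_closed_form:
  assumes z: "norm z \<le> 1" and inv: "invertible (mat (z ^ b) - A_gf D s b z)"
  shows "(\<lambda>n. z ^ n *s cvec (piplus n b)) sums
     ((((\<Sum>r=a..b - 1. cvec (visit_vec r) v* A_gf D s r z)
    - (\<Sum>n<b. z ^ n *s cvec (\<psi> n)) + (\<Sum>j=0..a - 1. z ^ b *s (cvec (\<psi> j) v* cmat (C_mat D a b j)))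
    + (\<Sum>l'<a. z ^ l' *s (cvec (level_law l') v* tau D (b + 1 - l') z))))
     v* (A_gf D s b z ** matrix_inv (mat (z ^ b) - A_gf D s b z)))" (is "_ sums (?R v* _)")
proof -
  let ?A = "A_gf D s b z" and ?S = "visit_vec_gf z v* A_gf D s b z"
  have "z ^ b *s ?S = (z ^ b *s visit_vec_gf z) v* ?A" by (simp only: scalar_vector_matrix_assoc)
  also have "z ^ b *s visit_vec_gf z = ?R + ?S" unfolding visit_vec_gf_eq[OF z] by (simp add: algebra_simps)
  finally have "?S v* (mat (z ^ b) - ?A) = ?R v* ?A"
    by (simp add: vector_matrix_mult_diff_rdistrib vm_mat vector_matrix_left_distrib)
  hence "?S v* (mat (z ^ b) - ?A) v* matrix_inv (mat (z ^ b) - ?A) = ?R v* ?A v* matrix_inv (mat (z ^ b) - ?A)"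
    by simp
  hence "?S = ?R v* (?A ** matrix_inv (mat (z ^ b) - ?A))"
    by (simp add: vector_matrix_mul_assoc matrix_mul_assoc[symmetric] mult_matrix_inv[OF inv])
  thus ?thesis using piplus_b_sums[OF z] by simp
qed

lemma piplus_lt_coeff:
  assumes "a \<le> r" "r < b"
  shows "cvec (piplus n r) = cvec (visit_vec r) v* A_coeff D s r n"
  using assms A_coeff_eq[of s r n, OF service_dist_prob_space service_dist_nonneg]
  by (simp add: piplus_lt cvec_vm)

lemma visit_vec_eq_psiplus:
  assumes "a \<le> r"
  shows "visit_vec r = (\<Sum>i = 0..a - 1. psiplus a b piplus i v* C_mat D a r i) + psiplus a b piplus r"
  using visit_vec_eq[OF assms] by (simp add: \<psi>_def add.commute)

end

theorem mainTheorem2: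
  fixes M :: "'w measure" and D :: "nat \<Rightarrow> real^'m::finite^'m" and \<pi> :: "real^'m"
    and a b :: nat and s :: "nat \<Rightarrow> real \<Rightarrow> real" and X0 R0 :: "'w \<Rightarrow> nat"
    and H :: "nat \<Rightarrow> 'w \<Rightarrow> real" and B :: "nat \<Rightarrow> 'w \<Rightarrow> nat" and Y :: "nat \<Rightarrow> 'w \<Rightarrow> 'm"
    and V :: "nat \<Rightarrow> nat \<Rightarrow> 'w \<Rightarrow> real" and piplus :: "nat \<Rightarrow> nat \<Rightarrow> real^'m"
  assumes queue: "stationary_bulk_queue M D \<pi> a b s X0 R0 H B Y V piplus"
    and stable: "traffic_intensity D b s \<pi> < 1"
  shows
    "(\<forall>r\<in>{a..b - 1}. \<forall>z. norm z \<le> 1 \<longrightarrow>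
        (\<lambda>n. z ^ n *s cvec (piplus n r)) sums
        (cvec ((\<Sum>i = 0..a - 1. psiplus a b piplus i v* C_mat D a r i) + psiplus a b piplus r)
         v* A_gf D s r z)) \<and>
     (\<forall>r\<in>{a..b - 1}. \<forall>n.
        cvec (piplus n r) =
        cvec ((\<Sum>i = 0..a - 1. psiplus a b piplus i v* C_mat D a r i) + psiplus a b piplus r)
        v* A_coeff D s r n) \<and>
     (\<forall>z. norm z \<le> 1 \<and> invertible (mat (z ^ b) - A_gf D s b z) \<longrightarrow>
        (\<lambda>n. z ^ n *s cvec (piplus n b)) sums
        (((\<Sum>j = 0..a - 1. cvec (psiplus a b piplus j) v*
             ((\<Sum>l = a..b. cmat (C_mat D a l j) ** A_gf D s l z)
              - cmat (C_mat D a b j) ** A_gf D s b z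
              + (cmat (C_mat D a b j) ** mat (z ^ b)
                 + (\<Sum>i = b - a + 2..b + 1 - j.
                      cmat (Q_mat D (b + 1 - j - i)) ** tau D i z ** mat (z ^ (b + 1 - i)))
                 - mat (z ^ j))))
          + (\<Sum>j = a..b - 1. cvec (psiplus a b piplus j) v* (A_gf D s j z - mat (z ^ j))))
         v* (A_gf D s b z ** matrix_inv (mat (z ^ b) - A_gf D s b z))))"
proof -
  interpret stationary_bulk_queue M D \<pi> a b s X0 R0 H B Y V piplus by (rule queue)
  have lt: "a \<le> r" "r < b" if "r \<in> {a..b - 1}" for r
    using that a_pos a_le_b by auto
  show ?thesis
  proof (intro conjI ballI allI impI)
    fix r z assume "r \<in> {a..b - 1}" "norm (z :: complex) \<le> 1"
    thus "(\<lambda>n. z ^ n *s cvec (piplus n r)) sums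
        (cvec ((\<Sum>i = 0..a - 1. psiplus a b piplus i v* C_mat D a r i) + psiplus a b piplus r) v* A_gf D s r z)"
      using piplus_lt_sums[of r z] by (simp only: lt visit_vec_eq_psiplus)
  next
    fix r n assume "r \<in> {a..b - 1}"
    thus "cvec (piplus n r) =
        cvec ((\<Sum>i = 0..a - 1. psiplus a b piplus i v* C_mat D a r i) + psiplus a b piplus r) v* A_coeff D s r n"
      using piplus_lt_coeff[of r n] by (simp only: lt visit_vec_eq_psiplus)
  qed (use piplus_b_closed_form[folded bracket_eq] in \<open>simp only: \<psi>_def\<close>)
qed

end
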